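(* There exists $\eta > 0$ such that if $s \in (0,2)$ then there exists a probability measure $\nu$ supported on $\mathcal{B}$ with the following two properties: (i) (Large Frostman dimension) For any ball $I$ of radius $r(I)$, we have $\nu(I) \ll_s r(I)^s$. (ii) (Polynomial Fourier decay) For any $\boldsymbol{\xi} \in \mathbb{Z}^2$, we have $\widehat{\nu}(\boldsymbol{\xi}) \ll_\eta (1 + \|\boldsymbol{\xi}\|_\infty)^{-\eta}$.
   Context: For $x\in\mathbb{R}$, $\|x\|$ denotes the distance from $x$ to the nearest integer, and $\mathbb{N}=\{1,2,\ldots\}$. $\mathbf{Bad} = \{\alpha \in \mathbb{R} : \inf_{n\in\mathbb{N}} n\|n\alpha\| > 0\}$, and for $\gamma\in\mathbb{R}$, $\mathbf{Bad}_\gamma = \{\alpha\in\mathbb{R} : \inf_{n\in\mathbb{N}} n\|n\alpha-\gamma\|>0\}$. $\mathcal{B} = \{(\alpha,\gamma)\in\mathbb{R}^2 : \alpha\in\mathbf{Bad}\cap\mathbf{Bad}_\gamma\}$. A probability measure $\nu$ is supported on a set $F$ if $\nu(F)=1$. The Fourier transform is $\widehat{\nu}(\boldsymbol{\xi}) = \int_{\mathbb{R}^2} e(-\boldsymbol{\xi}\cdot\mathbf{x})\,d\nu(\mathbf{x})$ with $e(x)=e^{2\pi i x}$, and $\|\boldsymbol{\xi}\|_\infty=\max(|\xi_1|,|\xi_2|)$. The notation $f \ll g$ means $|f|\le c|g|$ for some constant $c>0$; a subscript names the parameter on which the constant depends, so the constant in (i) depends only on $s$ and the constant in (ii) depends only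 on $\eta$. *)

theory Defs
  imports "HOL-Probability.Probability"
begin

definition dist_nearest_int :: "real \<Rightarrow> real" where
  "dist_nearest_int x = \<bar>x - of_int (round x)\<bar>"

lemma dist_nearest_int_le: "dist_nearest_int x \<le> \<bar>x - of_int k\<bar>"
  unfolding dist_nearest_int_def
  using round_diff_minimal[of x k] by (simp add: abs_minus_commute)

(* The natural numbers start at 1 here, hence the index set {1..}.
   The infimum is that of a nonempty set of nonnegative reals. *)
definition Bad_shift :: "real \<Rightarrow> real set" where
  "Bad_shift \<gamma> = {\<alpha>. (INF n\<in>{1::nat..}. real n * dist_nearest_int (real n * \<alpha> - \<gamma>)) > 0}"

definition Bad :: "real set" where
  "Bad = {\<alpha>. (INF n\<in>{1::nat..}. real n * dist_nearest_int (real n * \<alpha>)) > 0}"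

definition Bad_pairs :: "(real \<times> real) set" where
  "Bad_pairs = {(\<alpha>, \<gamma>). \<alpha> \<in> Bad \<inter> Bad_shift \<gamma>}"

(* Borel probability measures; for a non-measurable F the library sets
   measure \<nu> F = 0, so the last condition includes measurability of F. *)
definition prob_measure_supported_on :: "(real \<times> real) measure \<Rightarrow> (real \<times> real) set \<Rightarrow> bool" where
  "prob_measure_supported_on \<nu> F \<longleftrightarrow> prob_space \<nu> \<and> sets \<nu> = sets borel \<and> measure \<nu> F = 1"

definition exp2pi :: "real \<Rightarrow> complex" where
  "exp2pi x = exp (2 * of_real pi * \<i> * of_real x)"

definition fourier :: "(real \<times> real) measure \<Rightarrow> real \<times> real \<Rightarrow> complex" where
  "fourier \<nu> \<xi> = (LINT x|\<nu>. exp2pi (- (\<xi> \<bullet> x)))"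

lemma infnorm_real_pair: "infnorm (x :: real, y :: real) = max \<bar>x\<bar> \<bar>y\<bar>"
proof -
  have "{\<bar>(x, y) \<bullet> b\<bar> |b. b \<in> Basis} = (\<lambda>b. \<bar>(x, y) \<bullet> b\<bar>) ` Basis"
    by (rule Setcompr_eq_image)
  also have "\<dots> = {\<bar>x\<bar>, \<bar>y\<bar>}"
    by (simp add: Basis_prod_def insert_commute)
  finally have "infnorm (x, y) = Sup {\<bar>x\<bar>, \<bar>y\<bar>}"
    unfolding infnorm_def by (rule arg_cong)
  then show ?thesis by (simp add: cSup_eq_Max)
qed

end

theory Submission
  imports Defs
begin

text \<open>
Badly approximable pairs are produced by iterating integer maps.  An integer matrix of
determinant one, extended by a translation row, acts on the plane by
(x, y) \<mapsto> ((p x + p') / (q x + q'), (u x + u' + y) / (q x + q')), and it maps every line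
y = n x - m with integer n, m to a line of the same kind.  If finitely many such maps,
with bounded slopes, send a suitably placed rectangle into itself, then pulling a line back through a long enough prefix of the
coding of a limit point (x, y) turns it into one of boundedly many lines, all of which stay
away from the rectangle.  Hence n |n x - y - m| is bounded below, and likewise n |n x - m|
(lemma limit_point_bad).

For each large R there is an alphabet of at least 28 R^3 such maps with q x + q' between 32 R and
68 R, and with disjoint images of the rectangle (lemma letter_system_letters).  The Jacobian of a
map is (q x + q')^(-3), so up to a factor 16384 which does not depend on R the images fill the
rectangle.  Let \<nu> be the law of the limit point whose coding is independent and uniform on the
alphabet.  Averaging a function over all words of length k compares \<nu> with Lebesgue measure
at scale (32 R)^(-k), with a loss of at most a constant multiple of 16384^k (lemma
integral_stat_le).  As R grows this loss becomes an arbitrarily small power of the scale.  Applied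
to the indicator of a ball, the comparison gives Frostman exponents as close to 2 as desired.

For Fourier decay, stationarity gives \<nu>^(\<xi>) = \<integral> F d\<nu>, where F averages
exp(- 2 \<pi> i \<xi> \<cdot> f_w) over the words w of length n.  By Cauchy-Schwarz and the
comparison with Lebesgue measure it suffices to save a power of |\<xi>| in the Lebesgue mean square
of F; this power is independent of R, so it absorbs the loss.  Expanding the square gives an
oscillatory integral for each pair of words.  Two words whose maps have the same denominator use
the same Moebius parts, which is rare.  For the other pairs the two denominators differ by a
nonzero integral linear form, so the phase oscillates: along y if \<xi> has a large second
coordinate, and along x otherwise.  The word length is chosen with the denominators at most
|\<xi>|^(1/24), so that they are negligible against |\<xi>|.

This yields |\<nu>^(\<xi>)| \<le> C |\<xi>|^(-1/96), where C depends on R and therefore on s.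
To make the constant absolute, \<nu> is pushed forward by (x, y) \<mapsto> (K^2 x, y + K x).
This preserves the set of bad pairs and replaces an integer frequency (m, n) by
(K^2 m + K n, n), whose size is at least K and at least the square root of the size of (m, n)
(lemma shear_frequency).  If K is large in terms of C, half of the decay exponent
pays for C and the other half gives decay with exponent 1/384.
\<close>

section \<open>Projective integer maps of the plane\<close>

text \<open>
A map is stored by its integer entries: the matrix with rows (pa, pb) and (qa, qb) acts on the first
coordinate as a Moebius transformation, and (ua, ub) is the translation row.  In
homogeneous coordinates (x, y, 1) it is a 3 by 3 integer matrix whose y column is (0, 1, 0).
\<close>

datatype pmap = PMap (pa: int) (pb: int) (qa: int) (qb: int) (ua: int) (ub: int)

definition den :: "pmap \<Rightarrow> real \<Rightarrow> real" where
  "den g x = real_of_int (qa g) * x + real_of_int (qb g)"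

definition mob :: "pmap \<Rightarrow> real \<Rightarrow> real" where
  "mob g x = (real_of_int (pa g) * x + real_of_int (pb g)) / den g x"

definition act :: "pmap \<Rightarrow> real \<times> real \<Rightarrow> real \<times> real" where
  "act g z = (mob g (fst z), (real_of_int (ua g) * fst z + real_of_int (ub g) + snd z) / den g (fst z))"

text \<open>
Up to the factor - den, the slope is the partial derivative of the second coordinate of the
image with respect to x.  Integer lines are controlled through it, because the pullback
of y = n x - m has slope n / den + slope, up to a small error.
\<close>

definition slope :: "pmap \<Rightarrow> real \<times> real \<Rightarrow> real" where
  "slope g z = real_of_int (qa g) * snd (act g z) - real_of_int (ua g)"

definition id_pmap :: pmap where
  "id_pmap = PMap 1 0 0 1 0 0"

definition pcomp :: "pmap \<Rightarrow> pmap \<Rightarrow> pmap" where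
  "pcomp g h = PMap (pa g * pa h + pb g * qa h) (pa g * pb h + pb g * qb h)
                   (qa g * pa h + qb g * qa h) (qa g * pb h + qb g * qb h)
                   (ua g * pa h + ub g * qa h + ua h) (ua g * pb h + ub g * qb h + ub h)"

definition mob_entries :: "pmap \<Rightarrow> int \<times> int \<times> int \<times> int" where
  "mob_entries g = (pa g, pb g, qa g, qb g)"

text \<open>
The rectangle is thin in x and its y-range avoids 0 and 1.  Hence A x - y stays at distance at
least 1/16 from the integers for A = 0, 1, 2, 3, and these are the only slopes that occur when
lines are pulled back to scale one.
\<close>

definition rect :: "(real \<times> real) set" where
  "rect = {0..1/16} \<times> {1/4..3/4}"

lemma fst_act [simp]: "fst (act g z) = mob g (fst z)"
  by (simp add: act_def)

lemma id_pmap_simps [simp]: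
  "den id_pmap x = 1" "mob id_pmap x = x" "act id_pmap z = z" "slope id_pmap z = 0"
  by (simp_all add: id_pmap_def den_def mob_def act_def slope_def)

text \<open>
Clearing denominators in this form lets the identities below be checked by linear algebra
in the quantity mob h x, without expanding quotients.
\<close>

lemma mob_times_den:
  assumes "den h x \<noteq> 0"
  shows "real_of_int (pa h) * x + real_of_int (pb h) = mob h x * den h x"
  using assms by (simp add: mob_def)

lemma den_comp:
  assumes "den h x \<noteq> 0"
  shows "den (pcomp g h) x = den g (mob h x) * den h x"
proof -
  have "den (pcomp g h) x = qa g * (real_of_int (pa h) * x + real_of_int (pb h)) + qb g * den h x"
    by (simp add: den_def pcomp_def algebra_simps)
  then show ?thesis
    unfolding mob_times_den [OF assms] by (simp add: den_def [of g] algebra_simps)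
qed

lemma mob_comp:
  assumes "den h x \<noteq> 0"
  shows "mob (pcomp g h) x = mob g (mob h x)"
proof -
  have "real_of_int (pa (pcomp g h)) * x + real_of_int (pb (pcomp g h))
      = pa g * (real_of_int (pa h) * x + real_of_int (pb h)) + pb g * den h x"
    by (simp add: den_def pcomp_def algebra_simps)
  also have "\<dots> = (pa g * mob h x + pb g) * den h x"
    unfolding mob_times_den [OF assms] by (simp add: algebra_simps)
  finally show ?thesis
    using assms by (simp add: mob_def [of g] mob_def [of "pcomp g h"] den_comp)
qed

lemma act_comp:
  assumes "den h (fst z) \<noteq> 0"
  shows "act (pcomp g h) z = act g (act h z)"
proof -
  have Y: "real_of_int (ua h) * fst z + ub h + snd z = snd (act h z) * den h (fst z)"
    using assms by (simp add: act_def)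
  have "real_of_int (ua (pcomp g h)) * fst z + ub (pcomp g h) + snd z
      = ua g * (real_of_int (pa h) * fst z + real_of_int (pb h)) + ub g * den h (fst z)
        + (real_of_int (ua h) * fst z + ub h + snd z)"
    by (simp add: den_def pcomp_def algebra_simps)
  also have "\<dots> = (ua g * mob h (fst z) + ub g + snd (act h z)) * den h (fst z)"
    unfolding mob_times_den [OF assms] Y by (simp add: algebra_simps)
  finally show ?thesis
    using assms by (simp add: act_def [of g] act_def [of "pcomp g h"] mob_comp den_comp)
qed

text \<open>
This is the chain rule for the derivative in x.  The first term is divided by a large
denominator, which keeps the slopes of arbitrarily long words bounded.
\<close>

lemma slope_comp:
  assumes "den h (fst z) \<noteq> 0" "den g (mob h (fst z)) \<noteq> 0"
    and det: "pa h * qb h - pb h * qa h = 1"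
  shows "slope (pcomp g h) z = slope g (act h z) / den h (fst z) + slope h z"
proof -
  define D where "D = den h (fst z)"
  define w where "w = snd (act g (act h z))"
  define Y where "Y = snd (act h z)"
  define m where "m = mob h (fst z)"
  have D: "D = qa h * fst z + qb h" "D \<noteq> 0"
    using assms by (auto simp: D_def den_def)
  have m: "m * D = pa h * fst z + pb h"
    using D by (simp add: m_def mob_def D_def)
  have det': "real_of_int (pa h) * qb h - pb h * qa h = 1"
    using det by (metis of_int_1 of_int_diff of_int_mult)
  have "(pa h - m * qa h) * D = pa h * D - (m * D) * qa h"
    by (simp add: algebra_simps)
  also have "\<dots> = 1"
    using det' unfolding m unfolding D(1) by (simp add: algebra_simps)
  finally have mp: "pa h - m * qa h = 1 / D"
    using D(2) by (simp add: field_simps)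
  have w: "w * den g m = ua g * m + ub g + Y"
    using assms(2) by (simp add: w_def act_def [of g] m_def Y_def)
  have "slope (pcomp g h) z = (qa g * pa h + qb g * qa h) * w - (ua g * pa h + ub g * qa h + ua h)"
    using assms(1) by (simp add: slope_def act_comp w_def) (simp add: pcomp_def)
  also have "\<dots> = (qa g * w - ua g) * (pa h - m * qa h) + qa h * Y - ua h
      + qa h * (w * den g m - (ua g * m + ub g + Y))"
    by (simp add: algebra_simps den_def)
  also have "\<dots> = (qa g * w - ua g) / D + (qa h * Y - ua h)"
    by (simp add: w mp)
  finally show ?thesis
    by (simp add: slope_def w_def Y_def D_def)
qed

lemma mob_diff:
  assumes "den g x \<noteq> 0" "den g y \<noteq> 0" and det: "pa g * qb g - pb g * qa g = 1"
  shows "mob g x - mob g y = (x - y) / (den g x * den g y)"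
proof -
  have det': "real_of_int (pa g) * qb g - pb g * qa g = 1"
    using det by (metis of_int_1 of_int_diff of_int_mult)
  have "mob g x - mob g y
      = ((real_of_int (pa g) * x + pb g) * den g y - (real_of_int (pa g) * y + pb g) * den g x) / (den g x * den g y)"
    using assms by (simp add: mob_def diff_frac_eq)
  also have "(real_of_int (pa g) * x + pb g) * den g y - (real_of_int (pa g) * y + pb g) * den g x
      = (real_of_int (pa g) * qb g - pb g * qa g) * (x - y)"
    by (simp add: den_def algebra_simps)
  finally show ?thesis by (simp only: det' mult_1)
qed

lemma snd_act_diff:
  assumes "den g (fst z) \<noteq> 0" "den g (fst w) \<noteq> 0"
  shows "snd (act g z) - snd (act g w)
    = ((snd z - snd w) - slope g w * (fst z - fst w)) / den g (fst z)"
proof -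
  have w: "snd (act g w) * den g (fst w) = ua g * fst w + ub g + snd w"
    and z: "snd (act g z) * den g (fst z) = ua g * fst z + ub g + snd z"
    using assms by (auto simp: act_def)
  have "(snd (act g z) - snd (act g w)) * den g (fst z)
      = (snd z - snd w) - slope g w * (fst z - fst w)"
    using w z by (simp add: slope_def den_def algebra_simps)
  then show ?thesis using assms by (simp add: field_simps)
qed

section \<open>Systems of letters and their words\<close>

lemma rect_iff: "z \<in> rect \<longleftrightarrow> fst z \<in> {0..1/16} \<and> snd z \<in> {1/4..3/4}"
  by (cases z) (simp add: rect_def)

text \<open>
The sum metric is the one in which the maps of a letter system are visibly contracting.
\<close>

definition ldist :: "real \<times> real \<Rightarrow> real \<times> real \<Rightarrow> real" where
  "ldist z w = \<bar>fst z - fst w\<bar> + \<bar>snd z - snd w\<bar>"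

lemma dist_le_ldist: "dist z w \<le> ldist z w"
  unfolding ldist_def dist_prod_def dist_real_def
  using sqrt_sum_squares_le_sum_abs [of "\<bar>fst z - fst w\<bar>" "\<bar>snd z - snd w\<bar>"] by simp

text \<open>
The bounds on the denominator give the contraction, the cardinality gives the dimension, and
the two disjointness conditions are used at different places: disjoint images of the rectangle in
the comparison with Lebesgue measure, and disjoint Moebius images in counting the words
with a given denominator.  The fibre condition says that a letter is determined by its Moebius part
up to about R choices of the translation row, against about R^3 letters in total.
\<close>

locale letter_system =
  fixes R :: nat and G :: "pmap set"
  assumes R_ge: "10 \<le> R"
    and finite_G: "finite G"
    and card_G: "28 * R ^ 3 \<le> card G"
    and card_fibre: "card {g \<in> G. mob_entries g = m} \<le> 4 * R"
    and det: "g \<in> G \<Longrightarrow> pa g * qb g - pb g * qa g = 1"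
    and pa_le: "g \<in> G \<Longrightarrow> 0 \<le> pa g \<and> pa g \<le> pb g"
    and qa_le: "g \<in> G \<Longrightarrow> 0 \<le> qa g \<and> qa g \<le> qb g"
    and den_bounds: "g \<in> G \<Longrightarrow> x \<in> {0..1/16} \<Longrightarrow> 32 * real R \<le> den g x \<and> den g x \<le> 68 * real R"
    and act_rect: "g \<in> G \<Longrightarrow> z \<in> rect \<Longrightarrow> act g z \<in> rect"
    and slope_bounds: "g \<in> G \<Longrightarrow> z \<in> rect \<Longrightarrow> 0 \<le> slope g z \<and> slope g z \<le> 2"
    and act_disjoint: "\<lbrakk>g \<in> G; h \<in> G; z \<in> rect; w \<in> rect; act g z = act h w\<rbrakk> \<Longrightarrow> g = h"
    and mob_disjoint: "\<lbrakk>g \<in> G; h \<in> G; x \<in> {0..1/16}; y \<in> {0..1/16}; mob g x = mob h y\<rbrakk>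
      \<Longrightarrow> mob_entries g = mob_entries h"
begin

text \<open>
These are the properties of a letter that survive composition, with the constants
adjusted: k counts the letters, and the bound 2 for the slope is relaxed to 3 because
3/32 + 2 \<le> 3.
\<close>

definition admissible :: "nat \<Rightarrow> pmap \<Rightarrow> bool" where
  "admissible k g \<longleftrightarrow> pa g * qb g - pb g * qa g = 1 \<and> 0 \<le> qa g \<and> qa g \<le> qb g \<and>
     (\<forall>x\<in>{0..1/16}. (32 * real R) ^ k \<le> den g x \<and> den g x \<le> (68 * real R) ^ k) \<and>
     (\<forall>z\<in>rect. act g z \<in> rect \<and> 0 \<le> slope g z \<and> slope g z \<le> 3)"

lemma mob_mem: "g \<in> G \<Longrightarrow> x \<in> {0..1/16} \<Longrightarrow> mob g x \<in> {0..1/16}"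
  using act_rect [of g "(x, 1/2)"] by (auto simp: rect_iff)

lemma admissible_id: "admissible 0 id_pmap"
  by (simp add: admissible_def) (simp add: id_pmap_def)

lemma admissible_comp:
  assumes g: "admissible k g" and h: "h \<in> G"
  shows "admissible (Suc k) (pcomp g h)"
  unfolding admissible_def
proof (intro conjI ballI)
  have dg: "pa g * qb g - pb g * qa g = 1" and q: "0 \<le> qa g" "qa g \<le> qb g"
    using g by (auto simp: admissible_def)
  have "pa (pcomp g h) * qb (pcomp g h) - pb (pcomp g h) * qa (pcomp g h)
      = (pa g * qb g - pb g * qa g) * (pa h * qb h - pb h * qa h)"
    by (simp add: pcomp_def algebra_simps)
  then show "pa (pcomp g h) * qb (pcomp g h) - pb (pcomp g h) * qa (pcomp g h) = 1"
    using dg det [OF h] by simp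
  show "0 \<le> qa (pcomp g h)"
    using q pa_le [OF h] qa_le [OF h] by (simp add: pcomp_def)
  show "qa (pcomp g h) \<le> qb (pcomp g h)"
    using q pa_le [OF h] qa_le [OF h] by (auto simp: pcomp_def intro!: add_mono mult_left_mono)
next
  fix x :: real assume x: "x \<in> {0..1/16}"
  have b: "(32 * real R) ^ k \<le> den g (mob h x)" "den g (mob h x) \<le> (68 * real R) ^ k"
    using g mob_mem [OF h x] by (auto simp: admissible_def)
  have h': "32 * real R \<le> den h x" "den h x \<le> 68 * real R"
    using den_bounds [OF h x] by auto
  have "den h x \<noteq> 0" using h' R_ge by auto
  then have eq: "den (pcomp g h) x = den h x * den g (mob h x)"
    by (simp add: den_comp)
  show "(32 * real R) ^ Suc k \<le> den (pcomp g h) x"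
    unfolding eq using b h' by (auto intro!: mult_mono)
  show "den (pcomp g h) x \<le> (68 * real R) ^ Suc k"
    unfolding eq power_Suc using b h' R_ge
    by (intro mult_mono) (auto intro: order_trans [rotated])
next
  fix z :: "real \<times> real" assume z: "z \<in> rect"
  then have x: "fst z \<in> {0..1/16}" by (simp add: rect_iff)
  have D: "32 * real R \<le> den h (fst z)" using den_bounds [OF h x] by simp
  then have D32: "32 \<le> den h (fst z)" using R_ge by linarith
  then have nz: "den h (fst z) \<noteq> 0" by auto
  have az: "act h z \<in> rect" by (rule act_rect [OF h z])
  have "(32 * real R) ^ k \<le> den g (mob h (fst z))"
    using g mob_mem [OF h x] by (auto simp: admissible_def)
  moreover have "0 < (32 * real R) ^ k" using R_ge by simp
  ultimately have nz': "den g (mob h (fst z)) \<noteq> 0" by linarith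
  show "act (pcomp g h) z \<in> rect"
    using g az by (simp add: act_comp [OF nz] admissible_def)
  have sg: "0 \<le> slope g (act h z)" "slope g (act h z) \<le> 3"
    using g az by (auto simp: admissible_def)
  have eq: "slope (pcomp g h) z = slope g (act h z) / den h (fst z) + slope h z"
    by (rule slope_comp [OF nz nz' det [OF h]])
  have "slope g (act h z) / den h (fst z) \<le> 3 / 32"
    using sg D32 by (intro frac_le) auto
  moreover have "0 \<le> slope g (act h z) / den h (fst z)"
    using sg D32 by (intro divide_nonneg_nonneg) auto
  ultimately show "0 \<le> slope (pcomp g h) z" "slope (pcomp g h) z \<le> 3"
    using slope_bounds [OF h z] unfolding eq by linarith+
qed

lemma admissibleD:
  assumes "admissible k g"
  shows "pa g * qb g - pb g * qa g = 1" "0 \<le> qa g" "qa g \<le> qb g"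
    and "x \<in> {0..1/16} \<Longrightarrow> (32 * real R) ^ k \<le> den g x"
    and "x \<in> {0..1/16} \<Longrightarrow> den g x \<le> (68 * real R) ^ k"
    and "x \<in> {0..1/16} \<Longrightarrow> 1 \<le> den g x"
    and "x \<in> {0..1/16} \<Longrightarrow> mob g x \<in> {0..1/16}"
    and "z \<in> rect \<Longrightarrow> act g z \<in> rect"
    and "z \<in> rect \<Longrightarrow> 0 \<le> slope g z" "z \<in> rect \<Longrightarrow> slope g z \<le> 3"
proof -
  show "pa g * qb g - pb g * qa g = 1" "0 \<le> qa g" "qa g \<le> qb g"
    using assms by (auto simp: admissible_def)
  show lb: "(32 * real R) ^ k \<le> den g x" if "x \<in> {0..1/16}"
    using assms that by (auto simp: admissible_def)
  show "den g x \<le> (68 * real R) ^ k" if "x \<in> {0..1/16}"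
    using assms that by (auto simp: admissible_def)
  have "1 \<le> (32 * real R) ^ k" using R_ge by (intro one_le_power) auto
  then show "1 \<le> den g x" if "x \<in> {0..1/16}"
    using lb [OF that] by linarith
  show "z \<in> rect \<Longrightarrow> act g z \<in> rect" "z \<in> rect \<Longrightarrow> 0 \<le> slope g z" "z \<in> rect \<Longrightarrow> slope g z \<le> 3"
    using assms by (auto simp: admissible_def)
  show "mob g x \<in> {0..1/16}" if "x \<in> {0..1/16}"
  proof -
    have "(x, 1/2) \<in> rect" using that by (simp add: rect_iff)
    then have "act g (x, 1/2) \<in> rect"
      using assms by (auto simp: admissible_def)
    then show ?thesis by (simp add: rect_iff)
  qed
qed

text \<open>
Images of the rectangle are as anisotropic as their denominators D suggest: they have width of
order 1/D^2 in x but height of order 1/D in y.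
\<close>

lemma cell_bounds:
  assumes g: "admissible k g" and z: "z \<in> rect" and w: "w \<in> rect"
  shows "\<bar>mob g (fst z) - mob g (fst w)\<bar> \<le> \<bar>fst z - fst w\<bar> / (32 * real R) ^ k / (32 * real R) ^ k"
    and "\<bar>snd (act g z) - snd (act g w)\<bar>
           \<le> (\<bar>snd z - snd w\<bar> + 3 * \<bar>fst z - fst w\<bar>) / (32 * real R) ^ k"
proof -
  have P: "1 \<le> (32 * real R) ^ k" using R_ge by (intro one_le_power) auto
  have x: "fst z \<in> {0..1/16}" "fst w \<in> {0..1/16}" using z w by (auto simp: rect_iff)
  have D: "(32 * real R) ^ k \<le> den g (fst z)" "(32 * real R) ^ k \<le> den g (fst w)"
    using admissibleD(4) [OF g] x by auto
  have nz: "den g (fst z) \<noteq> 0" "den g (fst w) \<noteq> 0" using D P by auto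
  have "\<bar>mob g (fst z) - mob g (fst w)\<bar> = \<bar>fst z - fst w\<bar> / (den g (fst z) * den g (fst w))"
    using D P by (simp add: mob_diff [OF nz admissibleD(1) [OF g]] abs_mult)
  also have "\<dots> \<le> \<bar>fst z - fst w\<bar> / ((32 * real R) ^ k * (32 * real R) ^ k)"
    using D P by (intro divide_left_mono mult_mono mult_pos_pos) auto
  finally show "\<bar>mob g (fst z) - mob g (fst w)\<bar>
      \<le> \<bar>fst z - fst w\<bar> / (32 * real R) ^ k / (32 * real R) ^ k"
    by simp
  have s: "0 \<le> slope g w" "slope g w \<le> 3" using admissibleD(9,10) [OF g w] by auto
  have "\<bar>snd (act g z) - snd (act g w)\<bar>
      = \<bar>(snd z - snd w) - slope g w * (fst z - fst w)\<bar> / den g (fst z)"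
    using D P by (simp add: snd_act_diff [OF nz])
  also have "\<dots> \<le> (\<bar>snd z - snd w\<bar> + 3 * \<bar>fst z - fst w\<bar>) / (32 * real R) ^ k"
  proof (intro frac_le)
    have "\<bar>slope g w * (fst z - fst w)\<bar> \<le> 3 * \<bar>fst z - fst w\<bar>"
      unfolding abs_mult using s by (intro mult_right_mono) auto
    then show "\<bar>(snd z - snd w) - slope g w * (fst z - fst w)\<bar> \<le> \<bar>snd z - snd w\<bar> + 3 * \<bar>fst z - fst w\<bar>"
      by linarith
  qed (use D P in auto)
  finally show "\<bar>snd (act g z) - snd (act g w)\<bar>
      \<le> (\<bar>snd z - snd w\<bar> + 3 * \<bar>fst z - fst w\<bar>) / (32 * real R) ^ k" .
qed

lemma admissible_letter: "g \<in> G \<Longrightarrow> admissible 1 g"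
  unfolding admissible_def using det qa_le den_bounds act_rect slope_bounds by fastforce

lemma ldist_cell:
  assumes g: "admissible k g" and z: "z \<in> rect" and w: "w \<in> rect"
  shows "ldist (act g z) (act g w) \<le> 1 / (32 * real R) ^ k"
proof -
  define P where "P = (32 * real R) ^ k"
  have P: "1 \<le> P" unfolding P_def using R_ge by (intro one_le_power) auto
  have b: "\<bar>fst z - fst w\<bar> \<le> 1/16" "\<bar>snd z - snd w\<bar> \<le> 1/2"
    using z w unfolding rect_iff by (simp_all only: atLeastAtMost_iff abs_le_iff) linarith+
  have 1: "\<bar>mob g (fst z) - mob g (fst w)\<bar> \<le> \<bar>fst z - fst w\<bar> / P / P"
    using cell_bounds(1) [OF assms] by (simp add: P_def)
  have "\<bar>fst z - fst w\<bar> / P / P \<le> \<bar>fst z - fst w\<bar> / P / 1"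
    using P by (intro divide_left_mono) auto
  also have "\<dots> \<le> (1/16) / P"
    unfolding div_by_1 using P b by (intro divide_right_mono) auto
  finally have 1: "\<bar>mob g (fst z) - mob g (fst w)\<bar> \<le> (1/16) / P"
    using 1 by linarith
  have 2: "\<bar>snd (act g z) - snd (act g w)\<bar> \<le> (\<bar>snd z - snd w\<bar> + 3 * \<bar>fst z - fst w\<bar>) / P"
    using cell_bounds(2) [OF assms] by (simp add: P_def)
  also have "\<dots> \<le> (11/16) / P"
    using P b by (intro divide_right_mono) auto
  finally have "ldist (act g z) (act g w) \<le> (1/16) / P + (11/16) / P"
    using 1 by (simp add: ldist_def)
  also have "\<dots> \<le> 1 / P" using P by (simp add: field_simps)
  finally show ?thesis by (simp add: P_def)
qed

lemma ldist_letter: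
  assumes g: "g \<in> G" and z: "z \<in> rect" and w: "w \<in> rect"
  shows "ldist (act g z) (act g w) \<le> ldist z w / 8"
proof -
  note b = cell_bounds [OF admissible_letter [OF g] z w]
  have R: "320 \<le> 32 * real R" using R_ge by simp
  have "\<bar>fst z - fst w\<bar> / (32 * real R) / (32 * real R) \<le> \<bar>fst z - fst w\<bar> / 320 / 1"
    using R by (intro frac_le) auto
  moreover have "(\<bar>snd z - snd w\<bar> + 3 * \<bar>fst z - fst w\<bar>) / (32 * real R)
      \<le> (\<bar>snd z - snd w\<bar> + 3 * \<bar>fst z - fst w\<bar>) / 320"
    using R by (intro frac_le) auto
  moreover have "A + B \<le> (c + d) / 8"
    if "A \<le> P" "P \<le> c / 320 / 1" "B \<le> Q" "Q \<le> (d + 3 * c) / 320" "0 \<le> c" "0 \<le> d"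
    for A B c d P Q :: real
    using that by simp
  ultimately show ?thesis
    using b unfolding ldist_def fst_act power_one_right by (meson abs_ge_zero)
qed

lemma ldist_admissible:
  assumes g: "admissible k g" and z: "z \<in> rect" and w: "w \<in> rect"
  shows "ldist (act g z) (act g w) \<le> 4 * ldist z w"
proof -
  define P where "P = (32 * real R) ^ k"
  have P: "1 \<le> P" unfolding P_def using R_ge by (intro one_le_power) auto
  have 1: "\<bar>mob g (fst z) - mob g (fst w)\<bar> \<le> \<bar>fst z - fst w\<bar> / P / P"
    using cell_bounds(1) [OF assms] by (simp add: P_def)
  also have "\<dots> \<le> \<bar>fst z - fst w\<bar> / 1 / 1"
    using P by (intro frac_le) auto
  finally have 1: "\<bar>mob g (fst z) - mob g (fst w)\<bar> \<le> \<bar>fst z - fst w\<bar>" by simp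
  have 2: "\<bar>snd (act g z) - snd (act g w)\<bar> \<le> (\<bar>snd z - snd w\<bar> + 3 * \<bar>fst z - fst w\<bar>) / P"
    using cell_bounds(2) [OF assms] by (simp add: P_def)
  also have "\<dots> \<le> (\<bar>snd z - snd w\<bar> + 3 * \<bar>fst z - fst w\<bar>) / 1"
    using P by (intro divide_left_mono) auto
  finally have 2: "\<bar>snd (act g z) - snd (act g w)\<bar> \<le> \<bar>snd z - snd w\<bar> + 3 * \<bar>fst z - fst w\<bar>"
    by simp
  have "ldist (act g z) (act g w) \<le> \<bar>fst z - fst w\<bar> + (\<bar>snd z - snd w\<bar> + 3 * \<bar>fst z - fst w\<bar>)"
    unfolding ldist_def fst_act by (rule add_mono [OF 1 2])
  also have "\<dots> \<le> 4 * ldist z w"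
    by (simp add: ldist_def)
  finally show ?thesis .
qed

text \<open>
The head of the list is applied first.  Averaging a function over words of length n + 1 is
then averaging over words of length n followed by one averaging over letters.
\<close>

primrec word :: "pmap list \<Rightarrow> pmap" where
  "word [] = id_pmap"
| "word (a # w) = pcomp (word w) a"

definition words :: "nat \<Rightarrow> pmap list set" where
  "words n = {w. set w \<subseteq> G \<and> length w = n}"

lemma admissible_word: "w \<in> words n \<Longrightarrow> admissible n (word w)"
proof (induction w arbitrary: n)
  case (Cons a w)
  then show ?case
    by (cases n) (auto simp: words_def intro!: admissible_comp)
qed (auto simp: words_def admissible_id)

lemma finite_words [simp]: "finite (words n)"
  unfolding words_def using finite_lists_length_eq [OF finite_G] .

lemma card_words: "card (words n) = card G ^ n"
  unfolding words_def by (rule card_lists_length_eq [OF finite_G])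

lemma words_0: "words 0 = {[]}"
  by (auto simp: words_def)

lemma sum_words_Suc:
  "(\<Sum>w\<in>words (Suc n). f w) = (\<Sum>a\<in>G. \<Sum>w\<in>words n. f (a # w))"
proof -
  have "words (Suc n) = (\<lambda>(a, w). a # w) ` (G \<times> words n)"
    by (auto simp: words_def length_Suc_conv image_iff)
  then have "(\<Sum>w\<in>words (Suc n). f w) = (\<Sum>(a, w)\<in>G \<times> words n. f (a # w))"
    by (subst sum.reindex_cong [where l = "\<lambda>(a, w). a # w"]) (auto intro!: inj_onI)
  also have "\<dots> = (\<Sum>a\<in>G. \<Sum>w\<in>words n. f (a # w))"
    by (simp add: sum.cartesian_product)
  finally show ?thesis .
qed

lemma act_word_Cons:
  assumes "a \<in> G" "z \<in> rect"
  shows "act (word (a # w)) z = act (word w) (act a z)"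
proof -
  have "32 * real R \<le> den a (fst z)" using den_bounds assms by (auto simp: rect_iff)
  then have "den a (fst z) \<noteq> 0" using R_ge by auto
  then show ?thesis by (simp add: act_comp)
qed

lemma card_G_pos: "0 < card G"
  using card_G R_ge by (metis bot_nat_0.not_eq_extremum le_zero_eq mult_is_0 not_numeral_le_zero
      power_not_zero zero_neq_numeral)

end

section \<open>The stationary measure\<close>

lemma continuous_on_act:
  assumes "\<And>z. z \<in> S \<Longrightarrow> den g (fst z) \<noteq> 0"
  shows "continuous_on S (act g)"
  using assms unfolding act_def mob_def den_def by (auto intro!: continuous_intros)

lemma measurable_fst_snd_borel:
  "(fst :: real \<times> real \<Rightarrow> real) \<in> borel_measurable borel"
  "(snd :: real \<times> real \<Rightarrow> real) \<in> borel_measurable borel"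
  by (rule borel_measurable_continuous_onI, rule continuous_on_fst, rule continuous_on_id)
     (rule borel_measurable_continuous_onI, rule continuous_on_snd, rule continuous_on_id)

lemma measurable_act [measurable]: "act g \<in> borel_measurable borel"
proof -
  note [measurable] = measurable_fst_snd_borel
  show ?thesis
    unfolding act_def [abs_def] mob_def den_def by (rule borel_measurable_Pair) measurable
qed

lemma closed_rect: "closed rect" and compact_rect: "compact rect"
  unfolding rect_def by (auto intro: closed_Times compact_Times)

lemma sets_rect [measurable]: "rect \<in> sets borel"
  by (rule borel_closed [OF closed_rect])

context letter_system
begin

lemma continuous_on_admissible: "admissible k g \<Longrightarrow> continuous_on rect (act g)"
  by (rule continuous_on_act) (use admissibleD(6) in \<open>force simp: rect_iff\<close>)

text \<open>
The point (0, 1/2) is an arbitrary starting point in the rectangle; by contraction the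
limit does not depend on it.
\<close>

primrec approx :: "nat \<Rightarrow> pmap stream \<Rightarrow> real \<times> real" where
  "approx 0 \<omega> = (0, 1/2)"
| "approx (Suc n) \<omega> = act (shd \<omega>) (approx n (stl \<omega>))"

definition limit_point :: "pmap stream \<Rightarrow> real \<times> real" where
  "limit_point \<omega> = lim (\<lambda>n. approx n \<omega>)"

lemma shd_stl_streams:
  assumes "\<omega> \<in> streams G"
  shows "shd \<omega> \<in> G" "stl \<omega> \<in> streams G"
  using assms by (cases \<omega>, simp)+

lemma approx_rect: "\<omega> \<in> streams G \<Longrightarrow> approx n \<omega> \<in> rect"
proof (induction n arbitrary: \<omega>)
  case 0
  then show ?case by (simp add: rect_iff)
next
  case (Suc n)
  then show ?case using shd_stl_streams [OF Suc.prems] by (simp add: act_rect)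
qed

lemma ldist_approx: "\<omega> \<in> streams G \<Longrightarrow> ldist (approx (Suc n) \<omega>) (approx n \<omega>) \<le> (1/8) ^ n"
proof (induction n arbitrary: \<omega>)
  case 0
  have "approx 1 \<omega> \<in> rect" "approx 0 \<omega> \<in> rect" using approx_rect [OF 0] by blast+
  then show ?case unfolding rect_iff ldist_def by (auto simp: abs_if)
next
  case (Suc n)
  note s = shd_stl_streams [OF Suc.prems]
  have "ldist (approx (Suc (Suc n)) \<omega>) (approx (Suc n) \<omega>)
      = ldist (act (shd \<omega>) (approx (Suc n) (stl \<omega>))) (act (shd \<omega>) (approx n (stl \<omega>)))"
    by simp
  also have "\<dots> \<le> ldist (approx (Suc n) (stl \<omega>)) (approx n (stl \<omega>)) / 8"
    by (intro ldist_letter s approx_rect)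
  also have "\<dots> \<le> (1/8) ^ n / 8"
    using Suc.IH [OF s(2)] by simp
  finally show ?case by simp
qed

lemma approx_tendsto:
  assumes "\<omega> \<in> streams G"
  shows "(\<lambda>n. approx n \<omega>) \<longlonglongrightarrow> limit_point \<omega>"
proof -
  define d where "d n = approx (Suc n) \<omega> - approx n \<omega>" for n
  have "norm (d n) \<le> (1/8) ^ n" for n
    using order_trans [OF dist_le_ldist ldist_approx [OF assms]] by (simp add: d_def dist_norm)
  then have "summable d"
    by (intro summable_comparison_test' [OF summable_geometric [of "1/8 :: real"]]) auto
  then have "(\<lambda>n. (\<Sum>i<n. d i) + approx 0 \<omega>) \<longlonglongrightarrow> suminf d + approx 0 \<omega>"
    by (intro tendsto_add tendsto_const summable_LIMSEQ)
  moreover have "(\<Sum>i<n. d i) + approx 0 \<omega> = approx n \<omega>" for n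
    unfolding d_def by (subst sum_lessThan_telescope) simp
  ultimately have "(\<lambda>n. approx n \<omega>) \<longlonglongrightarrow> suminf d + approx 0 \<omega>"
    by simp
  then show ?thesis
    unfolding limit_point_def by (metis limI)
qed

lemma limit_point_rect: "\<omega> \<in> streams G \<Longrightarrow> limit_point \<omega> \<in> rect"
  using closed_sequentially [OF closed_rect _ approx_tendsto] approx_rect by blast

lemma limit_point_SCons:
  assumes a: "a \<in> G" and \<omega>: "\<omega> \<in> streams G"
  shows "limit_point (a ## \<omega>) = act a (limit_point \<omega>)"
proof -
  have "(\<lambda>n. act a (approx n \<omega>)) \<longlonglongrightarrow> act a (limit_point \<omega>)"
    using continuous_on_tendsto_compose [OF continuous_on_admissible [OF admissible_letter [OF a]]
        approx_tendsto [OF \<omega>] limit_point_rect [OF \<omega>]] approx_rect [OF \<omega>] by simp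
  moreover have "(\<lambda>n. approx (Suc n) (a ## \<omega>)) \<longlonglongrightarrow> limit_point (a ## \<omega>)"
    using a \<omega> by (intro LIMSEQ_Suc approx_tendsto) auto
  ultimately show ?thesis by (auto intro: LIMSEQ_unique)
qed

definition code :: "pmap stream measure" where
  "code = stream_space (uniform_count_measure G)"

lemma prob_space_letters: "prob_space (uniform_count_measure G)"
  using card_G_pos finite_G by (intro prob_space_uniform_count_measure) auto

lemma prob_space_code: "prob_space code"
  unfolding code_def by (rule prob_space.prob_space_stream_space [OF prob_space_letters])

lemma space_code: "space code = streams G"
  by (simp add: code_def space_stream_space space_uniform_count_measure)

lemma measurable_approx: "approx n \<in> borel_measurable code"
proof (induction n)
  case (Suc n)
  have stl: "stl \<in> measurable code code" unfolding code_def by measurable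
  have "shd \<in> measurable code (uniform_count_measure G)" unfolding code_def by measurable
  moreover have "measurable code (uniform_count_measure G) = measurable code (count_space G)"
    by (intro measurable_cong_sets) (auto simp: sets_uniform_count_measure)
  ultimately have shd: "shd \<in> measurable code (count_space G)" by simp
  have "(\<lambda>\<omega>. act (shd \<omega>) (approx n (stl \<omega>))) \<in> borel_measurable code"
    by (rule measurable_compose_countable' [OF _ shd countable_finite [OF finite_G]])
       (rule measurable_compose [OF measurable_compose [OF stl Suc.IH] measurable_act])
  then show ?case by simp
qed simp

lemma measurable_limit_point [measurable]: "limit_point \<in> borel_measurable code"
  unfolding limit_point_def [abs_def]
  by (rule borel_measurable_lim_metric) (rule measurable_approx)

definition stationary :: "(real \<times> real) measure" where
  "stationary = distr code borel limit_point"

lemma sets_stat [simp, measurable_cong]: "sets stationary = sets borel"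
  and space_stat [simp]: "space stationary = UNIV"
  by (simp_all add: stationary_def)

lemma prob_space_stat: "prob_space stationary"
  unfolding stationary_def by (intro prob_space.prob_space_distr prob_space_code) simp

lemma AE_stat:
  assumes "\<And>\<omega>. \<omega> \<in> streams G \<Longrightarrow> P (limit_point \<omega>)" "{z. P z} \<in> sets borel"
  shows "AE z in stationary. P z"
  unfolding stationary_def
  using assms by (subst AE_distr_iff) (auto simp: space_code intro!: AE_I2)

lemma AE_stat_rect: "AE z in stationary. z \<in> rect"
  by (rule AE_stat) (use limit_point_rect sets_rect in auto)

lemma code_eq_distr_Cons: "code = distr (uniform_count_measure G \<Otimes>\<^sub>M code) code (\<lambda>(x, X). x ## X)"
proof (rule measure_eqI)
  interpret prob_space "uniform_count_measure G" by (rule prob_space_letters)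
  interpret C: prob_space code by (rule prob_space_code)
  have m [measurable]: "(\<lambda>(x, X). x ## X) \<in> measurable (uniform_count_measure G \<Otimes>\<^sub>M code) code"
    unfolding code_def by measurable
  fix A assume A [measurable]: "A \<in> sets code"
  then have A': "A \<in> sets (stream_space (uniform_count_measure G))" by (simp add: code_def)
  have "emeasure code A = (\<integral>\<^sup>+X. indicator A X \<partial>code)" by simp
  also have "\<dots> = (\<integral>\<^sup>+x. (\<integral>\<^sup>+X. indicator A (x ## X) \<partial>code) \<partial>uniform_count_measure G)"
    unfolding code_def by (rule nn_integral_stream_space) (use A' in measurable)
  also have "\<dots> = (\<integral>\<^sup>+p. indicator A (case p of (x, X) \<Rightarrow> x ## X) \<partial>(uniform_count_measure G \<Otimes>\<^sub>M code))"
    using C.nn_integral_fst [of "\<lambda>p. indicator A (case p of (x, X) \<Rightarrow> x ## X)" "uniform_count_measure G"]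
    by simp
  also have "\<dots> = (\<integral>\<^sup>+X. indicator A X \<partial>distr (uniform_count_measure G \<Otimes>\<^sub>M code) code (\<lambda>(x, X). x ## X))"
    by (subst nn_integral_distr) simp_all
  also have "\<dots> = emeasure (distr (uniform_count_measure G \<Otimes>\<^sub>M code) code (\<lambda>(x, X). x ## X)) A"
    by (subst nn_integral_indicator) simp_all
  finally show "emeasure code A
      = emeasure (distr (uniform_count_measure G \<Otimes>\<^sub>M code) code (\<lambda>(x, X). x ## X)) A" .
qed simp

lemma integral_stat:
  fixes f :: "real \<times> real \<Rightarrow> 'b :: {banach, second_countable_topology}"
  assumes f [measurable]: "f \<in> borel_measurable borel" and bd: "\<And>z. norm (f z) \<le> B"
  shows "(\<integral>z. f z \<partial>stationary) = (\<Sum>a\<in>G. \<integral>z. f (act a z) \<partial>stationary) /\<^sub>R card G"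
proof -
  interpret L: prob_space "uniform_count_measure G" by (rule prob_space_letters)
  interpret C: prob_space code by (rule prob_space_code)
  interpret P: pair_prob_space "uniform_count_measure G" code ..
  have m [measurable]: "(\<lambda>(x, X). x ## X) \<in> measurable (uniform_count_measure G \<Otimes>\<^sub>M code) code"
    unfolding code_def by measurable
  have "(\<integral>z. f z \<partial>stationary) = (\<integral>\<omega>. f (limit_point \<omega>) \<partial>code)"
    unfolding stationary_def by (rule integral_distr) simp_all
  also have "\<dots> = (\<integral>\<omega>. f (limit_point \<omega>)
      \<partial>distr (uniform_count_measure G \<Otimes>\<^sub>M code) code (\<lambda>(x, X). x ## X))"
    by (subst code_eq_distr_Cons) (rule refl)
  also have "\<dots> = (\<integral>p. f (limit_point (case p of (x, X) \<Rightarrow> x ## X)) \<partial>(uniform_count_measure G \<Otimes>\<^sub>M code))"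
    by (rule integral_distr) simp_all
  also have "\<dots> = (\<integral>x. (\<integral>X. f (limit_point (x ## X)) \<partial>code) \<partial>uniform_count_measure G)"
  proof -
    have "integrable (uniform_count_measure G \<Otimes>\<^sub>M code)
        (\<lambda>p. f (limit_point (case p of (x, X) \<Rightarrow> x ## X)))"
      by (rule P.integrable_const_bound [where B = B]) (simp_all add: bd)
    from P.integral_fst' [OF this] show ?thesis by simp
  qed
  also have "\<dots> = (\<Sum>a\<in>G. \<integral>X. f (limit_point (a ## X)) \<partial>code) /\<^sub>R card G"
    unfolding uniform_count_measure_def
    by (subst lebesgue_integral_point_measure_finite)
       (auto simp: finite_G scaleR_sum_right divide_inverse)
  also have "(\<Sum>a\<in>G. \<integral>X. f (limit_point (a ## X)) \<partial>code)
      = (\<Sum>a\<in>G. \<integral>X. f (act a (limit_point X)) \<partial>code)"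
    by (intro sum.cong refl Bochner_Integration.integral_cong) (auto simp: space_code limit_point_SCons)
  also have "\<dots> = (\<Sum>a\<in>G. \<integral>z. f (act a z) \<partial>stationary)"
    unfolding stationary_def by (intro sum.cong refl integral_distr [symmetric]) simp_all
  finally show ?thesis .
qed

text \<open>
Stationarity, applied repeatedly to the innermost letter.
\<close>

lemma integral_stat_words:
  fixes f :: "real \<times> real \<Rightarrow> 'b :: {banach, second_countable_topology}"
  assumes f [measurable]: "f \<in> borel_measurable borel" and bd: "\<And>z. norm (f z) \<le> B"
  shows "(\<integral>z. f z \<partial>stationary)
    = (\<Sum>w\<in>words n. \<integral>z. f (act (word w) z) \<partial>stationary) /\<^sub>R (card G ^ n)"
proof (induction n)
  case 0
  then show ?case by (simp add: words_0)
next
  case (Suc n)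
  have step: "(\<integral>z. f (act (word w) z) \<partial>stationary)
      = (\<Sum>a\<in>G. \<integral>z. f (act (word (a # w)) z) \<partial>stationary) /\<^sub>R card G" for w
  proof -
    have "(\<integral>z. f (act (word w) z) \<partial>stationary)
        = (\<Sum>a\<in>G. \<integral>z. f (act (word w) (act a z)) \<partial>stationary) /\<^sub>R card G"
      by (rule integral_stat [where B = B]) (use bd in auto)
    also have "(\<Sum>a\<in>G. \<integral>z. f (act (word w) (act a z)) \<partial>stationary)
        = (\<Sum>a\<in>G. \<integral>z. f (act (word (a # w)) z) \<partial>stationary)"
    proof (intro sum.cong refl integral_cong_AE)
      show "AE z in stationary. f (act (word w) (act a z)) = f (act (word (a # w)) z)" if "a \<in> G" for a
        using AE_stat_rect by eventually_elim (simp only: act_word_Cons that)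
    qed simp_all
    finally show ?thesis .
  qed
  define I where "I w = (\<integral>z. f (act (word w) z) \<partial>stationary)" for w
  have step': "I w = (\<Sum>a\<in>G. I (a # w)) /\<^sub>R card G" for w
    unfolding I_def by (rule step)
  have "(\<Sum>w\<in>words n. I w) = (\<Sum>w\<in>words n. (\<Sum>a\<in>G. I (a # w)) /\<^sub>R card G)"
    by (intro sum.cong refl step')
  also have "\<dots> = (\<Sum>w\<in>words n. \<Sum>a\<in>G. I (a # w)) /\<^sub>R card G"
    by (rule scaleR_sum_right [symmetric])
  also have "(\<Sum>w\<in>words n. \<Sum>a\<in>G. I (a # w)) = (\<Sum>w\<in>words (Suc n). I w)"
    unfolding sum_words_Suc by (rule sum.swap)
  finally show ?case
    using Suc.IH by (simp add: I_def [symmetric])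
qed

end

section \<open>Limit points are badly approximable\<close>

text \<open>
The bound is required for the distance to every integer m, which is the same as for the
distance to the nearest one but behaves better under integer maps.
\<close>

definition uniformly_bad :: "real \<times> real \<Rightarrow> bool" where
  "uniformly_bad z \<longleftrightarrow> (\<exists>c>0. \<forall>n m. 1 \<le> n \<longrightarrow>
     c \<le> real n * \<bar>real n * fst z - real_of_int m\<bar> \<and>
     c \<le> real n * \<bar>real n * fst z - snd z - real_of_int m\<bar>)"

text \<open>
With N = n K^2 - K the shifted form n (K^2 x) - (y + K x) equals N x - y, and N is
a positive integer of size at most n K^2.  The hypothesis on K makes N positive already
for n = 1.
\<close>

lemma uniformly_bad_shear:
  assumes bad: "uniformly_bad z" and K: "2 \<le> K"
  shows "(real K ^ 2 * fst z, snd z + real K * fst z) \<in> Bad_pairs"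
proof -
  obtain c where c: "0 < c" and all: "\<forall>n m. 1 \<le> n \<longrightarrow>
     c \<le> real n * \<bar>real n * fst z - real_of_int m\<bar> \<and>
     c \<le> real n * \<bar>real n * fst z - snd z - real_of_int m\<bar>"
    using bad unfolding uniformly_bad_def by (elim exE conjE)
  have hom: "c \<le> real n * \<bar>real n * fst z - real_of_int m\<bar>"
    and inh: "c \<le> real n * \<bar>real n * fst z - snd z - real_of_int m\<bar>" if "1 \<le> n" for n m
    using all [rule_format, OF that] by simp_all
  define d where "d = c / real K ^ 2"
  have K0: "0 < real K ^ 2" and d: "0 < d" using K c by (auto simp: d_def)
  have "d \<le> real n * dist_nearest_int (real n * (real K ^ 2 * fst z))" if "1 \<le> n" for n
  proof -
    define y where "y = real n * (real K ^ 2 * fst z)"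
    have y: "real (n * K ^ 2) * fst z = y" by (simp add: y_def)
    have "c \<le> real (n * K ^ 2) * \<bar>y - round y\<bar>"
      unfolding y [symmetric] using that K by (intro hom) (auto simp: Suc_le_eq)
    also have "\<dots> = (real n * dist_nearest_int y) * real K ^ 2"
      by (simp add: dist_nearest_int_def)
    finally show ?thesis
      unfolding d_def pos_divide_le_eq [OF K0] y_def .
  qed
  then have 1: "d \<le> (INF n\<in>{1::nat..}. real n * dist_nearest_int (real n * (real K ^ 2 * fst z)))"
    by (intro cINF_greatest) simp_all
  have "d \<le> real n * dist_nearest_int (real n * (real K ^ 2 * fst z) - (snd z + real K * fst z))"
    if n: "1 \<le> n" for n
  proof -
    \<comment> \<open>Truncated subtraction is harmless here because 2 K is at most n K^2.\<close>
    define N where "N = n * K ^ 2 - K"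
    have "K * 2 \<le> K * K" using K by (intro mult_le_mono2)
    then have "2 * K \<le> n * K ^ 2"
      using mult_le_mono1 [OF n, of "K * K"] unfolding power2_eq_square nat_mult_1 by linarith
    then have N: "1 \<le> N" "real N = real n * real K ^ 2 - real K" "N \<le> n * K ^ 2"
      using K unfolding N_def by (simp_all add: of_nat_diff)
    define y where "y = real n * (real K ^ 2 * fst z) - (snd z + real K * fst z)"
    have y: "real N * fst z - snd z = y"
      by (simp add: N(2) y_def algebra_simps)
    have "c \<le> real N * \<bar>y - round y\<bar>"
      unfolding y [symmetric] by (rule inh [OF N(1)])
    also have "\<dots> \<le> real (n * K ^ 2) * \<bar>y - round y\<bar>"
      by (intro mult_right_mono of_nat_mono N(3)) simp
    also have "\<dots> = (real n * dist_nearest_int y) * real K ^ 2"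
      by (simp add: dist_nearest_int_def)
    finally show ?thesis
      unfolding d_def pos_divide_le_eq [OF K0] y_def .
  qed
  then have 2: "d \<le> (INF n\<in>{1::nat..}. real n *
      dist_nearest_int (real n * (real K ^ 2 * fst z) - (snd z + real K * fst z)))"
    by (intro cINF_greatest) simp_all
  show ?thesis
    using 1 2 d by (simp add: Bad_pairs_def Bad_def Bad_shift_def)
qed

lemma measurable_dist_nearest_int [measurable]: "dist_nearest_int \<in> borel_measurable borel"
  unfolding dist_nearest_int_def [abs_def] round_def by measurable

lemma sets_Bad_pairs: "Bad_pairs \<in> sets borel"
proof -
  note [measurable] = measurable_fst_snd_borel
  have bb: "bdd_below ((\<lambda>n. real n * dist_nearest_int (f n)) ` {1::nat..})" for f
    by (intro bdd_belowI [of _ 0]) (auto simp: dist_nearest_int_def)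
  have [measurable]:
    "(\<lambda>z :: real \<times> real. INF n\<in>{1::nat..}. real n * dist_nearest_int (real n * fst z)) \<in> borel_measurable borel"
    "(\<lambda>z :: real \<times> real. INF n\<in>{1::nat..}. real n * dist_nearest_int (real n * fst z - snd z)) \<in> borel_measurable borel"
    by (intro borel_measurable_cINF bb; simp)+
  have "Bad_pairs = {z. 0 < (INF n\<in>{1::nat..}. real n * dist_nearest_int (real n * fst z)) \<and>
      0 < (INF n\<in>{1::nat..}. real n * dist_nearest_int (real n * fst z - snd z))}"
    by (auto simp: Bad_pairs_def Bad_def Bad_shift_def)
  also have "\<dots> \<in> sets borel"
    by measurable
  finally show ?thesis .
qed

lemma pa_minus_mob:
  assumes "pa g * qb g - pb g * qa g = 1" "den g x \<noteq> 0"
  shows "real_of_int (pa g) - qa g * mob g x = 1 / den g x"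
proof -
  have det': "real_of_int (pa g) * qb g - pb g * qa g = 1"
    using assms(1) by (metis of_int_1 of_int_diff of_int_mult)
  have "(real_of_int (pa g) - qa g * mob g x) * den g x
      = pa g * den g x - qa g * (mob g x * den g x)"
    by (simp add: algebra_simps)
  also have "\<dots> = pa g * den g x - qa g * (real_of_int (pa g) * x + pb g)"
    using mob_times_den [OF assms(2)] by simp
  also have "\<dots> = 1"
    using det' by (simp add: den_def algebra_simps)
  finally show ?thesis
    using assms(2) by (simp add: field_simps)
qed

text \<open>
The second identity is what bounds the pulled back slope.  It follows by solving
n x - m = y + l for m and using that pa - qa x is the reciprocal of the denominator.
\<close>

lemma pullback_line:
  fixes l :: real and n m :: int
  assumes "pa g * qb g - pb g * qa g = 1" and D: "den g (fst z) \<noteq> 0"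
  defines "l \<equiv> real_of_int n * fst (act g z) - snd (act g z) - real_of_int m"
  shows "l * den g (fst z) = real_of_int (n * pa g - ua g - m * qa g) * fst z - snd z
           + real_of_int (n * pb g - ub g - m * qb g)"
    and "real_of_int (n * pa g - ua g - m * qa g) = n / den g (fst z) + slope g z + qa g * l"
proof -
  have Y: "snd (act g z) * den g (fst z) = real_of_int (ua g) * fst z + ub g + snd z"
    using D by (simp add: act_def)
  have "l * den g (fst z) = n * (mob g (fst z) * den g (fst z)) - snd (act g z) * den g (fst z)
      - m * den g (fst z)"
    by (simp add: l_def algebra_simps)
  then show "l * den g (fst z) = real_of_int (n * pa g - ua g - m * qa g) * fst z - snd z
           + real_of_int (n * pb g - ub g - m * qb g)"
    unfolding Y mob_times_den [OF D, symmetric] by (simp add: den_def algebra_simps)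
  have "n / den g (fst z) = n * (real_of_int (pa g) - qa g * mob g (fst z))"
    by (simp add: pa_minus_mob [OF assms(1) D])
  then show "real_of_int (n * pa g - ua g - m * qa g) = n / den g (fst z) + slope g z + qa g * l"
    by (simp add: slope_def l_def algebra_simps)
qed

lemma pullback_rational:
  fixes l :: real and n m :: int
  assumes "pa g * qb g - pb g * qa g = 1" and D: "den g x \<noteq> 0"
  defines "l \<equiv> real_of_int n * mob g x - real_of_int m"
  shows "l * den g x = real_of_int (n * pa g - m * qa g) * x + real_of_int (n * pb g - m * qb g)"
    and "real_of_int (n * pa g - m * qa g) = n / den g x + qa g * l"
proof -
  have "l * den g x = n * (mob g x * den g x) - m * den g x"
    by (simp add: l_def algebra_simps)
  then show "l * den g x = real_of_int (n * pa g - m * qa g) * x + real_of_int (n * pb g - m * qb g)"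
    unfolding mob_times_den [OF D, symmetric] by (simp add: den_def algebra_simps)
  have "n / den g x = n * (real_of_int (pa g) - qa g * mob g x)"
    by (simp add: pa_minus_mob [OF assms(1) D])
  then show "real_of_int (n * pa g - m * qa g) = n / den g x + qa g * l"
    by (simp add: l_def algebra_simps)
qed

context letter_system
begin

primrec "prefix" :: "nat \<Rightarrow> pmap stream \<Rightarrow> pmap" where
  "prefix 0 \<omega> = id_pmap"
| "prefix (Suc k) \<omega> = pcomp (prefix k \<omega>) (\<omega> !! k)"

lemma snth_G: "\<omega> \<in> streams G \<Longrightarrow> \<omega> !! k \<in> G"
  by (metis snth_in)

lemma admissible_prefix: "\<omega> \<in> streams G \<Longrightarrow> admissible k (prefix k \<omega>)"
  by (induction k) (auto intro: admissible_id admissible_comp snth_G)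

lemma sdrop_G: "\<omega> \<in> streams G \<Longrightarrow> sdrop k \<omega> \<in> streams G"
  by (induction k arbitrary: \<omega>) (simp_all add: shd_stl_streams)

lemma limit_point_sdrop:
  assumes "\<omega> \<in> streams G"
  shows "limit_point (sdrop k \<omega>) = act (\<omega> !! k) (limit_point (sdrop (Suc k) \<omega>))"
proof -
  have "sdrop k \<omega> = shd (sdrop k \<omega>) ## stl (sdrop k \<omega>)"
    by (rule stream.collapse [symmetric])
  then have "sdrop k \<omega> = \<omega> !! k ## sdrop (Suc k) \<omega>" by (simp only: sdrop_simps)
  then show ?thesis
    by (simp only: limit_point_SCons [OF snth_G [OF assms] sdrop_G [OF assms]])
qed

lemma den_letter_nz: "g \<in> G \<Longrightarrow> z \<in> rect \<Longrightarrow> den g (fst z) \<noteq> 0"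
  using den_bounds [of g "fst z"] R_ge by (auto simp: rect_iff)

lemma limit_point_prefix:
  assumes "\<omega> \<in> streams G"
  shows "limit_point \<omega> = act (prefix k \<omega>) (limit_point (sdrop k \<omega>))"
proof (induction k)
  case (Suc k)
  have "act (prefix (Suc k) \<omega>) (limit_point (sdrop (Suc k) \<omega>))
      = act (prefix k \<omega>) (act (\<omega> !! k) (limit_point (sdrop (Suc k) \<omega>)))"
    unfolding prefix.simps
    by (rule act_comp [OF den_letter_nz [OF snth_G [OF assms] limit_point_rect [OF sdrop_G [OF assms]]]])
  then show ?case using Suc limit_point_sdrop [OF assms, of k] by (simp only:)
qed simp

text \<open>
Denominators along the prefixes of a code grow by factors between 32 R and 68 R, so some
prefix has a denominator comparable with n.
\<close>

lemma prefix_of_size: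
  assumes \<omega>: "\<omega> \<in> streams G" and n: "1 \<le> n"
  shows "\<exists>g z k. admissible k g \<and> z \<in> rect \<and> limit_point \<omega> = act g z \<and>
           2 * real n \<le> den g (fst z) \<and> den g (fst z) \<le> 136 * real R * real n"
proof -
  define x where "x k = fst (limit_point (sdrop k \<omega>))" for k
  define D where "D k = den (prefix k \<omega>) (x k)" for k
  have rect: "limit_point (sdrop k \<omega>) \<in> rect" for k
    by (rule limit_point_rect [OF sdrop_G [OF \<omega>]])
  then have x: "x k \<in> {0..1/16}" for k
    unfolding x_def rect_iff by blast
  have step: "D (Suc k) \<le> D k * (68 * real R)" for k
  proof -
    have "D (Suc k) = den (prefix k \<omega>) (mob (\<omega> !! k) (x (Suc k))) * den (\<omega> !! k) (x (Suc k))"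
      unfolding D_def prefix.simps
      unfolding x_def by (rule den_comp [OF den_letter_nz [OF snth_G [OF \<omega>] rect]])
    also have "mob (\<omega> !! k) (x (Suc k)) = x k"
      unfolding x_def limit_point_sdrop [OF \<omega>, of k] by simp
    also have "den (prefix k \<omega>) (x k) * den (\<omega> !! k) (x (Suc k)) \<le> D k * (68 * real R)"
      unfolding D_def
      using den_bounds [OF snth_G [OF \<omega>] x] admissibleD(6) [OF admissible_prefix [OF \<omega>] x]
      by (intro mult_left_mono) (auto intro: order_trans [of 0 1])
    finally show ?thesis .
  qed
  have lower: "(32 * real R) ^ k \<le> D k" for k
    unfolding D_def using admissibleD(4) [OF admissible_prefix [OF \<omega>] x] .
  have "1 < 32 * real R" using R_ge by simp
  then obtain k where "2 * real n < (32 * real R) ^ k"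
    using real_arch_pow by blast
  then have ex: "\<exists>k. 2 * real n \<le> D k"
    using lower [of k] by (intro exI [of _ k]) linarith
  define k where "k = (LEAST k. 2 * real n \<le> D k)"
  have k: "2 * real n \<le> D k" unfolding k_def by (rule LeastI_ex [OF ex])
  have "D 0 = 1" by (simp add: D_def)
  then obtain j where j: "k = Suc j"
    using k n by (cases k) auto
  have "\<not> 2 * real n \<le> D j"
    using not_less_Least [of j "\<lambda>k. 2 * real n \<le> D k"] j by (simp add: k_def)
  then have "D j * (68 * real R) \<le> 2 * real n * (68 * real R)"
    by (intro mult_right_mono) auto
  then have "D k \<le> 136 * real R * real n"
    using step [of j] j by (simp add: mult.commute mult.left_commute)
  then show ?thesis
    using k admissible_prefix [OF \<omega>] rect limit_point_prefix [OF \<omega>]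
    unfolding D_def x_def by blast
qed

text \<open>
Suppose l = n x - y - m is smaller than c / n.  Pulled back through a prefix with denominator
comparable with n, the line becomes A x - y + B = l * den with integers A and B, where A is
n / den + slope up to 1/16 and hence one of 0, 1, 2, 3.  On the rectangle the left side is at
least 1/16 away from 0, while the right side is smaller than 1/16.  In the homogeneous case
the same argument forces A = B = 0, contradicting the invertibility of the matrix.
\<close>

lemma limit_point_bad:
  assumes \<omega>: "\<omega> \<in> streams G"
  shows "uniformly_bad (limit_point \<omega>)"
  unfolding uniformly_bad_def
proof (intro exI [of _ "1 / (2176 * real R)"] conjI allI impI)
  \<comment> \<open>Here 2176 = 16 * 136: the denominator is at most 136 R n, and 1/16 is the gap of the rectangle.\<close>
  define c where "c = 1 / (2176 * real R)"
  show "0 < 1 / (2176 * real R)" using R_ge by simp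
  fix n :: nat and m :: int assume n: "1 \<le> n"
  obtain g z k where g: "admissible k g" and z: "z \<in> rect" and lp: "limit_point \<omega> = act g z"
    and D: "2 * real n \<le> den g (fst z)" "den g (fst z) \<le> 136 * real R * real n"
    using prefix_of_size [OF \<omega> n] by blast
  define D where "D = den g (fst z)"
  have D0: "0 < D" "D \<noteq> 0" and n0: "0 < real n" using D n by (auto simp: D_def)
  have x: "fst z \<in> {0..1/16}" using z by (simp add: rect_iff)
  note dg = admissibleD(1-3) [OF g]
  have qaD: "real_of_int (qa g) \<le> D"
  proof -
    have "0 \<le> qa g * fst z" using dg x by simp
    then show ?thesis using dg by (simp add: D_def den_def)
  qed
  have nD: "0 < n / D" "n / D \<le> 1/2" using D D0 n by (auto simp: D_def field_simps)
  have small: "\<bar>qa g * l\<bar> \<le> 1/16" "\<bar>l * D\<bar> < 1/16" if "real n * \<bar>l\<bar> < c" for l :: real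
  proof -
    have "\<bar>l * D\<bar> = \<bar>l\<bar> * D" using D0 by (simp add: abs_mult)
    also have "\<dots> \<le> \<bar>l\<bar> * (136 * real R * real n)" using D by (intro mult_left_mono) (auto simp: D_def)
    also have "\<dots> = 136 * real R * (real n * \<bar>l\<bar>)" by simp
    also have "\<dots> < 136 * real R * c" using that R_ge by (intro mult_strict_left_mono) auto
    also have "\<dots> = 1/16" using R_ge by (simp add: c_def)
    finally show lD: "\<bar>l * D\<bar> < 1/16" .
    have "\<bar>qa g * l\<bar> \<le> \<bar>l * D\<bar>"
      unfolding abs_mult using qaD dg D0 by (subst mult.commute) (intro mult_left_mono, auto)
    then show "\<bar>qa g * l\<bar> \<le> 1/16" using lD by linarith
  qed
  have "c \<le> real n * \<bar>real n * fst (limit_point \<omega>) - real_of_int m\<bar>"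
  proof (rule ccontr)
    define l where "l = real n * mob g (fst z) - real_of_int m"
    define A where "A = int n * pa g - m * qa g"
    define B where "B = int n * pb g - m * qb g"
    assume "\<not> ?thesis"
    then have "real n * \<bar>l\<bar> < c" by (simp add: l_def lp)
    note s = small [OF this]
    have AB: "l * D = A * fst z + B" "real_of_int A = n / D + qa g * l"
      using pullback_rational [OF dg(1) D0(2) [unfolded D_def], of "int n" m]
      by (simp_all add: l_def A_def B_def D_def)
    have "\<bar>real_of_int A\<bar> < 1" using AB(2) s(1) nD by linarith
    then have A0: "A = 0" by linarith
    then have "\<bar>real_of_int B\<bar> < 1" using AB(1) s(2) by simp
    then have B0: "B = 0" by linarith
    have "int n = int n * (pa g * qb g - pb g * qa g)" using dg by simp
    also have "\<dots> = A * qb g - B * qa g" by (simp add: A_def B_def algebra_simps)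
    finally show False using A0 B0 n by simp
  qed
  then show "1 / (2176 * real R) \<le> real n * \<bar>real n * fst (limit_point \<omega>) - real_of_int m\<bar>"
    by (simp add: c_def)
  have "c \<le> real n * \<bar>real n * fst (limit_point \<omega>) - snd (limit_point \<omega>) - real_of_int m\<bar>"
  proof (rule ccontr)
    define l where "l = real n * fst (act g z) - snd (act g z) - real_of_int m"
    define A where "A = int n * pa g - ua g - m * qa g"
    define B where "B = int n * pb g - ub g - m * qb g"
    assume "\<not> ?thesis"
    then have "real n * \<bar>l\<bar> < c" by (simp add: l_def lp)
    note s = small [OF this]
    have AB: "l * D = A * fst z - snd z + B" "real_of_int A = n / D + slope g z + qa g * l"
      using pullback_line [OF dg(1) D0(2) [unfolded D_def], of "int n" m]
      by (simp_all add: l_def A_def B_def D_def)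
    have sl: "0 \<le> slope g z" "slope g z \<le> 3" using admissibleD(9,10) [OF g z] by auto
    have "-1 < real_of_int A" "real_of_int A < 4" using AB(2) s(1) nD sl by linarith+
    then have "0 \<le> A" "A \<le> 3" by linarith+
    then have A3: "0 \<le> real_of_int A" "real_of_int A \<le> 3" by auto
    have "0 \<le> A * fst z" "A * fst z \<le> 3 * (1/16)"
      using A3 x mult_mono [of "real_of_int A" 3 "fst z" "1/16"] by simp_all
    then have v: "- (3/4) \<le> A * fst z - snd z" "A * fst z - snd z \<le> - (1/16)"
      using z unfolding rect_iff by auto
    have "real_of_int B < 1" "0 < real_of_int B" using AB(1) s(2) v by linarith+
    then have "B < 1" "0 < B" by simp_all
    then show False by simp
  qed
  then show "1 / (2176 * real R)
      \<le> real n * \<bar>real n * fst (limit_point \<omega>) - snd (limit_point \<omega>) - real_of_int m\<bar>"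
    by (simp add: c_def)
qed

end

section \<open>Comparison of the stationary measure with Lebesgue measure\<close>

lemma mob_has_derivative:
  assumes "den g x \<noteq> 0" "pa g * qb g - pb g * qa g = 1"
  shows "(mob g has_real_derivative 1 / den g x ^ 2) (at x)"
proof -
  have det': "real_of_int (pa g) * qb g - pb g * qa g = 1"
    using assms(2) by (metis of_int_1 of_int_diff of_int_mult)
  have "((\<lambda>x. (pa g * x + pb g) / (qa g * x + qb g)) has_real_derivative
      (pa g * (qa g * x + qb g) - (pa g * x + pb g) * qa g) / ((qa g * x + qb g) * (qa g * x + qb g))) (at x)"
    using assms(1) unfolding den_def by (auto intro!: derivative_eq_intros)
  also have "pa g * (qa g * x + qb g) - (pa g * x + pb g) * qa g
      = real_of_int (pa g) * qb g - pb g * qa g"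
    by (simp add: algebra_simps)
  finally show ?thesis
    unfolding det' mob_def [abs_def] den_def power2_eq_square .
qed

context letter_system
begin

lemma sets_act_rect [measurable]:
  assumes "g \<in> G" shows "act g ` rect \<in> sets borel"
  by (intro borel_closed compact_imp_closed compact_continuous_image compact_rect
      continuous_on_admissible [OF admissible_letter [OF assms]])

text \<open>
This is the change of variables for the map, whose Jacobian is den^(-3): the substitution in y is
affine with factor 1/den, and the one in x has derivative den^(-2).
\<close>

lemma nn_integral_letter:
  assumes g: "g \<in> G" and h [measurable]: "h \<in> borel_measurable borel"
  shows "(\<integral>\<^sup>+z. h (act g z) * indicator rect z \<partial>lborel)
    \<le> ennreal ((68 * real R) ^ 3) * (\<integral>\<^sup>+z. h z * indicator (act g ` rect) z \<partial>lborel)"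
proof -
  define k where "k z = h z * indicator (act g ` rect) z" for z
  define K where "K X = (\<integral>\<^sup>+Y. k (X, Y) \<partial>lborel)" for X
  define D where "D = den g"
  have D: "32 * real R \<le> D x" "D x \<le> 68 * real R" if "x \<in> {0..1/16}" for x
    using den_bounds [OF g that] by (auto simp: D_def)
  have R0: "0 < real R" using R_ge by simp
  note [measurable] = sets_act_rect [OF g]
  have k [measurable]: "k \<in> borel_measurable borel" unfolding k_def [abs_def] by measurable
  have prod: "borel_measurable (lborel \<Otimes>\<^sub>M lborel) = borel_measurable (borel :: (real \<times> real) measure)"
    by (simp add: lborel_prod)
  have K [measurable]: "K \<in> borel_measurable borel"
    unfolding K_def [abs_def]
    using lborel.borel_measurable_nn_integral_fst [of k lborel] k by (simp add: prod)
  have inner: "(\<integral>\<^sup>+y. h (act g (x, y)) * indicator rect (x, y) \<partial>lborel)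
      \<le> ennreal (D x) * K (mob g x) * indicator {0..1/16} x" for x
  proof (cases "x \<in> {0..1/16}")
    case False
    then have "indicator rect (x, y) = (0 :: ennreal)" for y :: real
      by (auto simp: rect_iff indicator_def)
    then show ?thesis by simp
  next
    case True
    have D0: "0 < D x" using D(1) [OF True] R0 by linarith
    define t where "t = (ua g * x + ub g) / D x"
    have "(\<integral>\<^sup>+y. h (act g (x, y)) * indicator rect (x, y) \<partial>lborel)
        \<le> (\<integral>\<^sup>+y. k (mob g x, t + (1 / D x) * y) \<partial>lborel)"
    proof (rule nn_integral_mono)
      fix y
      have eq: "act g (x, y) = (mob g x, t + (1 / D x) * y)"
        by (simp add: act_def t_def D_def add_divide_distrib)
      show "h (act g (x, y)) * indicator rect (x, y) \<le> k (mob g x, t + (1 / D x) * y)"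
        unfolding eq [symmetric] k_def by (auto simp: indicator_def)
    qed
    also have "\<dots> = ennreal (D x) * (ennreal \<bar>1 / D x\<bar> * (\<integral>\<^sup>+y. k (mob g x, t + (1 / D x) * y) \<partial>lborel))"
      using D0 by (simp add: mult.assoc [symmetric] ennreal_mult [symmetric])
    also have "\<dots> = ennreal (D x) * K (mob g x)"
      unfolding K_def
      by (subst nn_integral_real_affine [of "\<lambda>Y. k (mob g x, Y)" "1 / D x" t]) (use D0 in auto)
    finally show ?thesis using True by simp
  qed
  have "(\<integral>\<^sup>+z. h (act g z) * indicator rect z \<partial>lborel)
      = (\<integral>\<^sup>+x. (\<integral>\<^sup>+y. h (act g (x, y)) * indicator rect (x, y) \<partial>lborel) \<partial>lborel)"
    using lborel.nn_integral_fst [of "\<lambda>z. h (act g z) * indicator rect z" "lborel :: real measure"]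
    by (simp add: prod lborel_prod)
  also have "\<dots> \<le> (\<integral>\<^sup>+x. ennreal (D x) * K (mob g x) * indicator {0..1/16} x \<partial>lborel)"
    by (intro nn_integral_mono inner)
  also have "\<dots> \<le> (\<integral>\<^sup>+x. ennreal ((68 * real R) ^ 3) *
      (K (mob g x) * ennreal (1 / D x ^ 2) * indicator {0..1/16} x) \<partial>lborel)"
  proof (rule nn_integral_mono)
    fix x
    show "ennreal (D x) * K (mob g x) * indicator {0..1/16} x
        \<le> ennreal ((68 * real R) ^ 3) * (K (mob g x) * ennreal (1 / D x ^ 2) * indicator {0..1/16} x)"
    proof (cases "x \<in> {0..1/16}")
      case True
      have D0: "0 < D x" using D(1) [OF True] R0 by linarith
      have "D x ^ 3 \<le> (68 * real R) ^ 3"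
        using D(2) [OF True] D0 by (intro power_mono) auto
      then have "D x \<le> (68 * real R) ^ 3 * (1 / D x ^ 2)"
        using D0 by (simp add: field_simps power3_eq_cube power2_eq_square)
      then have "ennreal (D x) \<le> ennreal ((68 * real R) ^ 3) * ennreal (1 / D x ^ 2)"
        using R0 by (subst ennreal_mult [symmetric]) (auto intro: ennreal_leI)
      then have "ennreal (D x) * K (mob g x) \<le> (ennreal ((68 * real R) ^ 3) * ennreal (1 / D x ^ 2)) * K (mob g x)"
        by (rule mult_right_mono) simp
      then show ?thesis using True by (simp add: mult_ac)
    qed simp
  qed
  also have "\<dots> = ennreal ((68 * real R) ^ 3) *
      (\<integral>\<^sup>+x. K (mob g x) * ennreal (1 / D x ^ 2) * indicator {0..1/16} x \<partial>lborel)"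
    unfolding D_def den_def mob_def by (rule nn_integral_cmult) measurable
  also have "(\<integral>\<^sup>+x. K (mob g x) * ennreal (1 / D x ^ 2) * indicator {0..1/16} x \<partial>lborel)
      = (\<integral>\<^sup>+x. K x * indicator {mob g 0..mob g (1/16)} x \<partial>lborel)"
  proof (rule nn_integral_substitution_aux [symmetric])
    fix x :: real assume x: "x \<in> {0..1/16}"
    have nz: "den g x \<noteq> 0" using D(1) [OF x] R0 by (auto simp: D_def)
    show "(mob g has_real_derivative 1 / D x ^ 2) (at x)"
      unfolding D_def by (rule mob_has_derivative [OF nz det [OF g]])
  next
    have "D x \<noteq> 0" if "x \<in> {0..1/16}" for x using D(1) [OF that] R0 by auto
    then show "continuous_on {0..1/16} (\<lambda>x. 1 / D x ^ 2)"
      unfolding D_def den_def by (intro continuous_intros) auto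
  qed (auto simp: K)
  also have "\<dots> \<le> (\<integral>\<^sup>+x. K x \<partial>lborel)"
    by (intro nn_integral_mono) (auto simp: indicator_def)
  also have "\<dots> = (\<integral>\<^sup>+z. k z \<partial>lborel)"
    unfolding K_def using lborel.nn_integral_fst [of k "lborel :: real measure"] k by (simp add: prod lborel_prod)
  finally show ?thesis
    unfolding k_def by (simp only: mult_left_mono zero_le)
qed

text \<open>
Each application of the previous bound costs one factor (68 R)^3, and the disjointness of the images
makes the sum over the letters cost nothing.
\<close>

lemma nn_integral_words:
  assumes h [measurable]: "h \<in> borel_measurable borel"
  shows "(\<Sum>w\<in>words n. \<integral>\<^sup>+z. h (act (word w) z) * indicator rect z \<partial>lborel)
    \<le> ennreal ((68 * real R) ^ 3) ^ n * (\<integral>\<^sup>+z. h z * indicator rect z \<partial>lborel)"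
proof (induction n)
  case 0
  then show ?case by (simp add: words_0)
next
  case (Suc n)
  define c where "c = ennreal ((68 * real R) ^ 3)"
  define H where "H z = (\<Sum>w\<in>words n. h (act (word w) z))" for z
  have [measurable]: "H \<in> borel_measurable borel" unfolding H_def [abs_def] by measurable
  have sum_H: "(\<integral>\<^sup>+z. H (f z) * indicator rect z \<partial>lborel)
      = (\<Sum>w\<in>words n. \<integral>\<^sup>+z. h (act (word w) (f z)) * indicator rect z \<partial>lborel)"
    if [measurable]: "f \<in> borel_measurable borel" for f
    unfolding H_def sum_distrib_right by (rule nn_integral_sum) measurable
  have "(\<Sum>w\<in>words (Suc n). \<integral>\<^sup>+z. h (act (word w) z) * indicator rect z \<partial>lborel)
      = (\<Sum>a\<in>G. \<Sum>w\<in>words n. \<integral>\<^sup>+z. h (act (word w) (act a z)) * indicator rect z \<partial>lborel)"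
    unfolding sum_words_Suc
    by (intro sum.cong refl nn_integral_cong) (auto simp del: word.simps simp: act_word_Cons indicator_def)
  also have "\<dots> = (\<Sum>a\<in>G. \<integral>\<^sup>+z. H (act a z) * indicator rect z \<partial>lborel)"
    by (simp add: sum_H)
  also have "\<dots> \<le> (\<Sum>a\<in>G. c * (\<integral>\<^sup>+z. H z * indicator (act a ` rect) z \<partial>lborel))"
    unfolding c_def by (intro sum_mono nn_integral_letter) measurable
  also have "\<dots> = c * (\<integral>\<^sup>+z. (\<Sum>a\<in>G. H z * indicator (act a ` rect) z) \<partial>lborel)"
    using sets_act_rect by (subst nn_integral_sum) (auto simp: sum_distrib_left)
  also have "(\<integral>\<^sup>+z. (\<Sum>a\<in>G. H z * indicator (act a ` rect) z) \<partial>lborel) \<le> (\<integral>\<^sup>+z. H z * indicator rect z \<partial>lborel)"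
  proof (rule nn_integral_mono)
    fix z
    show "(\<Sum>a\<in>G. H z * indicator (act a ` rect) z) \<le> H z * indicator rect z"
    proof (cases "\<exists>a\<in>G. z \<in> act a ` rect")
      case True
      then obtain a where a: "a \<in> G" "z \<in> act a ` rect" by blast
      have "z \<notin> act b ` rect" if "b \<in> G" "b \<noteq> a" for b
      proof
        assume "z \<in> act b ` rect"
        then obtain s t where "s \<in> rect" "t \<in> rect" "act b s = act a t"
          using a(2) by (metis imageE)
        then show False using act_disjoint [OF that(1) a(1)] that(2) by blast
      qed
      then have "(\<Sum>b\<in>G. H z * indicator (act b ` rect) z) = (\<Sum>b\<in>{a}. H z * indicator (act b ` rect) z)"
        using a finite_G by (intro sum.mono_neutral_right) auto
      also have "\<dots> = H z * indicator rect z"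
        using a act_rect by auto
      finally show ?thesis by simp
    qed simp
  qed
  also have "(\<integral>\<^sup>+z. H z * indicator rect z \<partial>lborel) \<le> c ^ n * (\<integral>\<^sup>+z. h z * indicator rect z \<partial>lborel)"
    using Suc.IH sum_H [of "\<lambda>z. z"] by (simp add: c_def)
  finally show ?case
    by (simp add: c_def mult_left_mono mult.assoc)
qed

lemma emeasure_rect: "emeasure lborel rect = ennreal (1/32)"
proof -
  have "emeasure lborel rect = emeasure lborel {0..1/16::real} * emeasure lborel {1/4..3/4::real}"
    unfolding rect_def lborel_prod [symmetric] by (rule lborel.emeasure_pair_measure_Times) auto
  also have "\<dots> = ennreal (1/16) * ennreal (1/2)"
    by (subst (1 2) emeasure_lborel_Icc) simp_all
  also have "\<dots> = ennreal (1/32)"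
    by (subst ennreal_mult [symmetric]) simp_all
  finally show ?thesis .
qed

text \<open>
The constant is the loss per letter in the comparison with Lebesgue measure.  What matters is that it
does not depend on R: indeed 68^3 / 28 < 2^14 = 16384.
\<close>

lemma growth_bound: "((68 * real R) ^ 3) ^ k / card G ^ k \<le> 16384 ^ k"
proof -
  have "28 * real R ^ 3 \<le> card G"
    using card_G by (metis of_nat_le_iff of_nat_mult of_nat_numeral of_nat_power)
  moreover have "0 < real R ^ 3" using R_ge by simp
  ultimately have "(68 * real R) ^ 3 \<le> 16384 * card G"
    by (simp add: power_mult_distrib)
  then have "(68 * real R) ^ 3 / card G \<le> 16384"
    using card_G_pos by (simp add: field_simps)
  then have "((68 * real R) ^ 3 / card G) ^ k \<le> 16384 ^ k"
    by (rule power_mono) simp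
  then show ?thesis by (simp add: power_divide)
qed

text \<open>
By stationarity the integral of f is an average of f over the images of points under words
of length k.  The premise key says that inside each image of the rectangle the value
of f is dominated by any value of f', up to e.  The average can thus be evaluated at an arbitrary
point t of the rectangle, and then integrated over t with respect to Lebesgue measure.
\<close>

lemma integral_stat_le:
  assumes f [measurable]: "f \<in> borel_measurable borel" and fb: "\<And>z. \<bar>f z\<bar> \<le> C"
    and f' [measurable]: "f' \<in> borel_measurable borel" and f'0: "\<And>z. 0 \<le> f' z"
    and I: "(\<integral>\<^sup>+z. ennreal (f' z) * indicator rect z \<partial>lborel) \<le> ennreal I" "0 \<le> I"
    and key: "\<And>w s t. \<lbrakk>w \<in> words k; s \<in> rect; t \<in> rect\<rbrakk> \<Longrightarrow> f (act (word w) s) \<le> f' (act (word w) t) + e"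
  shows "(\<integral>z. f z \<partial>stationary) \<le> 32 * 16384 ^ k * I + e"
proof -
  interpret prob_space stationary by (rule prob_space_stat)
  define v where "v = (\<integral>z. f z \<partial>stationary)"
  define N where "N = real (card G ^ k)"
  have N: "0 < N" using card_G_pos by (simp add: N_def)
  define S where "S t = (\<Sum>w\<in>words k. f' (act (word w) t))" for t
  have S0: "0 \<le> S t" for t unfolding S_def by (intro sum_nonneg f'0)
  have cardW: "real (card (words k)) = N" by (simp add: card_words N_def)
  have vS: "(v - e) * N \<le> S t" if t: "t \<in> rect" for t
  proof -
    have "v = (\<Sum>w\<in>words k. \<integral>z. f (act (word w) z) \<partial>stationary) / N"
      unfolding v_def N_def by (subst integral_stat_words [of f C k]) (use fb in \<open>auto simp: divide_inverse\<close>)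
    also have "(\<Sum>w\<in>words k. \<integral>z. f (act (word w) z) \<partial>stationary) \<le> (\<Sum>w\<in>words k. f' (act (word w) t) + e)"
    proof (rule sum_mono)
      fix w assume w: "w \<in> words k"
      have "integrable stationary (\<lambda>z. f (act (word w) z))"
        by (rule integrable_const_bound [where B = C]) (use fb in auto)
      moreover have "AE z in stationary. f (act (word w) z) \<le> f' (act (word w) t) + e"
        using AE_stat_rect by eventually_elim (use key [OF w _ t] in auto)
      ultimately show "(\<integral>z. f (act (word w) z) \<partial>stationary) \<le> f' (act (word w) t) + e"
        by (rule integral_le_const)
    qed
    also have "\<dots> = S t + N * e"
      by (simp add: S_def sum.distrib cardW)
    finally show ?thesis using N by (simp add: field_simps)
  qed
  have "ennreal ((v - e) * N) * ennreal (1/32) = (\<integral>\<^sup>+z. ennreal ((v - e) * N) * indicator rect z \<partial>lborel)"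
    by (simp add: nn_integral_cmult_indicator emeasure_rect)
  also have "\<dots> \<le> (\<integral>\<^sup>+z. ennreal (S z) * indicator rect z \<partial>lborel)"
    by (intro nn_integral_mono) (auto simp: indicator_def intro!: ennreal_leI vS)
  also have "\<dots> = (\<integral>\<^sup>+z. (\<Sum>w\<in>words k. ennreal (f' (act (word w) z)) * indicator rect z) \<partial>lborel)"
    unfolding S_def by (simp only: sum_ennreal [OF f'0, symmetric] sum_distrib_right)
  also have "\<dots> = (\<Sum>w\<in>words k. \<integral>\<^sup>+z. ennreal (f' (act (word w) z)) * indicator rect z \<partial>lborel)"
    by (rule nn_integral_sum) measurable
  also have "\<dots> \<le> ennreal ((68 * real R) ^ 3) ^ k * (\<integral>\<^sup>+z. ennreal (f' z) * indicator rect z \<partial>lborel)"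
    by (rule nn_integral_words [of "\<lambda>z. ennreal (f' z)"]) measurable
  also have "\<dots> \<le> ennreal ((68 * real R) ^ 3) ^ k * ennreal I"
    using I(1) by (rule mult_left_mono) simp
  also have "\<dots> = ennreal (((68 * real R) ^ 3) ^ k * I)"
    using I(2) by (subst ennreal_power) (auto intro: ennreal_mult [symmetric])
  finally have *: "ennreal ((v - e) * N) * ennreal (1/32) \<le> ennreal (((68 * real R) ^ 3) ^ k * I)" .
  have "(v - e) * N * (1/32) \<le> ((68 * real R) ^ 3) ^ k * I"
  proof (cases "0 \<le> (v - e) * N")
    case True
    then show ?thesis
      using * I(2) by (subst (asm) ennreal_mult [symmetric]) (auto simp: ennreal_le_iff)
  next
    case False
    have "0 \<le> ((68 * real R) ^ 3) ^ k * I" using I(2) by simp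
    then show ?thesis using False by linarith
  qed
  then have "v - e \<le> 32 * (((68 * real R) ^ 3) ^ k / N * I)"
    using N by (simp add: field_simps)
  also have "((68 * real R) ^ 3) ^ k / N * I \<le> 16384 ^ k * I"
    using growth_bound [of k] I(2) unfolding N_def of_nat_power by (rule mult_right_mono)
  finally show ?thesis by (simp add: v_def)
qed

end

section \<open>The Frostman bound\<close>

context letter_system
begin

text \<open>
The least k with (32 R)^k \<ge> Y overshoots Y by at most one factor, which costs 16384; the other
k - 1 factors of 16384 are each at most (32 R)^\<theta>.
\<close>

lemma cell_scale:
  assumes Y: "1 \<le> Y" and \<theta>: "0 < \<theta>" "16384 \<le> (32 * real R) powr \<theta>"
  obtains k where "Y \<le> (32 * real R) ^ k" "16384 ^ k \<le> 16384 * Y powr \<theta>"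
proof -
  have R32: "1 < 32 * real R" using R_ge by simp
  have P: "(P powr \<theta>) ^ j = (P ^ j) powr \<theta>" if "1 < P" for P :: real and j
    using that by (simp add: powr_realpow [symmetric] powr_powr mult.commute)
  have ex: "\<exists>k. Y \<le> (32 * real R) ^ k"
    using real_arch_pow [OF R32, of Y] by (auto intro: less_imp_le)
  define k where "k = (LEAST k. Y \<le> (32 * real R) ^ k)"
  have k: "Y \<le> (32 * real R) ^ k" unfolding k_def by (rule LeastI_ex [OF ex])
  have "16384 ^ k \<le> 16384 * Y powr \<theta>"
  proof (cases k)
    case 0
    have "1 \<le> Y powr \<theta>" using Y \<theta> by (intro ge_one_powr_ge_zero) auto
    then show ?thesis using 0 by simp
  next
    case (Suc j)
    then have "(32 * real R) ^ j < Y"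
      using not_less_Least [of j "\<lambda>k. Y \<le> (32 * real R) ^ k"] by (simp add: k_def)
    then have "((32 * real R) ^ j) powr \<theta> \<le> Y powr \<theta>"
      using R32 \<theta> by (intro powr_mono2) auto
    moreover have "16384 ^ j \<le> ((32 * real R) powr \<theta>) ^ j"
      using \<theta> by (intro power_mono) auto
    moreover have "((32 * real R) powr \<theta>) ^ j = ((32 * real R) ^ j) powr \<theta>"
      using P [OF R32] .
    ultimately show ?thesis using Suc by simp
  qed
  with k show ?thesis by (rule that)
qed

text \<open>
The comparison with Lebesgue measure at scale r: images of the rectangle that meet the ball lie in a
square of side 4 r, whose area is 16 r^2.
\<close>

lemma frostman:
  assumes \<theta>: "0 < \<theta>" "16384 \<le> (32 * real R) powr \<theta>" and s: "0 < s" "s \<le> 2 - \<theta>" and r: "0 < r"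
  shows "measure stationary (cball x r) \<le> 512 * 16384 * r powr s"
proof (cases "r < 1")
  case False
  interpret prob_space stationary by (rule prob_space_stat)
  have "1 \<le> r powr s" using False s by (intro ge_one_powr_ge_zero) auto
  then show ?thesis using prob_le_1 [of "cball x r"] by linarith
next
  case True
  have "1 \<le> 1 / r" using True r by simp
  then obtain k where k: "1 / r \<le> (32 * real R) ^ k" "16384 ^ k \<le> 16384 * (1 / r) powr \<theta>"
    by (rule cell_scale [OF _ \<theta>])
  have "0 < (32 * real R) ^ k" using R_ge by simp
  then have kr: "1 / (32 * real R) ^ k \<le> r" using k(1) r by (simp add: field_simps)
  \<comment> \<open>The square contains every image of the rectangle of diameter at most r that meets the ball.\<close>
  define Q where "Q = {fst x - 2 * r..fst x + 2 * r} \<times> {snd x - 2 * r..snd x + 2 * r}"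
  have [measurable]: "Q \<in> sets borel"
    unfolding Q_def by (intro borel_closed closed_Times) auto
  have "emeasure lborel Q = emeasure lborel {fst x - 2 * r..fst x + 2 * r} * emeasure lborel {snd x - 2 * r..snd x + 2 * r}"
    unfolding Q_def lborel_prod [symmetric] by (rule lborel.emeasure_pair_measure_Times) auto
  also have "\<dots> = ennreal (4 * r) * ennreal (4 * r)"
    using r by (subst (1 2) emeasure_lborel_Icc) simp_all
  also have "\<dots> = ennreal (16 * r\<^sup>2)"
    using r by (subst ennreal_mult [symmetric]) (simp_all add: power2_eq_square)
  finally have emQ: "emeasure lborel Q = ennreal (16 * r\<^sup>2)" .
  have "(\<integral>z. indicator (cball x r) z \<partial>stationary) \<le> 32 * 16384 ^ k * (16 * r\<^sup>2) + 0"
  proof (rule integral_stat_le [where C = 1 and f' = "indicator Q"])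
    have "(\<integral>\<^sup>+z. ennreal (indicator Q z) * indicator rect z \<partial>lborel) \<le> (\<integral>\<^sup>+z. indicator Q z \<partial>lborel)"
      by (intro nn_integral_mono) (auto simp: indicator_def)
    then show "(\<integral>\<^sup>+z. ennreal (indicator Q z) * indicator rect z \<partial>lborel) \<le> ennreal (16 * r\<^sup>2)"
      by (simp add: emQ)
  next
    fix w a b assume w: "w \<in> words k" "a \<in> rect" "b \<in> rect"
    have "ldist (act (word w) a) (act (word w) b) \<le> r"
      using ldist_cell [OF admissible_word [OF w(1)] w(2,3)] kr by linarith
    then have 1: "\<bar>fst (act (word w) a) - fst (act (word w) b)\<bar> \<le> r"
        "\<bar>snd (act (word w) a) - snd (act (word w) b)\<bar> \<le> r"
      unfolding ldist_def by linarith+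
    have "act (word w) b \<in> Q" if "act (word w) a \<in> cball x r"
    proof -
      have "dist (fst x) (fst (act (word w) a)) \<le> r" "dist (snd x) (snd (act (word w) a)) \<le> r"
        using that order_trans [OF dist_fst_le [of x "act (word w) a"]]
          order_trans [OF dist_snd_le [of x "act (word w) a"]] unfolding mem_cball by blast+
      then show ?thesis
        using 1 unfolding Q_def mem_Times_iff atLeastAtMost_iff dist_real_def by linarith
    qed
    then show "indicator (cball x r) (act (word w) a) \<le> indicator Q (act (word w) b) + (0 :: real)"
      by (auto simp: indicator_def)
  qed (auto simp: indicator_def)
  then have "measure stationary (cball x r) \<le> 512 * r\<^sup>2 * 16384 ^ k"
    by (simp add: mult.commute)
  also have "\<dots> \<le> 512 * r\<^sup>2 * (16384 * (1 / r) powr \<theta>)"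
    using k(2) by (intro mult_left_mono) auto
  also have "\<dots> = 512 * 16384 * (r powr 2 * r powr (- \<theta>))"
    using r by (simp add: powr_divide powr_minus_divide)
  also have "\<dots> = 512 * 16384 * r powr (2 - \<theta>)"
    by (simp add: powr_add [symmetric])
  also have "\<dots> \<le> 512 * 16384 * r powr s"
    using True r s by (intro mult_left_mono powr_mono') auto
  finally show ?thesis .
qed

end

section \<open>Oscillatory integrals\<close>

lemma exp2pi_cis: "exp2pi x = cis (2 * pi * x)"
  by (simp add: exp2pi_def cis_conv_exp mult_ac)

lemma norm_exp2pi [simp]: "cmod (exp2pi x) = 1"
  by (simp add: exp2pi_cis)

lemma exp2pi_diff: "exp2pi a * cnj (exp2pi b) = exp2pi (a - b)"
  by (simp add: exp2pi_cis cis_cnj cis_mult algebra_simps)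

lemma exp2pi_has_vector_derivative:
  assumes "(\<phi> has_real_derivative d) (at x)"
  shows "((\<lambda>x. exp2pi (\<phi> x)) has_vector_derivative 2 * of_real pi * \<i> * of_real d * exp2pi (\<phi> x)) (at x)"
proof -
  have "((\<lambda>x. 2 * of_real pi * \<i> * of_real (\<phi> x)) has_vector_derivative 2 * of_real pi * \<i> * of_real d) (at x)"
    using assms
    by (intro has_vector_derivative_mult_right has_vector_derivative_of_real)
  from field_vector_diff_chain_at [OF this DERIV_exp]
  show ?thesis by (simp add: exp2pi_def [abs_def] o_def mult_ac)
qed

lemma continuous_on_exp2pi [continuous_intros]:
  "continuous_on S f \<Longrightarrow> continuous_on S (\<lambda>x. exp2pi (f x))"
  unfolding exp2pi_def by (intro continuous_intros)

lemma measurable_exp2pi [measurable]: "exp2pi \<in> borel_measurable borel"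
  by (intro borel_measurable_continuous_onI continuous_intros)

text \<open>
The chord of the unit circle is twice the sine of half the angle.
\<close>

lemma exp2pi_lipschitz: "cmod (exp2pi a - exp2pi b) \<le> 2 * pi * \<bar>a - b\<bar>"
proof -
  define t where "t = 2 * pi * (a - b)"
  have "exp2pi a - exp2pi b = exp2pi b * (exp (\<i> * of_real t) - 1)"
    unfolding cis_conv_exp [symmetric] exp2pi_cis t_def by (simp add: cis_mult right_diff_distrib)
  then have "cmod (exp2pi a - exp2pi b) = 2 * \<bar>sin (t / 2)\<bar>"
    by (simp only: norm_mult norm_exp2pi dist_exp_i_1 mult_1)
  also have "\<dots> \<le> 2 * \<bar>t / 2\<bar>"
    by (intro mult_left_mono abs_sin_x_le_abs_x) simp
  also have "\<dots> = 2 * pi * \<bar>a - b\<bar>"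
    by (simp add: t_def abs_mult)
  finally show ?thesis .
qed

text \<open>
The first derivative test: integration by parts against exp2pi(\<phi>) / (2 \<pi> i \<phi>').  The
boundary terms give 1/l, and the derivative of 1/\<phi>' gives the term with L / l^2.
\<close>

lemma oscillatory_integral_bound:
  fixes \<phi> \<phi>' \<phi>'' :: "real \<Rightarrow> real"
  assumes ab: "a \<le> b"
    and d1: "\<And>x. x \<in> {a..b} \<Longrightarrow> (\<phi> has_real_derivative \<phi>' x) (at x)"
    and d2: "\<And>x. x \<in> {a..b} \<Longrightarrow> (\<phi>' has_real_derivative \<phi>'' x) (at x)"
    and lam: "0 < l" "\<And>x. x \<in> {a..b} \<Longrightarrow> l \<le> \<bar>\<phi>' x\<bar>"
    and Lam: "\<And>x. x \<in> {a..b} \<Longrightarrow> \<bar>\<phi>'' x\<bar> \<le> L" "0 \<le> L"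
  shows "cmod (integral {a..b} (\<lambda>x. exp2pi (\<phi> x))) \<le> 1 / l + (b - a) * (L / l\<^sup>2)"
proof -
  define c :: complex where "c = 2 * of_real pi * \<i>"
  have c0: "c \<noteq> 0" by (simp add: c_def)
  have cn: "cmod c = 2 * pi" by (simp add: c_def norm_mult)
  have pi2: "2 \<le> 2 * pi" using pi_ge_two by simp
  have nz: "\<phi>' x \<noteq> 0" if "x \<in> {a..b}" for x
    using lam(2) [OF that] lam(1) by auto
  \<comment> \<open>H is a primitive of exp2pi(phi) up to the remainder r.\<close>
  define H where "H x = exp2pi (\<phi> x) * of_real (1 / \<phi>' x) / c" for x
  define r where "r x = exp2pi (\<phi> x) * of_real (\<phi>'' x / (\<phi>' x)\<^sup>2) / c" for x
  have H': "(H has_vector_derivative (exp2pi (\<phi> x) - r x)) (at x within {a..b})" if x: "x \<in> {a..b}" for x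
  proof -
    have "((\<lambda>x. 1 / \<phi>' x) has_real_derivative (- \<phi>'' x / (\<phi>' x)\<^sup>2)) (at x)"
      using d2 [OF x] nz [OF x] by (auto intro!: derivative_eq_intros simp: power2_eq_square)
    then have "((\<lambda>x. complex_of_real (1 / \<phi>' x)) has_vector_derivative of_real (- \<phi>'' x / (\<phi>' x)\<^sup>2)) (at x)"
      by (rule has_vector_derivative_of_real)
    from has_vector_derivative_divide
      [OF has_vector_derivative_mult [OF exp2pi_has_vector_derivative [OF d1 [OF x]] this], of c]
    have "(H has_vector_derivative ((exp2pi (\<phi> x) * of_real (- \<phi>'' x / (\<phi>' x)\<^sup>2)
        + c * of_real (\<phi>' x) * exp2pi (\<phi> x) * of_real (1 / \<phi>' x)) / c)) (at x)"
      unfolding H_def [abs_def] c_def .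
    also have "(exp2pi (\<phi> x) * of_real (- \<phi>'' x / (\<phi>' x)\<^sup>2)
        + c * of_real (\<phi>' x) * exp2pi (\<phi> x) * of_real (1 / \<phi>' x)) / c = exp2pi (\<phi> x) - r x"
      using nz [OF x] c0 by (simp add: r_def field_simps)
    finally show ?thesis by (rule has_vector_derivative_at_within)
  qed
  have 1: "((\<lambda>x. exp2pi (\<phi> x) - r x) has_integral (H b - H a)) {a..b}"
    by (rule fundamental_theorem_of_calculus [OF ab H'])
  have "continuous_on {a..b} \<phi>"
    using d1 by (meson DERIV_continuous_on has_field_derivative_at_within)
  then have "(\<lambda>x. exp2pi (\<phi> x)) integrable_on {a..b}"
    by (intro integrable_continuous_real continuous_on_exp2pi)
  then have 2: "((\<lambda>x. exp2pi (\<phi> x)) has_integral integral {a..b} (\<lambda>x. exp2pi (\<phi> x))) {a..b}"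
    by (rule integrable_integral)
  define J where "J = integral {a..b} (\<lambda>x. exp2pi (\<phi> x))"
  have 3: "(r has_integral (J - (H b - H a))) {a..b}"
    using has_integral_diff [OF 2 1] by (simp add: J_def)
  have rb: "norm (r x) \<le> L / l\<^sup>2" if x: "x \<in> {a..b}" for x
  proof -
    have "norm (r x) = \<bar>\<phi>'' x\<bar> / (\<phi>' x)\<^sup>2 / (2 * pi)"
      by (simp add: r_def norm_mult norm_divide cn del: of_real_divide)
    also have "\<dots> \<le> L / l\<^sup>2 / 1"
    proof (intro frac_le)
      show "l\<^sup>2 \<le> (\<phi>' x)\<^sup>2"
        using power_mono [OF lam(2) [OF x], of 2] lam(1) by simp
    qed (use Lam x lam(1) pi2 in auto)
    finally show ?thesis by simp
  qed
  have "norm (J - (H b - H a)) \<le> L / l\<^sup>2 * measure lborel (cbox a b)"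
    by (rule has_integral_bound [of _ r]) (use Lam(2) lam(1) 3 rb in auto)
  then have J: "norm (J - (H b - H a)) \<le> (b - a) * (L / l\<^sup>2)"
    using ab by (simp add: mult.commute)
  have Hb: "norm (H x) \<le> 1 / (2 * l)" if x: "x \<in> {a..b}" for x
  proof -
    have "norm (H x) = 1 / (2 * pi * \<bar>\<phi>' x\<bar>)"
      by (simp add: H_def norm_mult norm_divide cn)
    also have "\<dots> \<le> 1 / (2 * l)"
      using lam(1) lam(2) [OF x] pi2 by (intro divide_left_mono mult_mono mult_pos_pos) auto
    finally show ?thesis .
  qed
  have "norm J \<le> norm (J - (H b - H a)) + (norm (H b) + norm (H a))"
    by (metis norm_triangle_sub norm_triangle_ineq4 add.commute add_mono_thms_linordered_semiring(2) order_trans)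
  also have "\<dots> \<le> (b - a) * (L / l\<^sup>2) + (1 / (2 * l) + 1 / (2 * l))"
    using J Hb [of a] Hb [of b] ab by (intro add_mono) auto
  finally show ?thesis using lam(1) by (simp add: J_def)
qed

text \<open>
A nonzero integral linear form is small only near its root, since its slope is at least one in
absolute value; a nonzero constant form is never small.  The bounds to the left of c and to the
right of d are stated only when those parts are nondegenerate.
\<close>

lemma linear_form_small_interval:
  fixes A B :: int and X \<delta> :: real
  assumes AB: "A \<noteq> 0 \<or> B \<noteq> 0" and \<delta>: "0 < \<delta>" "\<delta> < 1" and X: "0 \<le> X"
  obtains c d where "0 \<le> c" "c \<le> d" "d \<le> X" "d - c \<le> 2 * \<delta>"
    "\<And>x. 0 < c \<Longrightarrow> x \<le> c \<Longrightarrow> \<delta> \<le> \<bar>real_of_int A * x + real_of_int B\<bar>"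
    "\<And>x. d < X \<Longrightarrow> d \<le> x \<Longrightarrow> \<delta> \<le> \<bar>real_of_int A * x + real_of_int B\<bar>"
proof (cases "A = 0")
  case True
  then have "1 \<le> \<bar>B\<bar>" using AB by linarith
  then have "1 \<le> \<bar>real_of_int B\<bar>" by linarith
  then show ?thesis
    using that [of 0 0] True \<delta> X by auto
next
  case False
  then have "1 \<le> \<bar>A\<bar>" by linarith
  then have A1: "1 \<le> \<bar>real_of_int A\<bar>" by linarith
  define x0 where "x0 = - B / A"
  have far: "\<delta> \<le> \<bar>real_of_int A * x + real_of_int B\<bar>" if "\<delta> \<le> \<bar>x - x0\<bar>" for x
  proof -
    have "real_of_int A * x + real_of_int B = A * (x - x0)"
      using False by (simp add: x0_def field_simps)
    then have "\<bar>real_of_int A * x + real_of_int B\<bar> = \<bar>real_of_int A\<bar> * \<bar>x - x0\<bar>" by (simp add: abs_mult)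
    moreover have "1 * \<bar>x - x0\<bar> \<le> \<bar>real_of_int A\<bar> * \<bar>x - x0\<bar>"
      using A1 by (intro mult_right_mono) auto
    ultimately show ?thesis using that by simp
  qed
  show ?thesis
  proof (rule that [of "max 0 (min X (x0 - \<delta>))" "max 0 (min X (x0 + \<delta>))"])
    show "\<delta> \<le> \<bar>real_of_int A * x + real_of_int B\<bar>" if "0 < max 0 (min X (x0 - \<delta>))" "x \<le> max 0 (min X (x0 - \<delta>))" for x
      using that \<delta> by (intro far) linarith
    show "\<delta> \<le> \<bar>real_of_int A * x + real_of_int B\<bar>" if "max 0 (min X (x0 + \<delta>)) < X" "max 0 (min X (x0 + \<delta>)) \<le> x" for x
      using that \<delta> by (intro far) linarith
  qed (use \<delta> X in linarith)+
qed

text \<open>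
The interval splits into a neighbourhood of the root, where the trivial bound is used,
and at most two intervals on which the linear form is at least \<delta>.
\<close>

lemma integral_bound_off_root:
  fixes f :: "real \<Rightarrow> complex" and A B :: int
  assumes AB: "A \<noteq> 0 \<or> B \<noteq> 0" and \<delta>: "0 < \<delta>" "\<delta> < 1" and X: "0 \<le> X"
    and cont: "continuous_on {0..X} f" and M: "\<And>x. x \<in> {0..X} \<Longrightarrow> norm (f x) \<le> M"
    and E: "0 \<le> E" "\<And>a b. \<lbrakk>0 \<le> a; a \<le> b; b \<le> X; \<And>x. x \<in> {a..b} \<Longrightarrow> \<delta> \<le> \<bar>real_of_int A * x + real_of_int B\<bar>\<rbrakk>
      \<Longrightarrow> norm (integral {a..b} f) \<le> E"
  shows "norm (integral {0..X} f) \<le> 2 * E + 2 * \<delta> * M"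
proof -
  obtain c d where cd: "0 \<le> c" "c \<le> d" "d \<le> X" "d - c \<le> 2 * \<delta>"
    and c: "\<And>x. 0 < c \<Longrightarrow> x \<le> c \<Longrightarrow> \<delta> \<le> \<bar>real_of_int A * x + real_of_int B\<bar>"
    and d: "\<And>x. d < X \<Longrightarrow> d \<le> x \<Longrightarrow> \<delta> \<le> \<bar>real_of_int A * x + real_of_int B\<bar>"
    using linear_form_small_interval [OF AB \<delta> X] by blast
  have M0: "0 \<le> M" using order_trans [OF norm_ge_zero M [of 0]] X by simp
  have int: "f integrable_on {a..b}" if "0 \<le> a" "b \<le> X" for a b
    using that by (intro integrable_continuous_real continuous_on_subset [OF cont]) auto
  have "integral {0..X} f = integral {0..c} f + integral {c..X} f"
    using cd int by (intro Henstock_Kurzweil_Integration.integral_combine [symmetric]) auto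
  also have "integral {c..X} f = integral {c..d} f + integral {d..X} f"
    using cd int by (intro Henstock_Kurzweil_Integration.integral_combine [symmetric]) auto
  finally have eq: "integral {0..X} f = integral {0..c} f + (integral {c..d} f + integral {d..X} f)" .
  have 1: "norm (integral {0..c} f) \<le> E"
  proof (cases "c = 0")
    case False
    then show ?thesis using cd c by (intro E(2)) auto
  qed (simp add: E(1))
  have 3: "norm (integral {d..X} f) \<le> E"
  proof (cases "d = X")
    case False
    then show ?thesis using cd d by (intro E(2)) auto
  qed (simp add: E(1))
  have "norm (integral {c..d} f) \<le> M * (d - c)"
    using cd by (intro integral_bound continuous_on_subset [OF cont] M) auto
  also have "\<dots> \<le> M * (2 * \<delta>)"
    using cd M0 by (intro mult_left_mono) auto
  finally have 2: "norm (integral {c..d} f) \<le> 2 * \<delta> * M" by (simp add: mult_ac)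
  have "norm (integral {0..X} f)
      \<le> norm (integral {0..c} f) + (norm (integral {c..d} f) + norm (integral {d..X} f))"
    unfolding eq by (intro order_trans [OF norm_triangle_ineq] add_mono order_refl norm_triangle_ineq)
  then show ?thesis using 1 2 3 by linarith
qed

section \<open>Oscillatory integrals attached to two words\<close>

text \<open>
The numerator of the x-derivative of the second coordinate of the image.  It does not depend on x,
so that second derivatives are as simple as first ones.
\<close>

definition offset :: "pmap \<Rightarrow> real \<Rightarrow> real" where
  "offset g y = real_of_int (ua g) * real_of_int (qb g) - real_of_int (qa g) * (real_of_int (ub g) + y)"

lemma snd_act_has_derivative:
  assumes "den g x \<noteq> 0"
  shows "((\<lambda>x. snd (act g (x, y))) has_real_derivative offset g y / den g x ^ 2) (at x)"
proof -
  have "((\<lambda>x. (real_of_int (ua g) * x + ub g + y) / (real_of_int (qa g) * x + qb g)) has_real_derivative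
      (ua g * (real_of_int (qa g) * x + qb g) - (real_of_int (ua g) * x + ub g + y) * qa g)
        / ((qa g * x + qb g) * (qa g * x + qb g))) (at x)"
    using assms unfolding den_def by (auto intro!: derivative_eq_intros)
  also have "ua g * (real_of_int (qa g) * x + qb g) - (real_of_int (ua g) * x + ub g + y) * qa g = offset g y"
    by (simp add: offset_def algebra_simps)
  finally show ?thesis
    unfolding act_def den_def snd_conv fst_conv power2_eq_square .
qed

lemma offset_eq_slope:
  assumes "den g (fst z) \<noteq> 0"
  shows "offset g (snd z) = - slope g z * den g (fst z)"
proof -
  have "snd (act g z) * den g (fst z) = real_of_int (ua g) * fst z + ub g + snd z"
    using assms by (simp add: act_def)
  then have "slope g z * den g (fst z)
      = qa g * (real_of_int (ua g) * fst z + ub g + snd z) - ua g * den g (fst z)"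
    by (simp add: slope_def algebra_simps)
  then show ?thesis by (simp add: offset_def den_def algebra_simps)
qed

lemma inverse_den_power_has_derivative:
  fixes c :: real
  assumes "den g x \<noteq> 0"
  shows "((\<lambda>x. c / den g x ^ 2) has_real_derivative - 2 * real_of_int (qa g) * c / den g x ^ 3) (at x)"
proof -
  have "(den g has_real_derivative qa g) (at x)"
    unfolding den_def [abs_def] by (auto intro!: derivative_eq_intros)
  then have "((\<lambda>x. c / den g x ^ 2) has_real_derivative
      - (c * (2 * den g x * qa g)) / (den g x ^ 2 * den g x ^ 2)) (at x)"
    using assms by (auto intro!: derivative_eq_intros)
  moreover have "- (c * (2 * d * q)) / (d ^ 2 * d ^ 2) = - 2 * q * c / d ^ 3" if "d \<noteq> 0" for d q :: real
    using that by (simp add: field_simps eval_nat_numeral)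
  ultimately show ?thesis using assms by simp
qed

context letter_system
begin

text \<open>
The phase of the cross term that the words g and h contribute to the square of the
trigonometric sum.
\<close>

definition phase :: "pmap \<Rightarrow> pmap \<Rightarrow> real \<times> real \<Rightarrow> real \<times> real \<Rightarrow> real" where
  "phase g h \<xi> z = - (\<xi> \<bullet> act g z) + \<xi> \<bullet> act h z"

lemma rect_eq_cbox: "rect = cbox (0, 1/4) (1/16, 3/4)"
  unfolding rect_def cbox_Pair_eq by (simp add: cbox_interval)

lemma phase_split: "phase g h \<xi> (x, y)
    = - fst \<xi> * (mob g x - mob h x) - snd \<xi> * (snd (act g (x, y)) - snd (act h (x, y)))"
  by (simp add: phase_def inner_prod_def algebra_simps)

lemma continuous_on_phase:
  assumes "admissible n g" "admissible n h"
  shows "continuous_on rect (\<lambda>z. exp2pi (phase g h \<xi> z))"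
  unfolding phase_def by (intro continuous_intros continuous_on_admissible [OF assms(1)] continuous_on_admissible [OF assms(2)])

lemma continuous_on_phase_x:
  assumes "admissible n g" "admissible n h" "y \<in> {1/4..3/4}"
  shows "continuous_on {0..1/16} (\<lambda>x. exp2pi (phase g h \<xi> (x, y)))"
proof -
  have "continuous_on {0..1/16} ((\<lambda>z. exp2pi (phase g h \<xi> z)) \<circ> (\<lambda>x. (x, y)))"
    by (intro continuous_on_compose continuous_on_subset [OF continuous_on_phase [OF assms(1,2)]] continuous_intros)
       (use assms(3) in \<open>auto simp: rect_iff\<close>)
  then show ?thesis by (simp add: o_def)
qed

lemma integral_phase_xy:
  assumes "admissible n g" "admissible n h"
  shows "integral rect (\<lambda>z. exp2pi (phase g h \<xi> z))
      = integral {0..1/16} (\<lambda>x. integral {1/4..3/4} (\<lambda>y. exp2pi (phase g h \<xi> (x, y))))"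
    and "integral rect (\<lambda>z. exp2pi (phase g h \<xi> z))
      = integral {1/4..3/4} (\<lambda>y. integral {0..1/16} (\<lambda>x. exp2pi (phase g h \<xi> (x, y))))"
    and "continuous_on {0..1/16} (\<lambda>x. integral {1/4..3/4} (\<lambda>y. exp2pi (phase g h \<xi> (x, y))))"
    and "continuous_on {1/4..3/4} (\<lambda>y. integral {0..1/16} (\<lambda>x. exp2pi (phase g h \<xi> (x, y))))"
proof -
  have c: "continuous_on (cbox (0, 1/4) (1/16, 3/4)) (\<lambda>z. exp2pi (phase g h \<xi> z))"
    using continuous_on_phase [OF assms] unfolding rect_eq_cbox .
  have c': "continuous_on (cbox (0, 1/4) (1/16, 3/4)) (\<lambda>(x, y). exp2pi (phase g h \<xi> (x, y)))"
    using c by (simp add: case_prod_unfold)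
  show 1: "integral rect (\<lambda>z. exp2pi (phase g h \<xi> z))
      = integral {0..1/16} (\<lambda>x. integral {1/4..3/4} (\<lambda>y. exp2pi (phase g h \<xi> (x, y))))"
    using integral_prod_continuous [OF c] by (simp add: rect_eq_cbox)
  show "integral rect (\<lambda>z. exp2pi (phase g h \<xi> z))
      = integral {1/4..3/4} (\<lambda>y. integral {0..1/16} (\<lambda>x. exp2pi (phase g h \<xi> (x, y))))"
    unfolding 1 using integral_swap_continuous [OF c'] by simp
  show "continuous_on {0..1/16} (\<lambda>x. integral {1/4..3/4} (\<lambda>y. exp2pi (phase g h \<xi> (x, y))))"
    using integral_continuous_on_param [of "{0..1/16}" "1/4" "3/4" "\<lambda>x y. exp2pi (phase g h \<xi> (x, y))"] c'
    by (simp add: cbox_Pair_eq)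
  have "continuous_on ({1/4..3/4} \<times> {0..1/16}) ((\<lambda>z. exp2pi (phase g h \<xi> z)) \<circ> prod.swap)"
    by (intro continuous_on_compose continuous_on_subset [OF continuous_on_phase [OF assms]] continuous_on_swap)
       (auto simp: rect_iff)
  then show "continuous_on {1/4..3/4} (\<lambda>y. integral {0..1/16} (\<lambda>x. exp2pi (phase g h \<xi> (x, y))))"
    using integral_continuous_on_param [of "{1/4..3/4}" "0" "1/16" "\<lambda>y x. exp2pi (phase g h \<xi> (x, y))"]
    by (simp add: case_prod_unfold o_def prod.swap_def)
qed

lemma den_difference:
  "den g x - den h x = real_of_int (qa g - qa h) * x + real_of_int (qb g - qb h)"
  by (simp add: den_def algebra_simps)

text \<open>
For fixed x the phase is linear in y with slope - \<xi>_2 (1 / den g - 1 / den h).  Away from the root of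
den g - den h this is at least |\<xi>_2| \<delta> / Q^2.
\<close>

lemma pair_integral_vertical:
  assumes g: "admissible n g" and h: "admissible n h"
    and ne: "qa g \<noteq> qa h \<or> qb g \<noteq> qb h" and \<delta>: "0 < \<delta>" "\<delta> < 1" and \<xi>: "snd \<xi> \<noteq> 0"
    and Q: "Q = (68 * real R) ^ n"
  shows "cmod (integral rect (\<lambda>z. exp2pi (phase g h \<xi> z))) \<le> 2 * (Q ^ 2 / (\<bar>snd \<xi>\<bar> * \<delta>)) + 2 * \<delta>"
proof -
  have R68: "1 \<le> 68 * real R" using R_ge by simp
  have Q1: "1 \<le> Q" unfolding Q using R68 by (rule one_le_power)
  define E where "E = Q ^ 2 / (\<bar>snd \<xi>\<bar> * \<delta>)"
  have E0: "0 \<le> E" using \<delta> by (simp add: E_def)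
  define f where "f x = integral {1/4..3/4} (\<lambda>y. exp2pi (phase g h \<xi> (x, y)))" for x
  have AB: "qa g - qa h \<noteq> 0 \<or> qb g - qb h \<noteq> 0" using ne by auto
  have bound: "cmod (f x) \<le> E" if x: "x \<in> {0..1/16}" and far: "\<delta> \<le> \<bar>den g x - den h x\<bar>" for x
  proof -
    have D: "1 \<le> den g x" "den g x \<le> Q" "1 \<le> den h x" "den h x \<le> Q"
      using admissibleD(5,6) [OF g x] admissibleD(5,6) [OF h x] by (auto simp: Q)
    define b where "b = - snd \<xi> * (1 / den g x - 1 / den h x)"
    define c where "c = - fst \<xi> * (mob g x - mob h x)
      - snd \<xi> * ((ua g * x + ub g) / den g x - (ua h * x + ub h) / den h x)"
    have ph: "phase g h \<xi> (x, y) = c + b * y" for y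
      by (simp add: phase_split act_def b_def c_def algebra_simps add_divide_distrib diff_divide_distrib)
    have pos: "0 < \<bar>snd \<xi>\<bar> * \<delta> / Q ^ 2" using \<xi> \<delta> Q1 by (intro divide_pos_pos mult_pos_pos) auto
    have "\<bar>snd \<xi>\<bar> * \<delta> / Q ^ 2 \<le> \<bar>snd \<xi>\<bar> * \<bar>den g x - den h x\<bar> / (den g x * den h x)"
      using far D \<delta> Q1 unfolding power2_eq_square
      by (intro frac_le mult_left_mono mult_mono mult_pos_pos) auto
    also have "\<dots> = \<bar>b\<bar>"
    proof -
      have u: "1 / den g x - 1 / den h x = (den h x - den g x) / (den g x * den h x)"
        using D by (simp add: field_simps)
      show ?thesis
        unfolding b_def u using D by (simp add: abs_mult abs_minus_commute)
    qed
    finally have b: "\<bar>snd \<xi>\<bar> * \<delta> / Q ^ 2 \<le> \<bar>b\<bar>" .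
    have "cmod (integral {1/4..3/4} (\<lambda>y. exp2pi (c + b * y)))
        \<le> 1 / (\<bar>snd \<xi>\<bar> * \<delta> / Q ^ 2) + (3/4 - 1/4) * (0 / (\<bar>snd \<xi>\<bar> * \<delta> / Q ^ 2)\<^sup>2)"
      by (rule oscillatory_integral_bound [where \<phi>' = "\<lambda>_. b" and \<phi>'' = "\<lambda>_. 0"])
         (use b pos in \<open>auto intro!: derivative_eq_intros\<close>)
    then show ?thesis by (simp add: f_def ph E_def)
  qed
  have cont: "continuous_on {0..1/16} f"
    unfolding f_def by (rule integral_phase_xy(3) [OF g h])
  have "cmod (integral {0..1/16} f) \<le> 2 * E + 2 * \<delta> * 1"
  proof (rule integral_bound_off_root [OF AB \<delta> _ cont _ E0])
    fix x :: real assume x: "x \<in> {0..1/16}"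
    have "cmod (f x) \<le> 1 * (3/4 - 1/4)"
      unfolding f_def
    proof (rule integral_bound)
      have "continuous_on {1/4..3/4} ((\<lambda>z. exp2pi (phase g h \<xi> z)) \<circ> (\<lambda>y. (x, y)))"
        by (intro continuous_on_compose continuous_on_subset [OF continuous_on_phase [OF g h]] continuous_intros)
           (use x in \<open>auto simp: rect_iff\<close>)
      then show "continuous_on {1/4..3/4} (\<lambda>y. exp2pi (phase g h \<xi> (x, y)))" by (simp add: o_def)
    qed auto
    then show "cmod (f x) \<le> 1" by simp
  next
    fix a b :: real
    assume ab: "0 \<le> a" "a \<le> b" "b \<le> 1/16"
      and far: "\<And>x. x \<in> {a..b} \<Longrightarrow> \<delta> \<le> \<bar>real_of_int (qa g - qa h) * x + real_of_int (qb g - qb h)\<bar>"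
    have "cmod (integral {a..b} f) \<le> E * (b - a)"
      using ab far by (intro integral_bound continuous_on_subset [OF cont] bound) (auto simp: den_difference)
    also have "\<dots> \<le> E * 1" using ab E0 by (intro mult_left_mono) auto
    finally show "cmod (integral {a..b} f) \<le> E" by simp
  qed simp
  then show ?thesis
    unfolding integral_phase_xy(1) [OF g h] f_def E_def by simp
qed

text \<open>
For fixed y the x-derivative of the phase is, up to the contribution of \<xi>_2,
equal to - \<xi>_1 (1 / den g ^ 2 - 1 / den h ^ 2).  This difference of squares factors into the
difference of the reciprocals, at least \<delta> / Q^2, and their sum, at least 2 / Q.  The premises
on \<xi>_2 make its contribution at most half of this.
\<close>

lemma pair_integral_horizontal:
  assumes g: "admissible n g" and h: "admissible n h"
    and ne: "qa g \<noteq> qa h \<or> qb g \<noteq> qb h" and \<delta>: "0 < \<delta>" "\<delta> < 1" and \<xi>: "fst \<xi> \<noteq> 0"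
    and Q: "Q = (68 * real R) ^ n"
    and small: "6 * \<bar>snd \<xi>\<bar> \<le> \<bar>fst \<xi>\<bar> * \<delta> / Q ^ 3" "\<bar>snd \<xi>\<bar> \<le> \<bar>fst \<xi>\<bar>"
  shows "cmod (integral rect (\<lambda>z. exp2pi (phase g h \<xi> z)))
    \<le> 2 * (Q ^ 3 / (\<bar>fst \<xi>\<bar> * \<delta>) + 16 * Q ^ 6 / (\<bar>fst \<xi>\<bar> * \<delta>\<^sup>2)) + 2 * \<delta>"
proof -
  have R68: "1 \<le> 68 * real R" using R_ge by simp
  have Q1: "1 \<le> Q" unfolding Q using R68 by (rule one_le_power)
  define l where "l = \<bar>fst \<xi>\<bar> * \<delta> / Q ^ 3"
  have l0: "0 < l" unfolding l_def using \<xi> \<delta> Q1 by (intro divide_pos_pos mult_pos_pos) auto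
  define L where "L = 16 * \<bar>fst \<xi>\<bar>"
  define E where "E = 1 / l + L / l\<^sup>2"
  have E0: "0 \<le> E" using l0 by (simp add: E_def L_def)
  have E_eq: "E = Q ^ 3 / (\<bar>fst \<xi>\<bar> * \<delta>) + 16 * Q ^ 6 / (\<bar>fst \<xi>\<bar> * \<delta>\<^sup>2)"
  proof -
    have "L / l\<^sup>2 = 16 * \<bar>fst \<xi>\<bar> * (Q ^ 3)\<^sup>2 / (\<bar>fst \<xi>\<bar>\<^sup>2 * \<delta>\<^sup>2)"
      by (simp add: L_def l_def power_divide power_mult_distrib)
    also have "(Q ^ 3)\<^sup>2 = Q ^ 6" by (simp add: power_mult [symmetric])
    also have "16 * \<bar>fst \<xi>\<bar> * Q ^ 6 / (\<bar>fst \<xi>\<bar>\<^sup>2 * \<delta>\<^sup>2) = 16 * Q ^ 6 / (\<bar>fst \<xi>\<bar> * \<delta>\<^sup>2)"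
    proof -
      have r: "16 * a * q / (a\<^sup>2 * d) = 16 * q / (a * d)" if "a \<noteq> 0" for a q d :: real
        using that by (simp add: power2_eq_square)
      show ?thesis by (rule r) (use \<xi> in simp)
    qed
    finally show ?thesis by (simp add: E_def l_def)
  qed
  have AB: "qa g - qa h \<noteq> 0 \<or> qb g - qb h \<noteq> 0" using ne by auto
  define f where "f y = integral {0..1/16} (\<lambda>x. exp2pi (phase g h \<xi> (x, y)))" for y
  have bound: "cmod (f y) \<le> 2 * E + 2 * \<delta> * 1" if y: "y \<in> {1/4..3/4}" for y
    unfolding f_def
  proof (rule integral_bound_off_root [OF AB \<delta> _ continuous_on_phase_x [OF g h y] _ E0])
    fix a b :: real
    assume ab: "0 \<le> a" "a \<le> b" "b \<le> 1/16"
      and far: "\<And>x. x \<in> {a..b} \<Longrightarrow> \<delta> \<le> \<bar>real_of_int (qa g - qa h) * x + real_of_int (qb g - qb h)\<bar>"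
    define \<phi>' where "\<phi>' x = - fst \<xi> * (1 / den g x ^ 2 - 1 / den h x ^ 2)
      - snd \<xi> * (offset g y / den g x ^ 2 - offset h y / den h x ^ 2)" for x
    define \<phi>'' where "\<phi>'' x = - fst \<xi> * (- 2 * real_of_int (qa g) * 1 / den g x ^ 3 - - 2 * real_of_int (qa h) * 1 / den h x ^ 3)
      - snd \<xi> * (- 2 * real_of_int (qa g) * offset g y / den g x ^ 3 - - 2 * real_of_int (qa h) * offset h y / den h x ^ 3)" for x
    have one: "\<bar>offset k y / den k x ^ 2\<bar> \<le> 3" "\<bar>- 2 * real_of_int (qa k) * 1 / den k x ^ 3\<bar> \<le> 2"
        "\<bar>- 2 * real_of_int (qa k) * offset k y / den k x ^ 3\<bar> \<le> 6" "1 \<le> den k x" "den k x \<le> Q"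
      if k: "admissible n k" and x: "x \<in> {a..b}" for k x
    proof -
      have x': "x \<in> {0..1/16}" using x ab by auto
      show D: "1 \<le> den k x" "den k x \<le> Q"
        using admissibleD(5,6) [OF k x'] by (auto simp: Q)
      have qD: "0 \<le> real_of_int (qa k)" "real_of_int (qa k) \<le> den k x"
      proof -
        have "0 \<le> qa k * x" using x' admissibleD(2) [OF k] by simp
        then show "real_of_int (qa k) \<le> den k x"
          using admissibleD(3) [OF k] unfolding den_def by (smt (verit) of_int_le_iff)
      qed (use admissibleD(2) [OF k] in simp)
      have z: "(x, y) \<in> rect" using x' y by (simp add: rect_iff)
      have s: "0 \<le> slope k (x, y)" "slope k (x, y) \<le> 3" using admissibleD(9,10) [OF k z] by auto
      have off: "offset k y = - slope k (x, y) * den k x"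
        using offset_eq_slope [of k "(x, y)"] D by simp
      have abs_off: "\<bar>offset k y\<bar> \<le> 3 * den k x"
        using s D by (simp add: off abs_mult)
      have D2: "den k x \<le> den k x ^ 2" "0 < den k x ^ 2" using D by (auto simp: power2_eq_square)
      have D3: "den k x * den k x \<le> den k x ^ 3" "0 < den k x ^ 3"
        using D by (auto simp: power3_eq_cube mult_le_cancel_left1)
      have D13: "den k x \<le> den k x * den k x" using D by (simp add: mult_le_cancel_left1)
      show "\<bar>offset k y / den k x ^ 2\<bar> \<le> 3"
        using abs_off D2 by (simp add: pos_divide_le_eq)
      have "real_of_int (qa k) \<le> den k x ^ 3" using qD(2) D13 D3(1) by linarith
      then show "\<bar>- 2 * real_of_int (qa k) * 1 / den k x ^ 3\<bar> \<le> 2"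
        using qD(1) D3(2) by (simp add: pos_divide_le_eq abs_mult)
      have "real_of_int (qa k) * \<bar>offset k y\<bar> \<le> den k x * (3 * den k x)"
        using qD abs_off D by (intro mult_mono) auto
      also have "\<dots> \<le> 3 * den k x ^ 3" using D3 by simp
      finally show "\<bar>- 2 * real_of_int (qa k) * offset k y / den k x ^ 3\<bar> \<le> 6"
        using qD D3(2) by (simp add: pos_divide_le_eq abs_mult)
    qed
    have "cmod (integral {a..b} (\<lambda>x. exp2pi (phase g h \<xi> (x, y)))) \<le> 1 / l + (b - a) * (L / l\<^sup>2)"
    proof (rule oscillatory_integral_bound [where \<phi>' = \<phi>' and \<phi>'' = \<phi>''])
      fix x assume x: "x \<in> {a..b}"
      note og = one [OF g x] and oh = one [OF h x]
      have nz: "den g x \<noteq> 0" "den h x \<noteq> 0" using og(4) oh(4) by auto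
      show "((\<lambda>x. phase g h \<xi> (x, y)) has_real_derivative \<phi>' x) (at x)"
        unfolding phase_split \<phi>'_def
        by (intro DERIV_diff DERIV_cmult mob_has_derivative snd_act_has_derivative nz
            admissibleD(1) [OF g] admissibleD(1) [OF h])
      show "(\<phi>' has_real_derivative \<phi>'' x) (at x)"
        unfolding \<phi>'_def [abs_def] \<phi>''_def
        by (intro DERIV_diff DERIV_cmult inverse_den_power_has_derivative nz)
      show "\<bar>\<phi>'' x\<bar> \<le> L"
      proof -
        have "\<bar>\<phi>'' x\<bar> \<le> \<bar>fst \<xi>\<bar> * (2 + 2) + \<bar>snd \<xi>\<bar> * (6 + 6)"
          unfolding \<phi>''_def
          by (intro order_trans [OF abs_triangle_ineq4] add_mono, unfold abs_mult abs_minus_cancel)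
             (intro mult_left_mono order_trans [OF abs_triangle_ineq4] add_mono og oh; simp)+
        then show ?thesis using small(2) by (simp add: L_def)
      qed
      show "l \<le> \<bar>\<phi>' x\<bar>"
      proof -
        define u where "u = 1 / den g x - 1 / den h x"
        define v where "v = 1 / den g x + 1 / den h x"
        have far': "\<delta> \<le> \<bar>den g x - den h x\<bar>" using far [OF x] by (simp add: den_difference)
        have "u = - (den g x - den h x) / (den g x * den h x)"
          using nz by (simp add: u_def field_simps)
        then have "\<bar>u\<bar> = \<bar>den g x - den h x\<bar> / (den g x * den h x)"
          using og(4) oh(4) by (simp add: abs_mult)
        moreover have "\<delta> / (Q * Q) \<le> \<bar>den g x - den h x\<bar> / (den g x * den h x)"
          using far' og(4,5) oh(4,5) \<delta> by (intro frac_le mult_mono mult_pos_pos) auto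
        ultimately have u: "\<delta> / (Q * Q) \<le> \<bar>u\<bar>" by simp
        have "1 / Q \<le> 1 / den g x" "1 / Q \<le> 1 / den h x"
          using og(4,5) oh(4,5) Q1 by (auto intro!: divide_left_mono mult_pos_pos)
        then have v: "2 / Q \<le> v" by (simp add: v_def)
        have v0: "0 \<le> v" using v Q1 by (smt (verit) divide_nonneg_nonneg)
        have "2 * l = \<bar>fst \<xi>\<bar> * (\<delta> / (Q * Q) * (2 / Q))"
          by (simp add: l_def power3_eq_cube)
        also have "\<dots> \<le> \<bar>fst \<xi>\<bar> * (\<bar>u\<bar> * v)"
          using u v \<delta> Q1 by (intro mult_left_mono mult_mono) auto
        also have "\<dots> = \<bar>fst \<xi> * (u * v)\<bar>" using v0 by (simp add: abs_mult)
        also have "u * v = 1 / den g x ^ 2 - 1 / den h x ^ 2"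
          by (simp add: u_def v_def algebra_simps power2_eq_square)
        finally have main: "2 * l \<le> \<bar>fst \<xi> * (1 / den g x ^ 2 - 1 / den h x ^ 2)\<bar>" .
        have "\<bar>snd \<xi> * (offset g y / den g x ^ 2 - offset h y / den h x ^ 2)\<bar> \<le> \<bar>snd \<xi>\<bar> * (3 + 3)"
          unfolding abs_mult by (intro mult_left_mono order_trans [OF abs_triangle_ineq4] add_mono og oh) simp
        also have "\<dots> \<le> l" using small(1) by (simp add: l_def)
        finally show ?thesis
          using main unfolding \<phi>'_def by linarith
      qed
    qed (use ab l0 in \<open>auto simp: L_def\<close>)
    also have "\<dots> \<le> 1 / l + 1 * (L / l\<^sup>2)"
      using ab l0 by (intro add_left_mono mult_right_mono) (auto simp: L_def)
    finally show "cmod (integral {a..b} (\<lambda>x. exp2pi (phase g h \<xi> (x, y)))) \<le> E"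
      by (simp add: E_def)
  qed auto
  have "cmod (integral {1/4..3/4} f) \<le> (2 * E + 2 * \<delta> * 1) * (3/4 - 1/4)"
    by (rule integral_bound) (use bound integral_phase_xy(4) [OF g h] in \<open>auto simp: f_def\<close>)
  also have "\<dots> \<le> 2 * E + 2 * \<delta>"
    using E0 \<delta> by simp
  finally show ?thesis
    unfolding integral_phase_xy(2) [OF g h] f_def E_eq .
qed

end

section \<open>The mean square of the trigonometric sums\<close>

lemma mob_cong_entries: "mob_entries g = mob_entries h \<Longrightarrow> mob g = mob h"
  by (simp add: mob_entries_def mob_def den_def fun_eq_iff)

lemma mob_entries_pcomp: "mob_entries g = mob_entries g' \<Longrightarrow> mob_entries h = mob_entries h' \<Longrightarrow> mob_entries (pcomp g h) = mob_entries (pcomp g' h')"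
  by (simp add: mob_entries_def pcomp_def)

lemma inner_abs_le_ldist:
  "\<bar>\<xi> \<bullet> z - \<xi> \<bullet> w\<bar> \<le> max \<bar>fst \<xi>\<bar> \<bar>snd \<xi>\<bar> * ldist z w"
proof -
  have "\<xi> \<bullet> z - \<xi> \<bullet> w = fst \<xi> * (fst z - fst w) + snd \<xi> * (snd z - snd w)"
    by (simp add: inner_prod_def algebra_simps)
  then have "\<bar>\<xi> \<bullet> z - \<xi> \<bullet> w\<bar> \<le> \<bar>fst \<xi>\<bar> * \<bar>fst z - fst w\<bar> + \<bar>snd \<xi>\<bar> * \<bar>snd z - snd w\<bar>"
    by (metis abs_mult abs_triangle_ineq)
  also have "\<dots> \<le> max \<bar>fst \<xi>\<bar> \<bar>snd \<xi>\<bar> * \<bar>fst z - fst w\<bar> + max \<bar>fst \<xi>\<bar> \<bar>snd \<xi>\<bar> * \<bar>snd z - snd w\<bar>"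
    by (intro add_mono mult_right_mono) auto
  finally show ?thesis by (simp add: ldist_def distrib_left)
qed

context letter_system
begin

lemma mob_entries_word: "map mob_entries w = map mob_entries w' \<Longrightarrow> mob_entries (word w) = mob_entries (word w')"
proof (induction w arbitrary: w')
  case (Cons a w)
  then obtain b v where "w' = b # v" "mob_entries a = mob_entries b" "map mob_entries w = map mob_entries v" by auto
  then show ?case using Cons.IH by (auto intro: mob_entries_pcomp)
qed simp

lemma mob_word_Cons:
  assumes "a \<in> G" "x \<in> {0..1/16}"
  shows "mob (word (a # w)) x = mob (word w) (mob a x)"
proof -
  have "(x, 1/2) \<in> rect" using assms(2) by (simp add: rect_iff)
  from den_letter_nz [OF assms(1) this] show ?thesis by (simp add: mob_comp)
qed

text \<open>
The innermost letters are compared last: the induction hypothesis identifies the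
remaining letters, their common Moebius map is injective, and disjointness then
separates the innermost letters.
\<close>

lemma mob_word_disjoint:
  "\<lbrakk>w \<in> words n; w' \<in> words n; x \<in> {0..1/16}; y \<in> {0..1/16}; mob (word w) x = mob (word w') y\<rbrakk>
    \<Longrightarrow> map mob_entries w = map mob_entries w'"
proof (induction w arbitrary: n w' x y)
  case Nil
  then show ?case by (auto simp: words_def)
next
  case (Cons a w)
  then obtain b v where w': "w' = b # v"
    by (cases w') (auto simp: words_def)
  have mem: "a \<in> G" "b \<in> G" "w \<in> words (length w)" "v \<in> words (length w)"
    using Cons.prems(1,2) w' by (auto simp: words_def)
  have x: "mob a x \<in> {0..1/16}" and y: "mob b y \<in> {0..1/16}"
    using mob_mem [OF mem(1) Cons.prems(3)] mob_mem [OF mem(2) Cons.prems(4)] by auto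
  have eq: "mob (word w) (mob a x) = mob (word v) (mob b y)"
    using Cons.prems(5) w' mob_word_Cons [OF mem(1) Cons.prems(3)] mob_word_Cons [OF mem(2) Cons.prems(4)]
    by simp
  have tl: "map mob_entries w = map mob_entries v"
    by (rule Cons.IH [OF mem(3,4) x y eq])
  have same: "mob (word w) = mob (word v)"
    by (rule mob_cong_entries [OF mob_entries_word [OF tl]])
  have adm: "admissible (length w) (word w)" by (rule admissible_word [OF mem(3)])
  have nz: "den (word w) (mob a x) \<noteq> 0" "den (word w) (mob b y) \<noteq> 0"
    using admissibleD(6) [OF adm x] admissibleD(6) [OF adm y] by auto
  have "(mob a x - mob b y) / (den (word w) (mob a x) * den (word w) (mob b y)) = 0"
    using mob_diff [OF nz admissibleD(1) [OF adm]] eq same by simp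
  then have "mob a x = mob b y" using nz by simp
  then have "mob_entries a = mob_entries b"
    by (rule mob_disjoint [OF mem(1,2) Cons.prems(3,4)])
  then show ?case using tl w' by simp
qed

text \<open>
The determinant determines pb modulo qb from the bottom row, and 0 \<le> pb < qb because the
image of 0 lies in the unit interval.  So both words send 0 to the same point.
\<close>

lemma letters_eq_of_denominators:
  assumes w: "w \<in> words n" and w': "w' \<in> words n"
    and q: "qa (word w) = qa (word w')" "qb (word w) = qb (word w')"
  shows "map mob_entries w = map mob_entries w'"
proof -
  define g h where "g = word w" and "h = word w'"
  have g: "admissible n g" and h: "admissible n h"
    using admissible_word [OF w] admissible_word [OF w'] by (auto simp: g_def h_def)
  have range: "0 \<le> pb k \<and> pb k < qb k" if k: "admissible n k" for k
  proof -
    have "1 \<le> den k 0" "mob k 0 \<in> {0..1/16}" using admissibleD(6,7) [OF k, of 0] by auto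
    then have "0 < real_of_int (qb k)" "0 \<le> real_of_int (pb k) / qb k" "real_of_int (pb k) / qb k < 1"
      by (auto simp: mob_def den_def)
    then show ?thesis by (auto simp: zero_le_divide_iff field_simps)
  qed
  have "pa g * qb g - pb g * qa g = 1" "pa h * qb g - pb h * qa g = 1"
    using admissibleD(1) [OF g] admissibleD(1) [OF h] q by (auto simp: g_def h_def)
  note dets = this
  have eq: "(pa g - pa h) * qb g = (pb g - pb h) * qa g"
    using dets by (simp add: algebra_simps)
  have cop: "coprime (qb g) (qa g)"
  proof (rule coprimeI)
    fix c assume "c dvd qb g" "c dvd qa g"
    then have "c dvd pa g * qb g - pb g * qa g" by (intro dvd_diff dvd_mult)
    then show "is_unit c" using dets(1) by simp
  qed
  have "qb g dvd (pb g - pb h) * qa g" using eq by (metis dvd_triv_right)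
  then have dv: "qb g dvd pb g - pb h" using cop coprime_dvd_mult_left_iff by blast
  have "\<bar>pb g - pb h\<bar> < qb g"
    using range [OF g] range [OF h] q by (auto simp: g_def h_def)
  then have "pb g = pb h" using dv zdvd_imp_le [of "qb g" "\<bar>pb g - pb h\<bar>"] by auto
  then have "mob g 0 = mob h 0" using q by (simp add: mob_def den_def g_def h_def)
  then show ?thesis
    unfolding g_def h_def by (intro mob_word_disjoint [OF w w']) auto
qed

lemma card_words_fibre: "card {w \<in> words n. map mob_entries w = ms} \<le> (4 * R) ^ n"
proof (induction n arbitrary: ms)
  case 0
  have "{w \<in> words 0. map mob_entries w = ms} \<subseteq> {[]}" by (auto simp: words_0)
  from card_mono [OF _ this] show ?case by simp
next
  case (Suc n)
  show ?case
  proof (cases ms)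
    case Nil
    then have "{w \<in> words (Suc n). map mob_entries w = ms} = {}" by (auto simp: words_def)
    then show ?thesis by (simp only: card.empty le0)
  next
    case (Cons m ms')
    have "{w \<in> words (Suc n). map mob_entries w = ms}
        \<subseteq> (\<lambda>(a, w). a # w) ` ({a \<in> G. mob_entries a = m} \<times> {w \<in> words n. map mob_entries w = ms'})"
      using Cons by (auto simp: words_def length_Suc_conv image_iff)
    then have "card {w \<in> words (Suc n). map mob_entries w = ms}
        \<le> card ({a \<in> G. mob_entries a = m} \<times> {w \<in> words n. map mob_entries w = ms'})"
      using finite_G by (intro surj_card_le) simp_all
    also have "\<dots> \<le> (4 * R) * (4 * R) ^ n"
      unfolding card_cartesian_product by (intro mult_le_mono card_fibre Suc.IH)
    finally show ?thesis by simp
  qed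
qed

text \<open>
Divided by the number of words, this is the function whose integral is the Fourier transform
of the stationary measure.
\<close>

definition trig_sum :: "nat \<Rightarrow> real \<times> real \<Rightarrow> real \<times> real \<Rightarrow> complex" where
  "trig_sum n \<xi> z = (\<Sum>w\<in>words n. exp2pi (- (\<xi> \<bullet> act (word w) z)))"

lemma trig_sum_square:
  "complex_of_real ((cmod (trig_sum n \<xi> z))\<^sup>2) = (\<Sum>w\<in>words n. \<Sum>v\<in>words n. exp2pi (phase (word w) (word v) \<xi> z))"
proof -
  have "complex_of_real ((cmod (trig_sum n \<xi> z))\<^sup>2) = trig_sum n \<xi> z * cnj (trig_sum n \<xi> z)"
    by (rule complex_norm_square)
  also have "\<dots> = (\<Sum>w\<in>words n. \<Sum>v\<in>words n.
      exp2pi (- (\<xi> \<bullet> act (word w) z)) * cnj (exp2pi (- (\<xi> \<bullet> act (word v) z))))"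
    by (simp add: trig_sum_def sum_product)
  finally show ?thesis by (simp add: exp2pi_diff phase_def)
qed

lemma continuous_on_trig_sum: "continuous_on rect (trig_sum n \<xi>)"
  unfolding trig_sum_def [abs_def]
proof (rule continuous_on_sum)
  fix w assume "w \<in> words n"
  then have "continuous_on rect (act (word w))"
    by (intro continuous_on_admissible admissible_word)
  then show "continuous_on rect (\<lambda>z. exp2pi (- (\<xi> \<bullet> act (word w) z)))"
    by (intro continuous_on_exp2pi continuous_on_minus continuous_on_inner continuous_on_const)
qed

lemma norm_trig_sum: "cmod (trig_sum n \<xi> z) \<le> card G ^ n"
  unfolding trig_sum_def using sum_norm_le [of "words n" "\<lambda>w. exp2pi (- (\<xi> \<bullet> act (word w) z))" "\<lambda>_. 1"]
  by (simp add: card_words)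

lemma cell_integral_le_1:
  assumes "admissible n g" "admissible n h"
  shows "cmod (integral rect (\<lambda>z. exp2pi (phase g h \<xi> z))) \<le> 1"
proof -
  have "(\<lambda>z. exp2pi (phase g h \<xi> z)) integrable_on cbox (0, 1/4) (1/16, 3/4)"
    using continuous_on_phase [OF assms] unfolding rect_eq_cbox by (rule integrable_continuous)
  from has_integral_bound [OF _ integrable_integral [OF this], of 1]
  have "cmod (integral rect (\<lambda>z. exp2pi (phase g h \<xi> z)))
      \<le> 1 * measure lborel (cbox (0, 1/4) (1/16, 3/4) :: (real \<times> real) set)"
    unfolding rect_eq_cbox by simp
  also have "\<dots> = 1/32" using emeasure_rect by (simp add: rect_eq_cbox measure_def)
  finally show ?thesis by simp
qed

text \<open>
Pairs with equal denominators are bounded trivially; for each word there are at most (4 R)^n of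
them among at least (272 R^2)^n words.  All other pairs contribute at most E each.
\<close>

lemma trig_sum_mean_square:
  assumes E: "0 \<le> E"
    and pair: "\<And>g h. \<lbrakk>admissible n g; admissible n h; qa g \<noteq> qa h \<or> qb g \<noteq> qb h\<rbrakk>
      \<Longrightarrow> cmod (integral rect (\<lambda>z. exp2pi (phase g h \<xi> z))) \<le> E"
  shows "integral rect (\<lambda>z. (cmod (trig_sum n \<xi> z / card G ^ n))\<^sup>2) \<le> 1 / (68 * real R) ^ n + E"
proof -
  define N where "N = real (card G) ^ n"
  have N0: "0 < N" using card_G_pos by (simp add: N_def)
  have cardW: "real (card (words n)) = N" by (simp add: card_words N_def)
  define I where "I w v = integral rect (\<lambda>z. exp2pi (phase (word w) (word v) \<xi> z))" for w v
  have int: "(\<lambda>z. exp2pi (phase (word w) (word v) \<xi> z)) integrable_on rect" if "w \<in> words n" "v \<in> words n" for w v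
    using continuous_on_phase [OF admissible_word [OF that(1)] admissible_word [OF that(2)]]
    unfolding rect_eq_cbox by (rule integrable_continuous)
  have cont: "continuous_on rect (\<lambda>z. (cmod (trig_sum n \<xi> z))\<^sup>2)"
    by (intro continuous_intros continuous_on_trig_sum)
  have row: "(\<Sum>v\<in>words n. cmod (I w v)) \<le> (4 * real R) ^ n + N * E" if w: "w \<in> words n" for w
  proof -
    \<comment> \<open>The words outside S have a denominator different from that of w.\<close>
    define S where "S = {v \<in> words n. map mob_entries v = map mob_entries w}"
    have S: "S \<subseteq> words n" "finite S" by (auto simp: S_def)
    have "(\<Sum>v\<in>words n. cmod (I w v)) = (\<Sum>v\<in>S. cmod (I w v)) + (\<Sum>v\<in>words n - S. cmod (I w v))"
      using S by (simp add: sum.subset_diff)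
    also have "(\<Sum>v\<in>S. cmod (I w v)) \<le> (\<Sum>v\<in>S. 1)"
      unfolding I_def using w S by (intro sum_mono cell_integral_le_1 [of n] admissible_word) auto
    also have "\<dots> \<le> (4 * real R) ^ n"
    proof -
      have "real (card S) \<le> real ((4 * R) ^ n)"
        unfolding S_def by (intro of_nat_mono card_words_fibre)
      then show ?thesis by simp
    qed
    also have "(\<Sum>v\<in>words n - S. cmod (I w v)) \<le> (\<Sum>v\<in>words n - S. E)"
      unfolding I_def
    proof (intro sum_mono pair)
      fix v assume v: "v \<in> words n - S"
      show "qa (word w) \<noteq> qa (word v) \<or> qb (word w) \<noteq> qb (word v)"
        using letters_eq_of_denominators [of w n v] w v by (auto simp: S_def)
    qed (use w in \<open>auto intro: admissible_word\<close>)
    also have "\<dots> \<le> (\<Sum>v\<in>words n. E)"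
      by (intro sum_mono2) (auto simp: E)
    also have "\<dots> = N * E" by (simp add: cardW)
    finally show ?thesis by simp
  qed
  have "complex_of_real (integral rect (\<lambda>z. (cmod (trig_sum n \<xi> z))\<^sup>2))
      = integral rect (\<lambda>z. complex_of_real ((cmod (trig_sum n \<xi> z))\<^sup>2))"
    using cont unfolding rect_eq_cbox
    by (intro has_integral_of_real [THEN integral_unique, symmetric] integrable_integral integrable_continuous)
  also have "\<dots> = (\<Sum>w\<in>words n. \<Sum>v\<in>words n. I w v)"
    unfolding trig_sum_square I_def
    by (simp add: Henstock_Kurzweil_Integration.integral_sum integrable_sum int)
  finally have eq: "complex_of_real (integral rect (\<lambda>z. (cmod (trig_sum n \<xi> z))\<^sup>2)) = (\<Sum>w\<in>words n. \<Sum>v\<in>words n. I w v)" .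
  have "integral rect (\<lambda>z. (cmod (trig_sum n \<xi> z))\<^sup>2) \<le> cmod (complex_of_real (integral rect (\<lambda>z. (cmod (trig_sum n \<xi> z))\<^sup>2)))"
    by simp
  also have "\<dots> \<le> (\<Sum>w\<in>words n. \<Sum>v\<in>words n. cmod (I w v))"
    unfolding eq by (intro sum_norm_le order_refl norm_sum)
  also have "\<dots> \<le> (\<Sum>w\<in>words n. (4 * real R) ^ n + N * E)"
    by (intro sum_mono row)
  also have "\<dots> = N * ((4 * real R) ^ n + N * E)"
    by (simp add: cardW)
  finally have main: "integral rect (\<lambda>z. (cmod (trig_sum n \<xi> z))\<^sup>2) \<le> N * ((4 * real R) ^ n + N * E)" .
  have sparse: "(4 * real R) ^ n / N \<le> 1 / (68 * real R) ^ n"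
  proof -
    have "28 * R ^ 3 = (28 * R) * R ^ 2" by (simp add: power3_eq_cube power2_eq_square)
    moreover have "280 * R ^ 2 \<le> (28 * R) * R ^ 2" using R_ge by (intro mult_le_mono1) simp
    ultimately have "272 * R ^ 2 \<le> card G" using card_G by linarith
    then have "272 * real R ^ 2 \<le> real (card G)"
      by (metis of_nat_le_iff of_nat_mult of_nat_numeral of_nat_power)
    then have "(4 * real R) * (68 * real R) \<le> real (card G)" by (simp add: power2_eq_square)
    then have "((4 * real R) * (68 * real R)) ^ n \<le> N"
      unfolding N_def by (intro power_mono) auto
    then have "(4 * real R) ^ n * (68 * real R) ^ n \<le> N" by (simp only: power_mult_distrib)
    then show ?thesis using N0 R_ge by (simp add: field_simps)
  qed
  have "integral rect (\<lambda>z. (cmod (trig_sum n \<xi> z / card G ^ n))\<^sup>2)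
      = integral rect (\<lambda>z. (cmod (trig_sum n \<xi> z))\<^sup>2 * (1 / N\<^sup>2))"
    by (simp add: norm_divide norm_power power_divide N_def)
  also have "\<dots> = integral rect (\<lambda>z. (cmod (trig_sum n \<xi> z))\<^sup>2) * (1 / N\<^sup>2)"
    by (rule Henstock_Kurzweil_Integration.integral_mult_left)
  also have "\<dots> \<le> N * ((4 * real R) ^ n + N * E) * (1 / N\<^sup>2)"
    by (rule mult_right_mono [OF main]) simp
  also have "\<dots> = (4 * real R) ^ n / N + E"
    using N0 by (simp add: field_simps power2_eq_square)
  finally show ?thesis using sparse by linarith
qed

end

section \<open>Fourier decay of the stationary measure\<close>

text \<open>
The Cauchy-Schwarz inequality, from |f| \<le> |f|^2 / (2 c) + c / 2.
\<close>

lemma (in prob_space) norm_integral_le_sqrt_mean_square: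
  fixes f :: "'a \<Rightarrow> complex"
  assumes f [measurable]: "f \<in> borel_measurable M" and b: "\<And>x. cmod (f x) \<le> B"
    and c: "0 < c" "(\<integral>x. (cmod (f x))\<^sup>2 \<partial>M) \<le> c\<^sup>2"
  shows "cmod (\<integral>x. f x \<partial>M) \<le> c"
proof -
  have B: "0 \<le> B" using order_trans [OF norm_ge_zero b] .
  have i1: "integrable M (\<lambda>x. cmod (f x))"
    by (rule integrable_const_bound [where B = B]) (use b in auto)
  have i2: "integrable M (\<lambda>x. (cmod (f x))\<^sup>2)"
    by (rule integrable_const_bound [where B = "B\<^sup>2"]) (use power_mono [OF b norm_ge_zero] in auto)
  have "cmod (\<integral>x. f x \<partial>M) \<le> (\<integral>x. cmod (f x) \<partial>M)"
    by (rule integral_norm_bound)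
  also have "\<dots> \<le> (\<integral>x. (cmod (f x))\<^sup>2 * (1 / (2 * c)) + c / 2 \<partial>M)"
  proof (rule integral_mono)
    fix x
    have "0 \<le> (cmod (f x) - c)\<^sup>2" by simp
    then show "cmod (f x) \<le> (cmod (f x))\<^sup>2 * (1 / (2 * c)) + c / 2"
      using c(1) by (simp add: power2_eq_square field_simps)
  qed (use i1 i2 in auto)
  also have "\<dots> = (\<integral>x. (cmod (f x))\<^sup>2 \<partial>M) * (1 / (2 * c)) + c / 2"
    using i2 by (simp add: prob_space)
  also have "\<dots> \<le> c\<^sup>2 * (1 / (2 * c)) + c / 2"
    using c by (intro add_right_mono mult_right_mono) auto
  also have "\<dots> = c" using c(1) by (simp add: power2_eq_square)
  finally show ?thesis .
qed

lemma powr_of_power: "0 < x \<Longrightarrow> (x ^ n) powr a = x powr (real n * a)" for x :: real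
  by (simp add: powr_realpow [symmetric] powr_powr)

context letter_system
begin

text \<open>
The frequency has size t^24 and the denominators are at most t.  The threshold t^12 for the second
coordinate separates the two directions of integration.  With \<delta> = t^(-3), both the
neighbourhood of the root and the oscillating part contribute at most a multiple of 1/t.
\<close>

lemma pair_integral_decay:
  assumes t: "2 \<le> t" and m: "max \<bar>fst \<xi>\<bar> \<bar>snd \<xi>\<bar> = t ^ 24"
    and Q: "(68 * real R) ^ n \<le> t"
    and g: "admissible n g" and h: "admissible n h" and ne: "qa g \<noteq> qa h \<or> qb g \<noteq> qb h"
  shows "cmod (integral rect (\<lambda>z. exp2pi (phase g h \<xi> z))) \<le> 36 / t"
proof -
  define Q where "Q = (68 * real R) ^ n"
  have R68: "1 \<le> 68 * real R" using R_ge by simp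
  have Q1: "1 \<le> Q" "Q \<le> t" unfolding Q_def by (rule one_le_power [OF R68], rule Q)
  have t0: "0 < t" "1 \<le> t" using t by auto
  have tp: "0 < t ^ k" "1 \<le> t ^ k" for k using t0 by (auto intro: one_le_power)
  define \<delta> where "\<delta> = 1 / t ^ 3"
  have "1 < t ^ 3" using t by (intro one_less_power) auto
  note t3 = this
  have pow: "t ^ 12 = t ^ 2 * t ^ 3 * t ^ 7" "t ^ 24 = t ^ 3 * t ^ 3 * (t ^ 6 * t ^ 12)"
    "t ^ 24 = t ^ 3 * t ^ 3 * t ^ 18" "t ^ 24 = t ^ 3 * t ^ 3 * t ^ 6 * t ^ 12"
    by (simp_all only: power_add [symmetric]) simp_all
  have \<delta>: "0 < \<delta>" "\<delta> < 1"
    unfolding \<delta>_def using t3 tp(1) [of 3] by (simp_all only: zero_less_divide_1_iff pos_divide_less_eq mult_1)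
  have le_t: "t \<le> t ^ Suc k" for k using t0 tp [of k] by simp
  have \<delta>t: "2 * \<delta> \<le> 2 / t"
    unfolding \<delta>_def using le_t [of 2] t0 tp [of 3] by (simp add: frac_le)
  have inv: "1 / t ^ (Suc k) \<le> 1 / t" for k
    using le_t [of k] t0 by (intro divide_left_mono) auto
  show ?thesis
  proof (cases "t ^ 12 \<le> \<bar>snd \<xi>\<bar>")
    case True
    have "Q ^ 2 / (\<bar>snd \<xi>\<bar> * \<delta>) \<le> t ^ 2 / (t ^ 12 * \<delta>)"
      using True Q1 \<delta> tp by (intro frac_le mult_mono power_mono mult_pos_pos) auto
    also have "\<dots> = 1 / t ^ 7"
    proof -
      have "a / (a * b * c * (1 / b)) = 1 / c" if "a \<noteq> 0" "b \<noteq> 0" for a b c :: real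
        using that by simp
      note gen = this
      show ?thesis unfolding \<delta>_def pow(1) by (rule gen) (use t0 in simp_all)
    qed
    also have "\<dots> \<le> 1 / t" using inv [of 6] by simp
    finally have v: "Q ^ 2 / (\<bar>snd \<xi>\<bar> * \<delta>) \<le> 1 / t" .
    have nz: "snd \<xi> \<noteq> 0" using True tp [of 12] by auto
    have "cmod (integral rect (\<lambda>z. exp2pi (phase g h \<xi> z)))
        \<le> 2 * (Q ^ 2 / (\<bar>snd \<xi>\<bar> * \<delta>)) + 2 * \<delta>"
      by (rule pair_integral_vertical [OF g h ne \<delta> nz Q_def])
    also have "\<dots> \<le> 2 * (1 / t) + 2 / t"
      using v \<delta>t by linarith
    also have "\<dots> \<le> 36 / t" using t0 by (simp add: field_simps)
    finally show ?thesis .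
  next
    case False
    have t12: "t ^ 12 \<le> t ^ 24" using t0 by (intro power_increasing) auto
    then have x1: "\<bar>fst \<xi>\<bar> = t ^ 24" using m False by linarith
    have \<xi>0: "fst \<xi> \<noteq> 0" using x1 tp [of 24] by auto
    have Q3: "Q ^ 3 \<le> t ^ 3" "0 < Q ^ 3" using Q1 by (auto intro: power_mono)
    have "6 * t ^ 12 \<le> t ^ 6 * t ^ 12"
    proof (intro mult_right_mono)
      have "(2::real) ^ 6 \<le> t ^ 6" using t by (intro power_mono) auto
      then show "6 \<le> t ^ 6" by simp
    qed (use tp in auto)
    also have "\<dots> = t ^ 24 * \<delta> / t ^ 3"
    proof -
      have gen: "c = b * b * c * (1 / b) / b" if "b \<noteq> 0" for b c :: real
        using that by simp
      show ?thesis unfolding \<delta>_def pow(2) by (rule gen) (use t0 in simp)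
    qed
    also have "\<dots> \<le> t ^ 24 * \<delta> / Q ^ 3"
      using Q3 \<delta> tp t0 by (intro divide_left_mono mult_pos_pos) auto
    finally have s1: "6 * \<bar>snd \<xi>\<bar> \<le> \<bar>fst \<xi>\<bar> * \<delta> / Q ^ 3"
      using False x1 by simp
    have s2: "\<bar>snd \<xi>\<bar> \<le> \<bar>fst \<xi>\<bar>" using False x1 t12 by linarith
    have "Q ^ 3 / (t ^ 24 * \<delta>) \<le> t ^ 3 / (t ^ 24 * \<delta>)"
      using Q3 \<delta> tp t0 by (intro divide_right_mono) auto
    also have "\<dots> = 1 / t ^ 18"
    proof -
      have gen: "b / (b * b * c * (1 / b)) = 1 / c" if "b \<noteq> 0" for b c :: real
        using that by simp
      show ?thesis unfolding \<delta>_def pow(3) by (rule gen) (use t0 in simp)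
    qed
    also have "\<dots> \<le> 1 / t" using inv [of 17] by simp
    finally have e1: "Q ^ 3 / (t ^ 24 * \<delta>) \<le> 1 / t" .
    have "16 * Q ^ 6 / (t ^ 24 * \<delta>\<^sup>2) \<le> 16 * t ^ 6 / (t ^ 24 * \<delta>\<^sup>2)"
      using Q1 \<delta> tp t0 by (intro divide_right_mono mult_left_mono power_mono) auto
    also have "\<dots> = 16 * (1 / t ^ 12)"
    proof -
      have gen: "16 * a / (b * b * a * c * (1 / b * (1 / b))) = 16 * (1 / c)" if "a \<noteq> 0" "b \<noteq> 0" for a b c :: real
        using that by simp
      show ?thesis unfolding \<delta>_def power2_eq_square pow(4) by (rule gen) (use t0 in simp_all)
    qed
    also have "\<dots> \<le> 16 * (1 / t)" using inv [of 11] by simp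
    finally have e2: "16 * Q ^ 6 / (t ^ 24 * \<delta>\<^sup>2) \<le> 16 * (1 / t)" .
    have "cmod (integral rect (\<lambda>z. exp2pi (phase g h \<xi> z)))
        \<le> 2 * (Q ^ 3 / (t ^ 24 * \<delta>) + 16 * Q ^ 6 / (t ^ 24 * \<delta>\<^sup>2)) + 2 * \<delta>"
      using pair_integral_horizontal [OF g h ne \<delta> \<xi>0 Q_def s1 s2] unfolding x1 .
    also have "\<dots> \<le> 2 * (1 / t + 16 * (1 / t)) + 2 / t"
      by (intro add_mono mult_left_mono e1 e2 \<delta>t) simp_all
    also have "\<dots> = 36 / t" using t0 by (simp add: field_simps)
    finally show ?thesis .
  qed
qed

lemma mean_square_decay:
  assumes t: "2 \<le> t" and m: "max \<bar>fst \<xi>\<bar> \<bar>snd \<xi>\<bar> = t ^ 24"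
  obtains n where "integral rect (\<lambda>z. (cmod (trig_sum n \<xi> z / card G ^ n))\<^sup>2) \<le> 104 * real R / t"
proof -
  have R68: "1 < 68 * real R" using R_ge by simp
  have t0: "0 < t" using t by simp
  define P where "P = (\<lambda>n. t < (68 * real R) ^ n)"
  have ex: "\<exists>n. P n" using real_arch_pow [OF R68, of t] by (auto simp: P_def)
  obtain n where n: "t < (68 * real R) ^ Suc n" "\<not> t < (68 * real R) ^ n"
  proof (cases "LEAST n. P n")
    case 0
    then have "P 0" using LeastI_ex [OF ex] by simp
    then show ?thesis using t by (simp add: P_def)
  next
    case (Suc j)
    then have "P (Suc j)" "\<not> P j"
      using LeastI_ex [OF ex] not_less_Least [of j P] by auto
    then show ?thesis unfolding P_def by (rule that)
  qed
  have "integral rect (\<lambda>z. (cmod (trig_sum n \<xi> z / card G ^ n))\<^sup>2) \<le> 1 / (68 * real R) ^ n + 36 / t"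
  proof (rule trig_sum_mean_square)
    show "cmod (integral rect (\<lambda>z. exp2pi (phase g h \<xi> z))) \<le> 36 / t"
      if "admissible n g" "admissible n h" "qa g \<noteq> qa h \<or> qb g \<noteq> qb h" for g h
      using n(2) by (intro pair_integral_decay [OF t m _ that]) (simp only: not_less)
  qed (use t0 in simp)
  also have "1 / (68 * real R) ^ n \<le> 68 * real R / t"
    using n(1) t0 R68 by (simp add: field_simps)
  also have "68 * real R / t + 36 / t \<le> 104 * real R / t"
    using R_ge t0 by (simp add: field_simps)
  finally show ?thesis by (rule that) simp
qed

lemma trig_average_lipschitz:
  assumes z: "z \<in> rect" and w: "w \<in> rect"
  shows "cmod (trig_sum n \<xi> z / card G ^ n - trig_sum n \<xi> w / card G ^ n)
    \<le> 2 * pi * (max \<bar>fst \<xi>\<bar> \<bar>snd \<xi>\<bar> * (4 * ldist z w))"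
proof -
  define N where "N = real (card G) ^ n"
  have N0: "0 < N" using card_G_pos by (simp add: N_def)
  define L where "L = 2 * pi * (max \<bar>fst \<xi>\<bar> \<bar>snd \<xi>\<bar> * (4 * ldist z w))"
  have each: "cmod (exp2pi (- (\<xi> \<bullet> act (word v) z)) - exp2pi (- (\<xi> \<bullet> act (word v) w))) \<le> L"
    if v: "v \<in> words n" for v
  proof -
    have "cmod (exp2pi (- (\<xi> \<bullet> act (word v) z)) - exp2pi (- (\<xi> \<bullet> act (word v) w)))
        \<le> 2 * pi * \<bar>- (\<xi> \<bullet> act (word v) z) - - (\<xi> \<bullet> act (word v) w)\<bar>"
      by (rule exp2pi_lipschitz)
    also have "\<bar>- (\<xi> \<bullet> act (word v) z) - - (\<xi> \<bullet> act (word v) w)\<bar> = \<bar>\<xi> \<bullet> act (word v) z - \<xi> \<bullet> act (word v) w\<bar>"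
      by simp
    also have "\<dots> \<le> max \<bar>fst \<xi>\<bar> \<bar>snd \<xi>\<bar> * ldist (act (word v) z) (act (word v) w)"
      by (rule inner_abs_le_ldist)
    also have "\<dots> \<le> max \<bar>fst \<xi>\<bar> \<bar>snd \<xi>\<bar> * (4 * ldist z w)"
      by (intro mult_left_mono ldist_admissible [OF admissible_word [OF v]] z w) auto
    finally show ?thesis unfolding L_def by simp
  qed
  have "cmod (trig_sum n \<xi> z - trig_sum n \<xi> w) \<le> (\<Sum>v\<in>words n. L)"
    unfolding trig_sum_def sum_subtractf [symmetric] by (intro sum_norm_le each)
  also have "\<dots> = N * L" by (simp add: card_words N_def)
  finally have "cmod (trig_sum n \<xi> z - trig_sum n \<xi> w) / N \<le> L"
    using N0 by (simp add: field_simps)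
  then show ?thesis
    unfolding L_def by (simp add: N_def norm_divide norm_power flip: diff_divide_distrib)
qed

lemma fourier_stat_trig_sum: "fourier stationary \<xi> = (\<integral>z. trig_sum n \<xi> z / card G ^ n \<partial>stationary)"
proof -
  interpret prob_space stationary by (rule prob_space_stat)
  have [measurable]: "(\<lambda>z :: real \<times> real. exp2pi (- (\<xi> \<bullet> z))) \<in> borel_measurable borel"
    by (intro borel_measurable_continuous_onI continuous_intros)
  have "fourier stationary \<xi>
      = (\<Sum>w\<in>words n. \<integral>z. exp2pi (- (\<xi> \<bullet> act (word w) z)) \<partial>stationary) /\<^sub>R (card G ^ n)"
    unfolding fourier_def by (rule integral_stat_words [where B = 1]) auto
  also have "(\<Sum>w\<in>words n. \<integral>z. exp2pi (- (\<xi> \<bullet> act (word w) z)) \<partial>stationary)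
      = (\<integral>z. trig_sum n \<xi> z \<partial>stationary)"
    unfolding trig_sum_def
  proof (rule Bochner_Integration.integral_sum [symmetric])
    fix w
    have [measurable]: "(\<lambda>z. exp2pi (- (\<xi> \<bullet> act (word w) z))) \<in> borel_measurable borel"
      by (rule measurable_compose [OF measurable_act [of "word w"]]) measurable
    show "integrable stationary (\<lambda>z. exp2pi (- (\<xi> \<bullet> act (word w) z)))"
      by (rule integrable_const_bound [where B = 1]) auto
  qed
  finally show ?thesis
    by (simp add: scaleR_conv_of_real field_simps)
qed

text \<open>
Two scales are involved.  The word length n in the trigonometric sum is adapted to
X^(1/24), where X is the size of \<xi>, and makes the mean square smaller than a multiple of
t^(-1) = X^(-1/24).  The word length k in the comparison with Lebesgue measure is adapted to
X^2, so that the Lipschitz error is of order 1/X; by the assumption on R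
it costs at most a multiple of X^(1/48).  The product is X^(-1/48), and the square root gives X^(-1/96).
\<close>

lemma fourier_decay:
  assumes \<theta>: "16384 \<le> (32 * real R) powr (1/96)"
  obtains C where "0 < C" "\<And>\<xi>. 1 \<le> max \<bar>fst \<xi>\<bar> \<bar>snd \<xi>\<bar> \<Longrightarrow>
    cmod (fourier stationary \<xi>) \<le> C * max \<bar>fst \<xi>\<bar> \<bar>snd \<xi>\<bar> powr (- 1/96)"
proof -
  interpret prob_space stationary by (rule prob_space_stat)
  \<comment> \<open>The first summand comes from the mean square, the second bounds the Lipschitz error, as 16 \<pi> \<le> 64.\<close>
  define K where "K = 32 * 16384 * (104 * real R) + 64"
  have K0: "0 < K" using R_ge by (simp add: K_def)
  \<comment> \<open>The threshold makes t at least 2; below it the trivial bound 1 suffices.\<close>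
  have large: "cmod (fourier stationary \<xi>) \<le> K * X powr (- 1/96)"
    if X: "X = max \<bar>fst \<xi>\<bar> \<bar>snd \<xi>\<bar>" and big: "2 ^ 24 \<le> X" for \<xi> X
  proof -
    define t where "t = X powr (1/24)"
    have X0: "0 < X" "1 \<le> X" using big by auto
    have t24: "t ^ 24 = X"
      unfolding t_def using X0 by (subst powr_power) auto
    have t2: "2 \<le> t"
    proof (rule power_le_imp_le_base)
      show "2 ^ Suc 23 \<le> t ^ Suc 23" using big t24 by simp
    qed (simp add: t_def)
    have t0: "0 < t" "1 \<le> t" using t2 by auto
    have m: "max \<bar>fst \<xi>\<bar> \<bar>snd \<xi>\<bar> = t ^ 24" using X t24 by simp
    obtain n where n: "integral rect (\<lambda>z. (cmod (trig_sum n \<xi> z / card G ^ n))\<^sup>2) \<le> 104 * real R / t"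
      by (rule mean_square_decay [OF t2 m])
    define F where "F z = trig_sum n \<xi> z / card G ^ n" for z
    have F1: "cmod (F z) \<le> 1" for z
      using norm_trig_sum [of n \<xi> z] card_G_pos
      by (simp add: F_def norm_divide norm_power pos_divide_le_eq)
    have "(\<lambda>z :: real \<times> real. exp2pi (- (\<xi> \<bullet> z))) \<in> borel_measurable borel"
      by (intro borel_measurable_continuous_onI continuous_intros)
    then have trm: "(\<lambda>z. exp2pi (- (\<xi> \<bullet> act g z))) \<in> borel_measurable borel" for g
      by (rule measurable_compose [OF measurable_act [of g]])
    have F_meas [measurable]: "F \<in> borel_measurable borel"
      unfolding F_def [abs_def] trig_sum_def
      by (intro borel_measurable_divide borel_measurable_sum borel_measurable_const trm)
    have X2: "1 \<le> X\<^sup>2" using X0 by simp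
    have th: "0 < (1/96 :: real)" by simp
    obtain k where k: "X\<^sup>2 \<le> (32 * real R) ^ k" "16384 ^ k \<le> 16384 * (X\<^sup>2) powr (1/96)"
      by (rule cell_scale [OF X2 th \<theta>])
    have Rk: "0 < (32 * real R) ^ k" using R_ge by simp
    define s where "s = X powr (1/48)"
    have s0: "0 < s" using X0 by (simp add: s_def)
    have "(X\<^sup>2) powr (1/96) = s"
      using X0 by (simp add: s_def powr_of_power)
    with k(2) have k2: "16384 ^ k \<le> 16384 * s" by simp
    have st: "s * s = t"
      unfolding s_def t_def by (simp only: powr_add [symmetric]) simp
    have sX: "1 / X \<le> 1 / s"
    proof (intro divide_left_mono)
      have "X powr (1/48) \<le> X powr 1" using X0 by (intro powr_mono) auto
      then show "s \<le> X" using X0 by (simp add: s_def)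
    qed (use X0 s0 in auto)
    define I where "I = integral rect (\<lambda>z. (cmod (F z))\<^sup>2)"
    have contF: "continuous_on rect (\<lambda>z. (cmod (F z))\<^sup>2)"
      unfolding F_def by (intro continuous_intros continuous_on_trig_sum) (use card_G_pos in auto)
    have hasI: "((\<lambda>z. (cmod (F z))\<^sup>2) has_integral I) rect"
      unfolding I_def using contF unfolding rect_eq_cbox
      by (intro integrable_integral integrable_continuous)
    have I0: "0 \<le> I" unfolding I_def by (rule Henstock_Kurzweil_Integration.integral_nonneg) (use hasI in auto)
    have nnI: "(\<integral>\<^sup>+z. ennreal ((cmod (F z))\<^sup>2) * indicator rect z \<partial>lborel) = ennreal I"
      by (rule nn_integral_has_integral_lebesgue' [OF _ hasI]) auto
    have "(\<integral>z. (cmod (F z))\<^sup>2 \<partial>stationary) \<le> 32 * 16384 ^ k * I + 16 * pi / X"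
    proof (rule integral_stat_le [where C = 1 and f' = "\<lambda>z. (cmod (F z))\<^sup>2"])
      show "\<bar>(cmod (F z))\<^sup>2\<bar> \<le> 1" for z using F1 [of z] by (simp add: power_le_one)
      fix w a b assume w: "w \<in> words k" and a: "a \<in> rect" and b: "b \<in> rect"
      define x where "x = act (word w) a"
      define y where "y = act (word w) b"
      have xy: "x \<in> rect" "y \<in> rect"
        using admissibleD(8) [OF admissible_word [OF w]] a b by (auto simp: x_def y_def)
      have "ldist x y \<le> 1 / (32 * real R) ^ k"
        unfolding x_def y_def by (rule ldist_cell [OF admissible_word [OF w] a b])
      also have "\<dots> \<le> 1 / X\<^sup>2" using k(1) X0 Rk by (intro divide_left_mono mult_pos_pos) simp_all
      finally have d: "ldist x y \<le> 1 / X\<^sup>2" .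
      have "cmod (F x - F y) \<le> 2 * pi * (X * (4 * ldist x y))"
        unfolding F_def X by (rule trig_average_lipschitz [OF xy])
      also have "\<dots> \<le> 2 * pi * (X * (4 * (1 / X\<^sup>2)))"
        using d X0 by (intro mult_left_mono) auto
      also have "\<dots> = 8 * pi / X" using X0 by (simp add: power2_eq_square)
      finally have Fd: "cmod (F x - F y) \<le> 8 * pi / X" .
      have "(cmod (F x))\<^sup>2 - (cmod (F y))\<^sup>2 = (cmod (F x) - cmod (F y)) * (cmod (F x) + cmod (F y))"
        by (simp add: power2_eq_square algebra_simps)
      also have "\<dots> \<le> (8 * pi / X) * (cmod (F x) + cmod (F y))"
        using Fd norm_triangle_ineq2 [of "F x" "F y"] by (intro mult_right_mono) auto
      also have "\<dots> \<le> (8 * pi / X) * 2"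
        using F1 [of x] F1 [of y] X0 by (intro mult_left_mono) auto
      finally show "(cmod (F (act (word w) a)))\<^sup>2 \<le> (cmod (F (act (word w) b)))\<^sup>2 + 16 * pi / X"
        by (simp add: x_def y_def)
    qed (simp_all add: I0 nnI)
    also have "\<dots> \<le> 32 * (16384 * s) * (104 * real R / t) + 64 * (1 / X)"
    proof (intro add_mono mult_mono)
      show "I \<le> 104 * real R / t" using n by (simp add: I_def F_def)
      show "16 * pi / X \<le> 64 * (1 / X)" using pi_less_4 X0 by (simp add: field_simps)
    qed (use k2 I0 s0 in simp_all)
    also have "\<dots> \<le> 32 * (16384 * s) * (104 * real R / t) + 64 * (1 / s)"
      using sX by simp
    also have "\<dots> = K / s"
    proof -
      have "32 * (16384 * s) * (a / (s * s)) + 64 * (1 / s) = (32 * 16384 * a + 64) / s" for a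
        using s0 by (simp add: field_simps)
      then show ?thesis unfolding st K_def .
    qed
    also have "\<dots> \<le> (K * X powr (- 1/96))\<^sup>2"
    proof -
      have "X powr (- 1/96) * X powr (- 1/96) = X powr (- (1/48))"
        by (simp only: powr_add [symmetric]) simp
      then have "X powr (- 1/96) * X powr (- 1/96) = 1 / s"
        unfolding s_def powr_minus_divide .
      then have "(K * X powr (- 1/96))\<^sup>2 = K * K * (1 / s)"
        by (metis mult.assoc mult.left_commute power2_eq_square)
      then have "(K * X powr (- 1/96))\<^sup>2 = K * K / s" by simp
      moreover have "K * 1 \<le> K * K"
        using R_ge K0 by (intro mult_left_mono) (auto simp: K_def)
      ultimately show ?thesis using s0 by (simp add: divide_right_mono)
    qed
    finally have ms: "(\<integral>z. (cmod (F z))\<^sup>2 \<partial>stationary) \<le> (K * X powr (- 1/96))\<^sup>2" .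
    have "cmod (\<integral>z. F z \<partial>stationary) \<le> K * X powr (- 1/96)"
      by (rule norm_integral_le_sqrt_mean_square [where B = 1]) (use F1 ms K0 X0 F_meas in auto)
    then show ?thesis
      unfolding F_def fourier_stat_trig_sum [of \<xi> n] .
  qed
  show ?thesis
  proof (rule that [of "K"])
    fix \<xi> :: "real \<times> real" assume one: "1 \<le> max \<bar>fst \<xi>\<bar> \<bar>snd \<xi>\<bar>"
    define X where "X = max \<bar>fst \<xi>\<bar> \<bar>snd \<xi>\<bar>"
    show "cmod (fourier stationary \<xi>) \<le> K * max \<bar>fst \<xi>\<bar> \<bar>snd \<xi>\<bar> powr (- 1/96)"
    proof (cases "2 ^ 24 \<le> X")
      case True
      then show ?thesis using large [OF X_def] by (simp add: X_def)
    next
      case False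
      have "cmod (fourier stationary \<xi>) \<le> (\<integral>z. cmod (exp2pi (- (\<xi> \<bullet> z))) \<partial>stationary)"
        unfolding fourier_def by (rule integral_norm_bound)
      also have "\<dots> = 1" using prob_space by simp
      finally have le1: "cmod (fourier stationary \<xi>) \<le> 1" .
      have X1: "1 \<le> X" using one by (simp add: X_def)
      have "X powr (1/96) \<le> (2 ^ 24) powr (1/96)" using False X1 by (intro powr_mono2) auto
      also have "(2 ^ 24) powr (1/96) = (2::real) powr (1/4)"
        by (simp only: powr_of_power zero_less_numeral) simp
      also have "\<dots> \<le> 2 powr 1" by (intro powr_mono) auto
      finally have "X powr (1/96) \<le> K" using R_ge by (simp add: K_def)
      then have "1 \<le> K * X powr (- 1/96)"
        using X1 by (simp add: powr_minus_divide field_simps)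
      then show ?thesis using le1 by (simp add: X_def)
    qed
  qed (rule K0)
qed

end

section \<open>A concrete alphabet\<close>

lemma card_multiples_le:
  assumes d: "0 < d"
  shows "card {x \<in> {m<..n}. d dvd x} \<le> n div d - m div d"
proof -
  have "{x \<in> {m<..n}. d dvd x} \<subseteq> (\<lambda>k. d * k) ` {m div d<..n div d}"
  proof
    fix x assume "x \<in> {x \<in> {m<..n}. d dvd x}"
    then obtain k where k: "x = d * k" "m < d * k" "d * k \<le> n" by auto
    have "m div d < k" using k d by (metis div_less_iff_less_mult mult.commute)
    moreover have "k \<le> n div d" using k d by (metis less_eq_div_iff_mult_less_eq mult.commute)
    ultimately show "x \<in> (\<lambda>k. d * k) ` {m div d<..n div d}" using k by auto
  qed
  then have "card {x \<in> {m<..n}. d dvd x} \<le> card {m div d<..n div d}"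
    by (rule surj_card_le [rotated]) simp
  then show ?thesis by simp
qed

text \<open>
Telescoping: 1 / (n + 1)^2 \<le> 1 / n - 1 / (n + 1).
\<close>

lemma sum_inverse_squares_le: "(\<Sum>d=2..n. 1 / real d ^ 2) \<le> 3/4"
proof -
  have main: "(\<Sum>d=2..n. 1 / real d ^ 2) \<le> 3/4 - 1 / real n" if "2 \<le> n"
    using that
  proof (induction n rule: nat_induct_at_least)
    case base
    then show ?case by simp
  next
    case (Suc n)
    have "1 / real (Suc n) ^ 2 \<le> 1 / real n - 1 / real (Suc n)"
    proof -
      have n: "0 < real n" using Suc.hyps by simp
      have "1 / real (Suc n) ^ 2 \<le> 1 / (real n * real (Suc n))"
        unfolding power2_eq_square using n by (intro divide_left_mono mult_right_mono mult_pos_pos) auto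
      also have "\<dots> = 1 / real n - 1 / real (Suc n)"
        using n by (simp add: field_simps)
      finally show ?thesis .
    qed
    then show ?case using Suc by simp
  qed
  show ?thesis
  proof (cases "2 \<le> n")
    case True
    have "3/4 - 1 / real n \<le> 3/4" by simp
    with main [OF True] show ?thesis by (rule order_trans)
  qed simp
qed

definition coprime_pairs :: "nat \<Rightarrow> (nat \<times> nat) set" where
  "coprime_pairs R = {(a, b). a \<in> {1..R} \<and> b \<in> {32 * R<..64 * R} \<and> coprime a b}"

lemma finite_coprime_pairs: "finite (coprime_pairs R)"
  by (rule finite_subset [of _ "{1..R} \<times> {32 * R<..64 * R}"]) (auto simp: coprime_pairs_def)

text \<open>
Of the 32 R^2 pairs, those with common divisor d number at most 33 R^2 / d^2 for each d
from 2 to R, and the sum of 1 / d^2 over d \<ge> 2 is below 3/4.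
\<close>

lemma card_coprime_pairs: "7 * R ^ 2 \<le> card (coprime_pairs R)"
proof -
  define S where "S = {1..R} \<times> {32 * R<..64 * R}"
  define D where "D d = {x \<in> {0<..R}. d dvd x} \<times> {x \<in> {32 * R<..64 * R}. d dvd x}" for d
  have S: "finite S" "card S = 32 * R ^ 2" by (simp_all add: S_def power2_eq_square)
  have sub: "S - coprime_pairs R \<subseteq> (\<Union>d\<in>{2..R}. D d)"
  proof
    fix z assume z: "z \<in> S - coprime_pairs R"
    obtain a b where ab: "z = (a, b)" by (cases z)
    have a: "1 \<le> a" "a \<le> R" and b: "b \<in> {32 * R<..64 * R}" and nc: "\<not> coprime a b"
      using z by (auto simp: ab S_def coprime_pairs_def)
    define g where "g = gcd a b"
    have "g \<noteq> 1" using nc by (simp add: g_def coprime_iff_gcd_eq_1)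
    moreover have "g \<noteq> 0" using a by (simp add: g_def)
    moreover have "g \<le> a" using a by (auto simp: g_def intro: dvd_imp_le)
    ultimately have "g \<in> {2..R}" using a by auto
    moreover have "z \<in> D g" using a b by (auto simp: ab D_def g_def)
    ultimately show "z \<in> (\<Union>d\<in>{2..R}. D d)" by blast
  qed
  have card_D: "real (card (D d)) \<le> 33 * real R ^ 2 * (1 / real d ^ 2)" if d: "d \<in> {2..R}" for d
  proof -
    have d0: "0 < d" "0 < real d" using d by auto
    have 1: "real (card {x \<in> {0<..R}. d dvd x}) \<le> R / d"
    proof -
      have "real (card {x \<in> {0<..R}. d dvd x}) \<le> real (R div d - 0 div d)"
        by (intro of_nat_mono card_multiples_le d0)
      also have "\<dots> \<le> R / d" using of_nat_div_le_of_nat [of R d, where ?'a = real] by simp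
      finally show ?thesis .
    qed
    have 2: "real (card {x \<in> {32 * R<..64 * R}. d dvd x}) \<le> 33 * R / d"
    proof -
      have "real (card {x \<in> {32 * R<..64 * R}. d dvd x}) \<le> real (64 * R div d - 32 * R div d)"
        by (intro of_nat_mono card_multiples_le d0)
      also have "\<dots> = real (64 * R div d) - real (32 * R div d)"
        by (intro of_nat_diff div_le_mono) simp
      also have "\<dots> \<le> (64 * R) / d - ((32 * R) / d - 1)"
      proof (intro diff_mono)
        show "real (64 * R div d) \<le> (64 * R) / d"
          using of_nat_div_le_of_nat [of "64 * R" d, where ?'a = real] by simp
        have "32 * R < d + (32 * R) div d * d" using d0 by (intro dividend_less_div_times)
        then have "real (32 * R) < real (d + (32 * R) div d * d)" by (simp only: of_nat_less_iff)
        then have "real (32 * R) < real d * (real (32 * R div d) + 1)" by (simp add: algebra_simps)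
        then show "(32 * R) / d - 1 \<le> real (32 * R div d)"
          using d0 by (simp add: field_simps)
      qed
      also have "\<dots> = 32 * R / d + 1" by (simp add: field_simps)
      also have "\<dots> \<le> 33 * R / d" using d d0 by (simp add: field_simps)
      finally show ?thesis .
    qed
    have "real (card (D d)) = real (card {x \<in> {0<..R}. d dvd x}) * real (card {x \<in> {32 * R<..64 * R}. d dvd x})"
      by (simp add: D_def card_cartesian_product)
    also have "\<dots> \<le> (R / d) * (33 * R / d)"
      using 1 2 by (intro mult_mono) auto
    also have "\<dots> = 33 * real R ^ 2 * (1 / real d ^ 2)"
      by (simp add: power2_eq_square)
    finally show ?thesis .
  qed
  have "real (card (S - coprime_pairs R)) \<le> real (card (\<Union>d\<in>{2..R}. D d))"
    using sub by (intro of_nat_mono card_mono) (auto simp: D_def)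
  also have "\<dots> \<le> real (\<Sum>d\<in>{2..R}. card (D d))"
    by (intro of_nat_mono card_UN_le) simp
  also have "\<dots> \<le> (\<Sum>d=2..R. 33 * real R ^ 2 * (1 / real d ^ 2))"
    unfolding of_nat_sum by (intro sum_mono card_D)
  also have "\<dots> = 33 * real R ^ 2 * (\<Sum>d=2..R. 1 / real d ^ 2)"
    by (simp add: sum_distrib_left)
  also have "\<dots> \<le> 33 * real R ^ 2 * (3/4)"
    by (intro mult_left_mono sum_inverse_squares_le) simp
  also have "\<dots> \<le> 25 * real R ^ 2" by simp
  finally have "real (card (S - coprime_pairs R)) \<le> real (25 * R ^ 2)" by simp
  then have bad: "card (S - coprime_pairs R) \<le> 25 * R ^ 2" by (simp only: of_nat_le_iff)
  have "coprime_pairs R \<subseteq> S" by (auto simp: coprime_pairs_def S_def)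
  then have "card (S - coprime_pairs R) = card S - card (coprime_pairs R)"
    by (intro card_Diff_subset finite_coprime_pairs)
  then show ?thesis using bad S by linarith
qed

text \<open>
The residue q with a q = -1 modulo b, which makes (a q + 1) / b an integer and completes (a, b) to
a matrix of determinant one.
\<close>

definition neg_inverse :: "int \<Rightarrow> int \<Rightarrow> int" where
  "neg_inverse a b = (SOME q. 0 \<le> q \<and> q < b \<and> b dvd a * q + 1)"

lemma neg_inverse:
  assumes "coprime a b" "0 < b"
  shows "0 \<le> neg_inverse a b" "neg_inverse a b < b" "b dvd a * neg_inverse a b + 1"
proof -
  obtain x y where xy: "a * x + b * y = 1"
    using assms(1) bezout_int [of a b] by (auto simp: coprime_iff_gcd_eq_1 mult.commute)
  define q where "q = (- x) mod b"
  have "a * q + 1 = a * (q + x) + b * y"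
    using xy by (simp add: algebra_simps)
  moreover have "b dvd q + x"
  proof -
    have "q = - x - b * ((- x) div b)" by (simp add: q_def minus_mult_div_eq_mod [symmetric])
    then have "q + x = b * (- ((- x) div b))" by simp
    then show ?thesis by (metis dvd_triv_left)
  qed
  ultimately have "b dvd a * q + 1" by simp
  then have "\<exists>q. 0 \<le> q \<and> q < b \<and> b dvd a * q + 1"
    using assms(2) by (intro exI [of _ q]) (auto simp: q_def)
  from someI_ex [OF this] show "0 \<le> neg_inverse a b" "neg_inverse a b < b" "b dvd a * neg_inverse a b + 1"
    by (auto simp: neg_inverse_def)
qed

text \<open>
The fraction a / b is the image of 0.  The entry u = b div 2 + j places the image
near height 1/2, with j selecting the height, and the other translation entry is q u / b rounded
down, which keeps the slope of the map between 0 and 2.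
\<close>

definition letter :: "nat \<Rightarrow> nat \<Rightarrow> nat \<Rightarrow> pmap" where
  "letter a b j = (let q = neg_inverse a b; u = int b div 2 + j in
     PMap ((a * q + 1) div b) a q b (q * u div b) u)"

definition letters :: "nat \<Rightarrow> pmap set" where
  "letters R = (\<lambda>((a, b), j). letter a b j) ` (coprime_pairs R \<times> {..<4 * R})"

lemma letter_entries:
  assumes R: "10 \<le> R" and ab: "(a, b) \<in> coprime_pairs R" and j: "j < 4 * R"
  defines "g \<equiv> letter a b j"
  shows "pb g = int a" "qb g = int b" "ub g = int b div 2 + int j" "ua g = qa g * ub g div int b"
    "qa g = neg_inverse a b" "pa g = (a * qa g + 1) div b"
    and "pa g * qb g - pb g * qa g = 1" "0 \<le> pa g" "pa g \<le> pb g" "0 \<le> qa g" "qa g < qb g"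
    and "1 \<le> a" "a \<le> R" "32 * R < b" "b \<le> 64 * R" "coprime a b"
proof -
  show e: "pb g = int a" "qb g = int b" "ub g = int b div 2 + int j" "ua g = qa g * ub g div int b"
    "qa g = neg_inverse a b" "pa g = (a * qa g + 1) div b"
    by (simp_all add: g_def letter_def Let_def)
  show p: "1 \<le> a" "a \<le> R" "32 * R < b" "b \<le> 64 * R" "coprime a b"
    using ab by (auto simp: coprime_pairs_def)
  have b0: "0 < int b" using p by simp
  have "coprime (int a) (int b)" using p by simp
  note q = neg_inverse [OF this b0, folded e(5)]
  show "0 \<le> qa g" "qa g < qb g" using q e(2) by auto
  have pb: "pa g * int b = a * qa g + 1" using q(3) e(6) by simp
  then show "pa g * qb g - pb g * qa g = 1" by (simp add: e(1,2))
  show "0 \<le> pa g" unfolding e(6) using q(1) b0 by (intro pos_imp_zdiv_nonneg_iff [THEN iffD2]) auto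
  have "pa g * int b \<le> int a * (int b - 1) + 1"
    unfolding pb using q(2) by (intro add_right_mono mult_left_mono) auto
  also have "\<dots> \<le> int a * int b" using p(1) by (simp add: algebra_simps)
  finally show "pa g \<le> pb g" using b0 e(1) by simp
qed

text \<open>
Writing r for the remainder of q u modulo b, the slope is (r + q y) / den, which is at most 2 since
r, q < b \<le> den and y \<le> 1.  The same remainder gives the height of the image as u / b plus a
positive correction of at most 1 / den.
\<close>

lemma letter_geometry:
  assumes R: "10 \<le> R" and ab: "(a, b) \<in> coprime_pairs R" and j: "j < 4 * R"
    and x: "x \<in> {0..1/16}"
  defines "g \<equiv> letter a b j"
  shows "real b \<le> den g x" "den g x \<le> 68 * real R"
    and "0 \<le> mob g x - a / b" "mob g x - a / b \<le> 1 / (16 * real b ^ 2)"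
    and "y \<in> {1/4..3/4} \<Longrightarrow> 0 \<le> slope g (x, y) \<and> slope g (x, y) \<le> 2"
    and "y \<in> {1/4..3/4} \<Longrightarrow> snd (act g (x, y)) \<in> {1/4..3/4}"
proof -
  note e = letter_entries [OF R ab j, folded g_def]
  have b0: "0 < real b" "320 \<le> real b" using e(14) R by auto
  have qx: "0 \<le> qa g * x" using e(10) x by simp
  have qb: "real_of_int (qa g) < b" using e(2,11) by (metis of_int_less_iff of_int_of_nat_eq)
  show D1: "real b \<le> den g x" unfolding den_def using qx e(2) by simp
  have "qa g * x \<le> real b * (1/16)" using qb x e(10) by (intro mult_mono) auto
  moreover have b64: "real b \<le> 64 * R" using e(15) by linarith
  ultimately show "den g x \<le> 68 * real R" unfolding den_def e(2) by simp
  have D0: "0 < den g x" using D1 b0 by linarith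
  have "mob g x - mob g 0 = (x - 0) / (den g x * den g 0)"
    by (rule mob_diff [OF _ _ e(7)]) (use D0 b0 e(2) in \<open>auto simp: den_def\<close>)
  then have mx: "mob g x - a / b = x / (den g x * b)"
    by (simp add: mob_def [of g 0] den_def [of g 0] e(1,2))
  show "0 \<le> mob g x - a / b" unfolding mx using x D0 b0 by simp
  have "x / (den g x * b) \<le> (1/16) / (b * b)"
    using x D1 b0 by (intro frac_le mult_mono mult_pos_pos) auto
  then show "mob g x - a / b \<le> 1 / (16 * real b ^ 2)"
    unfolding mx by (simp add: power2_eq_square)
  define r where "r = (qa g * ub g) mod int b"
  have r: "0 \<le> real_of_int r" "real_of_int r \<le> b"
  proof -
    have "0 < int b" using b0 by simp
    then have "0 \<le> r" "r < int b" by (auto simp: r_def)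
    then show "0 \<le> real_of_int r" by simp
    show "real_of_int r \<le> b" using \<open>r < int b\<close> by (metis less_imp_le of_int_le_iff of_int_of_nat_eq)
  qed
  have "qa g * ub g = ua g * int b + r" by (simp add: r_def e(4))
  then have "real_of_int (qa g * ub g) = real_of_int (ua g * int b + r)" by (rule arg_cong)
  then have qu: "real_of_int (qa g) * ub g = ua g * b + r" by simp
  assume y: "y \<in> {1/4..3/4}"
  have Y: "snd (act g (x, y)) * den g x = ua g * x + ub g + y"
    using D0 by (simp add: act_def)
  have "slope g (x, y) * den g x = qa g * (snd (act g (x, y)) * den g x) - ua g * den g x"
    by (simp add: slope_def algebra_simps)
  also have "\<dots> = real_of_int (qa g) * ub g + qa g * y - ua g * b"
    unfolding Y unfolding den_def e(2) by (simp add: algebra_simps)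
  finally have "slope g (x, y) * den g x = r + qa g * y" by (simp add: qu)
  then have sl: "slope g (x, y) = (r + qa g * y) / den g x" using D0 by (simp add: field_simps)
  have qy: "0 \<le> qa g * y" "qa g * y \<le> b * 1"
    using e(10) y qb mult_mono [of "real_of_int (qa g)" "real b" y 1] by simp_all
  have "(r + qa g * y) / den g x \<le> 2"
    using r qy D1 D0 by (simp add: pos_divide_le_eq)
  then show "0 \<le> slope g (x, y) \<and> slope g (x, y) \<le> 2"
    unfolding sl using r qy D0 by simp
  have "(ua g * x + ub g + y) * b = ub g * den g x + (b * y - r * x)"
  proof -
    have "ub g * den g x = x * (real_of_int (qa g) * ub g) + ub g * b"
      by (simp add: den_def e(2) algebra_simps)
    then show ?thesis unfolding qu by (simp add: algebra_simps)
  qed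
  then have "snd (act g (x, y)) * den g x * b = ub g * den g x + (b * y - r * x)"
    using Y by simp
  then have Y': "snd (act g (x, y)) = ub g / b + (b * y - r * x) / (den g x * b)"
    using D0 b0 by (simp add: field_simps)
  have rx: "0 \<le> r * x" "r * x \<le> b * (1/16)"
    using r x mult_mono [of "real_of_int r" "real b" x "1/16"] by simp_all
  have bY: "real b * (1/4) \<le> b * y" "b * y \<le> real b * 1" using y by (intro mult_left_mono; simp)+
  have small: "0 \<le> (b * y - r * x) / (den g x * b)" "(b * y - r * x) / (den g x * b) \<le> 1 / 320"
  proof -
    have byrx: "0 \<le> b * y - r * x" "b * y - r * x \<le> b" using rx bY b0 by linarith+
    show "0 \<le> (b * y - r * x) / (den g x * b)"
      using byrx(1) D0 b0 by (intro divide_nonneg_nonneg) auto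
    have "(b * y - r * x) / (den g x * b) \<le> b / (den g x * b)"
      using byrx(2) D0 b0 by (intro divide_right_mono) auto
    also have "\<dots> = 1 / den g x" using b0 by simp
    also have "\<dots> \<le> 1 / 320" using D1 b0 by (intro divide_left_mono) auto
    finally show "(b * y - r * x) / (den g x * b) \<le> 1 / 320" .
  qed
  have "int b - 1 \<le> 2 * ub g" "2 * ub g \<le> int b + 8 * int R" using e(3) j by linarith+
  then have "real_of_int (int b - 1) \<le> real_of_int (2 * ub g)" "real_of_int (2 * ub g) \<le> real_of_int (int b + 8 * int R)"
    by (simp_all only: of_int_le_iff)
  then have ub: "(real b - 1) / 2 \<le> real_of_int (ub g)" "ub g \<le> b / 2 + 4 * R"
    by simp_all
  have "32 * real R \<le> b" using e(14) by linarith
  then have "ub g \<le> b * (5/8)" using ub(2) by simp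
  moreover have "b * (1/4) \<le> ub g" using ub(1) b0(2) by (simp add: field_simps)
  ultimately have "1/4 \<le> ub g / b" "ub g / b \<le> 5/8" using b0 by (simp_all add: field_simps)
  then show "snd (act g (x, y)) \<in> {1/4..3/4}" using small unfolding Y' atLeastAtMost_iff by linarith
qed

text \<open>
Two different reduced fractions with denominators at most 64 R are at least 1 / (64 R)^2 apart,
while the Moebius images extend only 1 / (16 (32 R)^2) beyond their fractions.  The factor 16,
from the width of the rectangle, beats the factor 4 lost between 32 R and 64 R.
\<close>

lemma letter_mob_disjoint:
  assumes R: "10 \<le> R" and ab: "(a, b) \<in> coprime_pairs R" and j: "j < 4 * R"
    and cd: "(c, d) \<in> coprime_pairs R" and i: "i < 4 * R"
    and x: "x \<in> {0..1/16}" and y: "y \<in> {0..1/16}" and eq: "mob (letter a b j) x = mob (letter c d i) y"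
  shows "a = c \<and> b = d"
proof (rule ccontr)
  assume ne: "\<not> (a = c \<and> b = d)"
  note e = letter_entries [OF R ab j] and f = letter_entries [OF R cd i]
  have "a * d \<noteq> c * b"
  proof
    assume eq: "a * d = c * b"
    have "b dvd d" using e(16) eq by (metis coprime_commute coprime_dvd_mult_right_iff dvd_triv_right)
    moreover have "d dvd b" using f(16) eq by (metis coprime_commute coprime_dvd_mult_right_iff dvd_triv_right)
    ultimately have "b = d" by (rule dvd_antisym)
    then show False using ne eq e(14) by auto
  qed
  then have "1 \<le> \<bar>int (a * d) - int (c * b)\<bar>" by linarith
  then have "real_of_int 1 \<le> real_of_int \<bar>int (a * d) - int (c * b)\<bar>" by (simp only: of_int_le_iff)
  then have one: "1 \<le> \<bar>real a * d - real c * b\<bar>" by simp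
  define B where "B = 32 * real R"
  have B0: "0 < B" using R by (simp add: B_def)
  have b: "B \<le> b" "real b \<le> 2 * B" "B \<le> d" "real d \<le> 2 * B" 
    using e(14,15) f(14,15) by (auto simp: B_def)
  have b0: "0 < real b" "0 < real d" using b B0 by linarith+
  have near: "\<bar>a / b - c / d\<bar> \<le> 1 / (16 * B ^ 2)"
  proof -
    have "1 / (16 * real b ^ 2) \<le> 1 / (16 * B ^ 2)" "1 / (16 * real d ^ 2) \<le> 1 / (16 * B ^ 2)"
      using b B0 by (auto intro!: divide_left_mono mult_left_mono power_mono mult_pos_pos)
    then show ?thesis
      using letter_geometry(3,4) [OF R ab j x] letter_geometry(3,4) [OF R cd i y] eq by linarith
  qed
  have "a / b - c / d = (real a * d - real c * b) / (real b * real d)"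
    using b0 by (simp add: field_simps)
  then have "\<bar>a / b - c / d\<bar> = \<bar>real a * d - real c * b\<bar> / (real b * real d)"
    using b0 by (simp add: abs_mult)
  moreover have "1 / ((2 * B) * (2 * B)) \<le> \<bar>real a * d - real c * b\<bar> / (real b * real d)"
  proof (rule frac_le)
    show "real b * real d \<le> (2 * B) * (2 * B)"
      using b b0 B0 by (intro mult_mono) simp_all
  qed (use one b0 in auto)
  ultimately have "1 / ((2 * B) * (2 * B)) \<le> 1 / (16 * B ^ 2)" using near by linarith
  then show False using B0 by (simp add: field_simps power2_eq_square)
qed

text \<open>
For letters with the same Moebius part, disjointness comes from the translation rows: increasing j
raises u x + u' by at least 1, since the rounding is monotone, while the rectangle has
height 1/2.
\<close>

lemma letter_system_letters:
  assumes R: "10 \<le> R"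
  shows "letter_system R (letters R)"
proof unfold_locales
  show "10 \<le> R" by (rule R)
  show "finite (letters R)"
    unfolding letters_def using finite_coprime_pairs by auto
  have inj: "inj_on (\<lambda>((a, b), j). letter a b j) (coprime_pairs R \<times> {..<4 * R})"
  proof (rule inj_onI)
    fix s t assume st: "s \<in> coprime_pairs R \<times> {..<4 * R}" "t \<in> coprime_pairs R \<times> {..<4 * R}"
      and eq: "(\<lambda>((a, b), j). letter a b j) s = (\<lambda>((a, b), j). letter a b j) t"
    obtain a b j where s: "s = ((a, b), j)" by (cases s, cases "fst s") simp
    obtain c d i where t: "t = ((c, d), i)" by (cases t, cases "fst t") simp
    have "letter a b j = letter c d i" using eq s t by simp
    then show "s = t"
      using letter_entries(1-3) [OF R, of a b j] letter_entries(1-3) [OF R, of c d i] st s t by auto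
  qed
  have "card (letters R) = card (coprime_pairs R) * (4 * R)"
    unfolding letters_def card_image [OF inj] by (simp add: card_cartesian_product)
  moreover have "7 * R ^ 2 * (4 * R) \<le> card (coprime_pairs R) * (4 * R)"
    by (intro mult_le_mono1 card_coprime_pairs)
  ultimately show "28 * R ^ 3 \<le> card (letters R)"
    by (simp add: power2_eq_square power3_eq_cube)
next
  fix m :: "int \<times> int \<times> int \<times> int"
  obtain p a q b where m: "m = (p, a, q, b)" by (cases m)
  have "{g \<in> letters R. mob_entries g = m} \<subseteq> (\<lambda>j. letter (nat a) (nat b) j) ` {..<4 * R}"
  proof
    fix g assume "g \<in> {g \<in> letters R. mob_entries g = m}"
    then obtain c d j where g: "g = letter c d j" "(c, d) \<in> coprime_pairs R" "j < 4 * R" "mob_entries g = m"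
      by (auto simp: letters_def)
    then have "nat a = c" "nat b = d"
      using letter_entries(1,2) [OF R g(2,3)] m by (auto simp: mob_entries_def)
    then show "g \<in> (\<lambda>j. letter (nat a) (nat b) j) ` {..<4 * R}" using g by auto
  qed
  then have "card {g \<in> letters R. mob_entries g = m} \<le> card {..<4 * R}"
    by (rule surj_card_le [OF finite_lessThan])
  then show "card {g \<in> letters R. mob_entries g = m} \<le> 4 * R" by simp
next
  fix g assume "g \<in> letters R"
  then obtain a b j where g: "g = letter a b j" "(a, b) \<in> coprime_pairs R" "j < 4 * R"
    by (auto simp: letters_def)
  note e = letter_entries [OF R g(2,3), folded g(1)] and geo = letter_geometry [OF R g(2,3), folded g(1)]
  show "pa g * qb g - pb g * qa g = 1" by (rule e)
  show "0 \<le> pa g \<and> pa g \<le> pb g" "0 \<le> qa g \<and> qa g \<le> qb g" using e(8-11) by auto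
  have b: "32 * real R \<le> b" "0 < real b" "320 \<le> real b" using e(14) R by auto
  show "32 * real R \<le> den g x \<and> den g x \<le> 68 * real R" if "x \<in> {0..1/16}" for x
    using geo(1,2) [OF that] b by auto
  show "act g z \<in> rect" if z: "z \<in> rect" for z
  proof -
    have x: "fst z \<in> {0..1/16}" and y: "snd z \<in> {1/4..3/4}" using z by (auto simp: rect_iff)
    have "real a \<le> R" using e(13) by simp
    then have "a / b \<le> 1/32" "0 \<le> a / b" using b by (simp_all add: divide_le_eq)
    moreover have "1 / (16 * real b ^ 2) \<le> 1 / 32"
    proof (intro divide_left_mono)
      have "2 * 1 \<le> real b * real b" using b by (intro mult_mono) auto
      then show "32 \<le> 16 * real b ^ 2" by (simp add: power2_eq_square)
    qed (use b in auto)
    ultimately have "mob g (fst z) \<in> {0..1/16}"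
      using geo(3,4) [OF x] unfolding atLeastAtMost_iff by linarith
    then show ?thesis using geo(6) [OF x y] by (simp add: rect_iff)
  qed
  show "0 \<le> slope g z \<and> slope g z \<le> 2" if z: "z \<in> rect" for z
    using geo(5) [of "fst z" "snd z"] z by (simp add: rect_iff)
next
  fix g h z w
  assume gh: "g \<in> letters R" "h \<in> letters R" and zw: "z \<in> rect" "w \<in> rect" and eq: "act g z = act h w"
  obtain a b j where g: "g = letter a b j" "(a, b) \<in> coprime_pairs R" "j < 4 * R"
    using gh(1) by (auto simp: letters_def)
  obtain c d i where h: "h = letter c d i" "(c, d) \<in> coprime_pairs R" "i < 4 * R"
    using gh(2) by (auto simp: letters_def)
  note e = letter_entries [OF R g(2,3), folded g(1)] and f = letter_entries [OF R h(2,3), folded h(1)]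
  have x: "fst z \<in> {0..1/16}" "fst w \<in> {0..1/16}" using zw by (auto simp: rect_iff)
  have meq: "mob g (fst z) = mob h (fst w)" using arg_cong [OF eq, of fst] by simp
  have same: "a = c" "b = d"
    using letter_mob_disjoint [OF R g(2,3) h(2,3) x meq [unfolded g(1) h(1)]] by simp_all
  have q: "qa g = qa h" "pa g = pa h" unfolding e(6) f(6) e(5) f(5) same by (rule refl)+
  then have mats: "mob_entries g = mob_entries h" unfolding mob_entries_def e(1,2) f(1,2) same by simp
  have "mob h = mob g" by (rule mob_cong_entries [OF mats [symmetric]])
  have b0: "0 < real b" using e(14) by simp
  have D: "0 < den g (fst z)" "0 < den g (fst w)"
    using letter_geometry(1) [OF R g(2,3) x(1), folded g(1)]
      letter_geometry(1) [OF R g(2,3) x(2), folded g(1)] b0 by linarith+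
  have "(fst z - fst w) / (den g (fst z) * den g (fst w)) = 0"
    using mob_diff [OF _ _ e(7), of "fst z" "fst w"] D meq \<open>mob h = mob g\<close> by simp
  then have xeq: "fst z = fst w" using D by auto
  have dens: "den g = den h" unfolding den_def [abs_def] e(2) f(2) q(1) same by (rule refl)
  have Y: "ua g * fst z + ub g + snd z = ua h * fst z + ub h + snd w"
  proof -
    have "(ua g * fst z + ub g + snd z) / den g (fst z) = (ua h * fst z + ub h + snd w) / den g (fst z)"
      using arg_cong [OF eq, of snd] unfolding act_def xeq dens by simp
    then show ?thesis using D(1) by simp
  qed
  have mono: "ua k \<le> ua l" if "ub k \<le> ub l" "qa k = qa l" "ua k = qa k * ub k div int b" "ua l = qa l * ub l div int b" "0 \<le> qa l"
    for k l
  proof -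
    have "qa k * ub k \<le> qa l * ub l" unfolding that(2) by (rule mult_left_mono [OF that(1,5)])
    then show ?thesis unfolding that(3,4) using b0 by (intro zdiv_mono1) simp_all
  qed
  have half: "\<bar>snd z - snd w\<bar> < 1" using zw by (auto simp: rect_iff)
  have False if lt: "ub k + 1 \<le> ub l" "ua k \<le> ua l" "ua k * fst z + ub k + s = ua l * fst z + ub l + t" "\<bar>s - t\<bar> < 1"
    for k l and s t :: real
  proof -
    have "real_of_int (ub k + 1) \<le> ub l" using lt(1) by (simp only: of_int_le_iff)
    moreover have "ua k * fst z \<le> ua l * fst z" using lt(2) x by (intro mult_right_mono) auto
    ultimately show False using lt(3,4) by (simp add: abs_if split: if_splits)
  qed
  note no = this
  have "ub g = ub h"
  proof (rule linorder_cases [of "ub g" "ub h"])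
    assume l: "ub g < ub h"
    have "ua g \<le> ua h" by (rule mono) (use l q(1) e(4) f(4,10) same in simp_all)
    from no [OF _ this Y half] l show ?thesis by simp
  next
    assume l: "ub h < ub g"
    have mono': "ua h \<le> ua g" by (rule mono) (use l q(1) e(4,10) f(4) same in simp_all)
    have half': "\<bar>snd w - snd z\<bar> < 1" using half by (simp only: abs_minus_commute)
    from no [OF _ mono' Y [symmetric] half'] l show ?thesis by simp
  qed
  then have "i = j" unfolding e(3) f(3) same by simp
  then show "g = h" using g(1) h(1) same by simp
next
  fix g h x y
  assume gh: "g \<in> letters R" "h \<in> letters R" and xy: "x \<in> {0..1/16}" "y \<in> {0..1/16}" and eq: "mob g x = mob h y"
  obtain a b j where g: "g = letter a b j" "(a, b) \<in> coprime_pairs R" "j < 4 * R"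
    using gh(1) by (auto simp: letters_def)
  obtain c d i where h: "h = letter c d i" "(c, d) \<in> coprime_pairs R" "i < 4 * R"
    using gh(2) by (auto simp: letters_def)
  note e = letter_entries [OF R g(2,3), folded g(1)] and f = letter_entries [OF R h(2,3), folded h(1)]
  have same: "a = c" "b = d"
    using letter_mob_disjoint [OF R g(2,3) h(2,3) xy eq [unfolded g(1) h(1)]] by simp_all
  show "mob_entries g = mob_entries h"
    unfolding mob_entries_def e(1,2) f(1,2) e(6) f(6) e(5) f(5) same by (rule refl)
qed

section \<open>Uniform constants\<close>

text \<open>
The two entries K^2 and K have different orders, so that the transposed map on integer frequencies
enlarges every nonzero frequency, including those with m = 0 and those with n = 0.
\<close>

definition shear :: "nat \<Rightarrow> real \<times> real \<Rightarrow> real \<times> real" where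
  "shear K z = (real K ^ 2 * fst z, snd z + real K * fst z)"

lemma continuous_on_shear: "continuous_on UNIV (shear K)"
  unfolding shear_def by (intro continuous_intros)

lemma measurable_shear [measurable]: "shear K \<in> borel_measurable borel"
  by (rule borel_measurable_continuous_onI [OF continuous_on_shear])

text \<open>
The new first coordinate is K (K m + n).  If |n| < K, then K m + n is a nonzero integer of size
at least |m|.  If |n| \<ge> K, then |n| itself is large enough unless |m| > n^2, and in that case
K^2 m dominates K n.
\<close>

lemma shear_frequency:
  fixes m n :: int
  assumes K: "2 \<le> K" and mn: "m \<noteq> 0 \<or> n \<noteq> 0"
  defines "F \<equiv> max \<bar>K\<^sup>2 * m + K * n\<bar> \<bar>n\<bar>"
  shows "K \<le> F" "max \<bar>m\<bar> \<bar>n\<bar> \<le> F\<^sup>2"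
proof -
  have eq: "\<bar>K\<^sup>2 * m + K * n\<bar> = K * \<bar>K * m + n\<bar>"
  proof -
    have "K\<^sup>2 * m + K * n = K * (K * m + n)" by (simp add: power2_eq_square algebra_simps)
    then show ?thesis using K by (simp add: abs_mult)
  qed
  have "K \<le> F \<and> max \<bar>m\<bar> \<bar>n\<bar> \<le> F\<^sup>2"
  proof (cases "\<bar>n\<bar> < K")
    case small: True
    have "1 \<le> \<bar>K * m + n\<bar> \<and> max \<bar>m\<bar> \<bar>n\<bar> \<le> K * \<bar>K * m + n\<bar>"
    proof (cases "m = 0")
      case True
      have "1 * \<bar>n\<bar> \<le> K * \<bar>n\<bar>" using K by (intro mult_right_mono) auto
      then show ?thesis using True mn by auto
    next
      case False
      have "0 \<le> (K - 1) * (\<bar>m\<bar> - 1)" using K False by (intro mult_nonneg_nonneg) auto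
      then have "\<bar>m\<bar> + K - 1 \<le> K * \<bar>m\<bar>" by (simp add: algebra_simps)
      moreover have "K * \<bar>m\<bar> - \<bar>n\<bar> \<le> \<bar>K * m + n\<bar>"
      proof -
        have "\<bar>K * m\<bar> = K * \<bar>m\<bar>" using K by (simp add: abs_mult)
        then show ?thesis by linarith
      qed
      ultimately have ge: "\<bar>m\<bar> \<le> \<bar>K * m + n\<bar>" using small by linarith
      then have "K * \<bar>m\<bar> \<le> K * \<bar>K * m + n\<bar>" using K by (intro mult_left_mono) auto
      moreover have "K * 1 \<le> K * \<bar>m\<bar>" using False K by (intro mult_left_mono) auto
      moreover have "1 * \<bar>m\<bar> \<le> K * \<bar>m\<bar>" using K by (intro mult_right_mono) auto
      ultimately have "\<bar>m\<bar> \<le> K * \<bar>K * m + n\<bar>" "\<bar>n\<bar> \<le> K * \<bar>K * m + n\<bar>"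
        using small by linarith+
      moreover have "1 \<le> \<bar>K * m + n\<bar>" using ge False by linarith
      ultimately show ?thesis by (simp only: max.bounded_iff)
    qed
    then have 1: "1 \<le> \<bar>K * m + n\<bar>" and 2: "max \<bar>m\<bar> \<bar>n\<bar> \<le> K * \<bar>K * m + n\<bar>" by auto
    have "K * 1 \<le> K * \<bar>K * m + n\<bar>" using 1 K by (intro mult_left_mono) auto
    moreover have "K * \<bar>K * m + n\<bar> \<le> F" by (simp add: F_def eq)
    ultimately have "K \<le> F" "max \<bar>m\<bar> \<bar>n\<bar> \<le> F" using 2 by auto
    moreover have "F * 1 \<le> F * F" using \<open>K \<le> F\<close> K by (intro mult_left_mono) auto
    ultimately show ?thesis by (simp add: power2_eq_square)
  next
    case False
    then have nK: "K \<le> \<bar>n\<bar>" by simp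
    have nF: "\<bar>n\<bar> \<le> F" by (simp add: F_def)
    have n2: "\<bar>n\<bar> * \<bar>n\<bar> \<le> F * F" using nF by (intro mult_mono) auto
    have FF: "F * 1 \<le> F * F" using nF nK K by (intro mult_left_mono) auto
    show ?thesis
    proof (cases "\<bar>m\<bar> \<le> \<bar>n\<bar> * \<bar>n\<bar>")
      case True
      then show ?thesis using n2 nF nK FF by (simp add: power2_eq_square)
    next
      case False
      have "K * \<bar>n\<bar> \<le> \<bar>n\<bar> * \<bar>n\<bar>" using nK by (intro mult_right_mono) auto
      then have Kn: "K * \<bar>n\<bar> \<le> \<bar>m\<bar>" using False by linarith
      have "2 * \<bar>m\<bar> \<le> K\<^sup>2 * \<bar>m\<bar>"
      proof (intro mult_right_mono)
        have "2 * 1 \<le> K * K" using K by (intro mult_mono) auto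
        then show "2 \<le> K\<^sup>2" by (simp add: power2_eq_square)
      qed simp
      moreover have "\<bar>K\<^sup>2 * m\<bar> = K\<^sup>2 * \<bar>m\<bar>" "\<bar>K * n\<bar> = K * \<bar>n\<bar>" using K by (simp_all add: abs_mult)
      ultimately have "\<bar>m\<bar> \<le> \<bar>K\<^sup>2 * m + K * n\<bar>" using Kn by linarith
      then have "\<bar>m\<bar> \<le> F" by (simp add: F_def)
      then show ?thesis using nF nK FF by (simp add: power2_eq_square)
    qed
  qed
  then show "K \<le> F" "max \<bar>m\<bar> \<bar>n\<bar> \<le> F\<^sup>2" by auto
qed

context letter_system
begin

lemma sheared_support:
  assumes K: "2 \<le> K"
  shows "prob_measure_supported_on (distr stationary borel (shear K)) Bad_pairs"
proof -
  interpret prob_space stationary by (rule prob_space_stat)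
  have meas: "shear K \<in> measurable stationary borel" by simp
  have P: "prob_space (distr stationary borel (shear K))"
    by (rule prob_space_distr [OF meas])
  have "AE z in stationary. shear K z \<in> Bad_pairs"
  proof (rule AE_stat)
    show "shear K (limit_point \<omega>) \<in> Bad_pairs" if "\<omega> \<in> streams G" for \<omega>
      unfolding shear_def by (rule uniformly_bad_shear [OF limit_point_bad [OF that] K])
    have "shear K -` Bad_pairs \<in> sets borel"
      using measurable_sets [OF measurable_shear sets_Bad_pairs] by simp
    then show "{z. shear K z \<in> Bad_pairs} \<in> sets borel" by (simp add: vimage_def)
  qed
  then have "AE z in distr stationary borel (shear K). z \<in> Bad_pairs"
    using sets_Bad_pairs by (subst AE_distr_iff [OF meas]) auto
  then have "measure (distr stationary borel (shear K)) Bad_pairs = 1"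
    using sets_Bad_pairs by (subst prob_space.prob_eq_1 [OF P]) auto
  with P show ?thesis by (simp add: prob_measure_supported_on_def)
qed

text \<open>
The preimage of a ball of radius r has diameter at most 6 r, since the inverse of the shear is
bounded independently of K.
\<close>

lemma sheared_frostman:
  assumes K: "2 \<le> K" and fr: "\<And>x r. 0 < r \<Longrightarrow> measure stationary (cball x r) \<le> c * r powr s"
    and r: "0 < r"
  shows "measure (distr stationary borel (shear K)) (cball x r) \<le> c * 6 powr s * r powr s"
proof -
  interpret prob_space stationary by (rule prob_space_stat)
  have "measure (distr stationary borel (shear K)) (cball x r) = measure stationary (shear K -` cball x r)"
    by (subst measure_distr) auto
  also have "\<dots> \<le> c * (6 * r) powr s"
  proof (cases "shear K -` cball x r = {}")
    case True
    have "0 \<le> c * (6 * r) powr s" using order_trans [OF measure_nonneg fr [of "6 * r"]] r by simp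
    then show ?thesis using True by simp
  next
    case False
    then obtain z where "z \<in> shear K -` cball x r" by blast
    then have z: "shear K z \<in> cball x r" by (rule vimageD)
    have "shear K -` cball x r \<subseteq> cball z (6 * r)"
    proof
      fix w assume "w \<in> shear K -` cball x r"
      then have d: "dist (shear K z) (shear K w) \<le> 2 * r"
        using z dist_triangle3 [of "shear K z" "shear K w" x] by auto
      have "\<bar>real K ^ 2 * fst z - real K ^ 2 * fst w\<bar> \<le> 2 * r"
        using order_trans [OF dist_fst_le d] by (simp add: shear_def dist_real_def)
      then have "real K ^ 2 * \<bar>fst z - fst w\<bar> \<le> 2 * r"
        by (simp add: abs_mult flip: right_diff_distrib)
      moreover have "real K * \<bar>fst z - fst w\<bar> \<le> real K ^ 2 * \<bar>fst z - fst w\<bar>" "\<bar>fst z - fst w\<bar> \<le> real K * \<bar>fst z - fst w\<bar>"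
        using K by (auto intro!: mult_right_mono simp: power2_eq_square mult_le_cancel_right1)
      ultimately have x1: "real K * \<bar>fst z - fst w\<bar> \<le> 2 * r" "\<bar>fst z - fst w\<bar> \<le> 2 * r" by linarith+
      have "\<bar>(snd z + real K * fst z) - (snd w + real K * fst w)\<bar> \<le> 2 * r"
        using order_trans [OF dist_snd_le d] by (simp add: shear_def dist_real_def)
      moreover have "(snd z + real K * fst z) - (snd w + real K * fst w) = (snd z - snd w) + real K * (fst z - fst w)"
        by (simp add: algebra_simps)
      moreover have "\<bar>real K * (fst z - fst w)\<bar> \<le> 2 * r" using x1 by (simp add: abs_mult)
      ultimately have "\<bar>snd z - snd w\<bar> \<le> 4 * r" by linarith
      then have "ldist z w \<le> 6 * r" using x1 by (simp add: ldist_def)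
      then show "w \<in> cball z (6 * r)" using order_trans [OF dist_le_ldist] by auto
    qed
    then have "measure stationary (shear K -` cball x r) \<le> measure stationary (cball z (6 * r))"
      by (intro finite_measure_mono) auto
    also have "\<dots> \<le> c * (6 * r) powr s" using r by (intro fr) simp
    finally show ?thesis .
  qed
  also have "\<dots> = c * 6 powr s * r powr s" using r by (simp add: powr_mult)
  finally show ?thesis .
qed

lemma sheared_fourier:
  "fourier (distr stationary borel (shear K)) (real_of_int m, real_of_int n)
    = fourier stationary (real_of_int (int K ^ 2 * m + int K * n), real_of_int n)"
proof -
  have [measurable]: "(\<lambda>z :: real \<times> real. exp2pi (- ((real_of_int m, real_of_int n) \<bullet> z))) \<in> borel_measurable borel"
    by (intro borel_measurable_continuous_onI continuous_intros)
  have "fourier (distr stationary borel (shear K)) (real_of_int m, real_of_int n)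
      = (\<integral>z. exp2pi (- ((real_of_int m, real_of_int n) \<bullet> shear K z)) \<partial>stationary)"
    unfolding fourier_def by (rule integral_distr) simp_all
  also have "(\<lambda>z. (real_of_int m, real_of_int n) \<bullet> shear K z)
      = (\<lambda>z. (real_of_int (int K ^ 2 * m + int K * n), real_of_int n) \<bullet> z)"
    by (simp add: fun_eq_iff shear_def inner_prod_def algebra_simps)
  then have "(\<integral>z. exp2pi (- ((real_of_int m, real_of_int n) \<bullet> shear K z)) \<partial>stationary)
      = fourier stationary (real_of_int (int K ^ 2 * m + int K * n), real_of_int n)"
    unfolding fourier_def by (metis (no_types, lifting))
  finally show ?thesis .
qed

text \<open>
The new frequency has size f \<ge> K with f^2 \<ge> X.  Half of the decay, f^(-1/192), cancels C, and the
other half is at most X^(-1/384).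
\<close>

lemma sheared_fourier_decay:
  assumes K: "2 \<le> K" and C: "0 < C" "C \<le> real K powr (1/192)"
    and dec: "\<And>\<xi>. 1 \<le> max \<bar>fst \<xi>\<bar> \<bar>snd \<xi>\<bar> \<Longrightarrow>
      cmod (fourier stationary \<xi>) \<le> C * max \<bar>fst \<xi>\<bar> \<bar>snd \<xi>\<bar> powr (- 1/96)"
  shows "cmod (fourier (distr stationary borel (shear K)) (real_of_int m, real_of_int n))
    \<le> 2 * (1 + infnorm (real_of_int m, real_of_int n)) powr (- (1/384))"
proof (cases "m = 0 \<and> n = 0")
  case True
  interpret prob_space stationary by (rule prob_space_stat)
  have "cmod (fourier stationary \<xi>) \<le> (\<integral>z. cmod (exp2pi (- (\<xi> \<bullet> z))) \<partial>stationary)" for \<xi>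
    unfolding fourier_def by (rule integral_norm_bound)
  then have le1: "cmod (fourier stationary \<xi>) \<le> 1" for \<xi>
    using prob_space by simp
  have "cmod (fourier stationary \<xi>) \<le> 2" for \<xi>
    by (rule order_trans [OF le1]) simp
  then show ?thesis using True unfolding sheared_fourier by (simp add: infnorm_real_pair)
next
  case False
  define F where "F = max \<bar>int K ^ 2 * m + int K * n\<bar> \<bar>n\<bar>"
  define X where "X = real_of_int (max \<bar>m\<bar> \<bar>n\<bar>)"
  have F: "int K \<le> F" "max \<bar>m\<bar> \<bar>n\<bar> \<le> F\<^sup>2"
    using shear_frequency [of "int K" m n] K False by (auto simp: F_def)
  define f where "f = real_of_int F"
  have "real_of_int (int K) \<le> f" unfolding f_def using F(1) by (simp only: of_int_le_iff)
  then have fK: "real K \<le> f" by simp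
  have fX: "X \<le> f ^ 2"
    unfolding X_def f_def using F(2) by (simp only: of_int_power [symmetric] of_int_le_iff)
  have X1: "1 \<le> X"
  proof -
    have "1 \<le> max \<bar>m\<bar> \<bar>n\<bar>" using False by auto
    then show ?thesis unfolding X_def by (simp only: of_int_1_le_iff)
  qed
  have f2: "2 \<le> f" "0 < real K" using fK K by auto
  have X_eq: "infnorm (real_of_int m, real_of_int n) = X"
    by (simp add: infnorm_real_pair X_def of_int_max)
  have fmax: "f = max \<bar>real_of_int (int K ^ 2 * m + int K * n)\<bar> \<bar>real_of_int n\<bar>"
    by (simp only: f_def F_def of_int_max of_int_abs)
  have "cmod (fourier (distr stationary borel (shear K)) (real_of_int m, real_of_int n)) \<le> C * f powr (- 1/96)"
    unfolding sheared_fourier fmax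
    using dec [of "(real_of_int (int K ^ 2 * m + int K * n), real_of_int n)"] f2(1) unfolding fmax fst_conv snd_conv
    by linarith
  also have "\<dots> \<le> f powr (1/192) * f powr (- 1/96)"
  proof (intro mult_right_mono)
    have "real K powr (1/192) \<le> f powr (1/192)" using fK by (intro powr_mono2) auto
    then show "C \<le> f powr (1/192)" using C by linarith
  qed simp
  also have "\<dots> = f powr (- (1/192))"
    by (simp only: powr_add [symmetric]) simp
  also have "\<dots> = (f ^ 2) powr (- (1/384))"
    using f2 by (simp add: powr_of_power)
  also have "\<dots> \<le> X powr (- (1/384))"
    using fX X1 by (intro powr_mono2') auto
  also have "\<dots> \<le> 2 * (1 + X) powr (- (1/384))"
  proof -
    have "(1 + X) powr (1/384) \<le> (2 * X) powr (1/384)" using X1 by (intro powr_mono2) auto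
    also have "\<dots> = 2 powr (1/384) * X powr (1/384)" using X1 by (simp add: powr_mult)
    also have "\<dots> \<le> 2 * X powr (1/384)"
    proof (intro mult_right_mono)
      have "(2::real) powr (1/384) \<le> 2 powr 1" by (intro powr_mono) auto
      then show "(2::real) powr (1/384) \<le> 2" by simp
    qed simp
    finally have le: "(1 + X) powr (1/384) \<le> 2 * X powr (1/384)" .
    have "0 < X powr (1/384)" "0 < (1 + X) powr (1/384)" using X1 by auto
    with le show ?thesis by (simp add: powr_minus_divide field_simps)
  qed
  finally show ?thesis unfolding X_eq .
qed

end

theorem theorem1p1:
  shows "\<exists>\<eta>>0::real. \<exists>C>0::real. \<forall>s\<in>{0<..<2::real}. \<exists>c>0::real.
    \<exists>\<nu> :: (real \<times> real) measure.
      prob_measure_supported_on \<nu> Bad_pairs \<and>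
      (\<forall>x r. 0 < r \<longrightarrow> measure \<nu> (cball x r) \<le> c * r powr s) \<and>
      (\<forall>m n :: int. cmod (fourier \<nu> (of_int m, of_int n))
          \<le> C * (1 + infnorm (real_of_int m, real_of_int n)) powr (- \<eta>))"
proof (rule exI [of _ "1/384"], intro conjI, simp, rule exI [of _ 2], intro conjI ballI, simp)
  fix s :: real assume "s \<in> {0<..<2}"
  then have s: "0 < s" "s < 2" by auto
  define \<theta> where "\<theta> = min (1/96) (2 - s)"
  have \<theta>: "0 < \<theta>" "\<theta> \<le> 1/96" "s \<le> 2 - \<theta>" using s unfolding \<theta>_def by linarith+
  \<comment> \<open>The loss 16384 per letter is at most the power \<theta> of the contraction once 32 R exceeds 16384^(1/\<theta>).\<close>
  obtain R :: nat where R: "max 10 (16384 powr (1/\<theta>)) \<le> real R"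
    using real_arch_simple by blast
  then have R10: "10 \<le> R" by simp
  have "16384 powr (1/\<theta>) \<le> 32 * real R" using R by simp
  then have "(16384 powr (1/\<theta>)) powr \<theta> \<le> (32 * real R) powr \<theta>"
    using \<theta>(1) by (intro powr_mono2) auto
  then have R\<theta>: "16384 \<le> (32 * real R) powr \<theta>"
    using \<theta>(1) by (simp add: powr_powr)
  also have "\<dots> \<le> (32 * real R) powr (1/96)"
    using \<theta>(2) R10 by (intro powr_mono) auto
  finally have R96: "16384 \<le> (32 * real R) powr (1/96)" .
  interpret letter_system R "letters R" by (rule letter_system_letters [OF R10])
  obtain C where C: "0 < C" and dec: "\<And>\<xi>. 1 \<le> max \<bar>fst \<xi>\<bar> \<bar>snd \<xi>\<bar> \<Longrightarrow>
      cmod (fourier stationary \<xi>) \<le> C * max \<bar>fst \<xi>\<bar> \<bar>snd \<xi>\<bar> powr (- 1/96)"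
    using fourier_decay [OF R96] by blast
  \<comment> \<open>With K \<ge> C^192, the power 1/192 of the smallest new frequency pays for C.\<close>
  obtain K :: nat where K: "max 2 (C powr 192) \<le> real K"
    using real_arch_simple by blast
  then have K2: "2 \<le> K" by simp
  have "C powr 192 \<le> real K" using K by simp
  then have "(C powr 192) powr (1/192) \<le> real K powr (1/192)"
    using C by (intro powr_mono2) auto
  then have KC: "C \<le> real K powr (1/192)" unfolding powr_powr using C by simp
  have fr: "measure stationary (cball x r) \<le> (512 * 16384) * r powr s" if "0 < r" for x r
    using frostman [OF \<theta>(1) R\<theta> s(1) \<theta>(3) that] .
  show "\<exists>c>0::real. \<exists>\<nu> :: (real \<times> real) measure.
      prob_measure_supported_on \<nu> Bad_pairs \<and>
      (\<forall>x r. 0 < r \<longrightarrow> measure \<nu> (cball x r) \<le> c * r powr s) \<and>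
      (\<forall>m n :: int. cmod (fourier \<nu> (of_int m, of_int n))
          \<le> 2 * (1 + infnorm (real_of_int m, real_of_int n)) powr (- (1/384)))"
  proof (intro exI conjI allI impI)
    show "prob_measure_supported_on (distr stationary borel (shear K)) Bad_pairs"
      by (rule sheared_support [OF K2])
    show "measure (distr stationary borel (shear K)) (cball x r) \<le> 512 * 16384 * 6 powr s * r powr s"
      if "0 < r" for x r
      by (rule sheared_frostman [OF K2 fr that])
    show "cmod (fourier (distr stationary borel (shear K)) (of_int m, of_int n))
          \<le> 2 * (1 + infnorm (real_of_int m, real_of_int n)) powr (- (1/384))" for m n :: int
      by (rule sheared_fourier_decay [OF K2 C KC dec])
  qed simp
qed

end
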